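(* Let $m,N\in\mathbb{N}$ with $N+1\ge m$, let $a<b$ be real, $h=\frac{b-a}{N}$, and let $\omega\in\mathbb{R}$ with $\omega h\notin\mathbb{Z}$. Then the coefficients of the optimal quadrature formula in the sense of Sard of the form $$\int_a^b e^{2\pi i\omega x}\varphi(x)\,dx\cong\sum_{\beta=0}^N C_{\beta,\omega}[a,b]\,\varphi(h\beta+a)$$ in the space $L_2^{(m)}[a,b]$ are expressed by $$\mathring{C}_{0,\omega}[a,b]=h\left(\frac{e^{2\pi i\omega(a+h)}K_{\omega,m}}{e^{2\pi i\omega h}-1}-\frac{e^{2\pi i\omega a}}{2\pi i\omega h}+\sum_{k=1}^{m-1}\left(a_k\frac{q_k}{q_k-1}+b_k\frac{q_k^N}{1-q_k}\right)\right),$$ $$\mathring{C}_{\beta,\omega}[a,b]=h\left(e^{2\pi i\omega(h\beta+a)}K_{\omega,m}+\sum_{k=1}^{m-1}\left(a_kq_k^\beta+b_kq_k^{N-\beta}\right)\right),\quad\beta=1,2,\dots,N-1,$$ $$\mathring{C}_{N,\omega}[a,b]=h\left(\frac{e^{2\pi i\omega b}K_{\omega,m}}{1-e^{2\pi i\omega h}}+\frac{e^{2\pi i\omega b}}{2\pi i\omega h}+\sum_{k=1}^{m-1}\left(a_k\frac{q_k^N}{1-q_k}+b_k\frac{q_k}{q_k-1}\right)\right),$$ where $a_k,b_k$ ($k=1,\dots,m-1$) are defined by the following system of $2m-2$ linear equations: for $j=1,2,\dots,m-1$, $$\sum_{k=1}^{m-1}a_k\left[\sum_{t=1}^{j}\frac{q_k\Delta^t0^j}{(q_k-1)^{t+1}}\right]+\sum_{k=1}^{m-1}b_k\left[\sum_{t=1}^j\frac{q_k^{N+t}\Delta^t0^{j}}{(1-q_k)^{t+1}}\right]=\frac{j!\,e^{2\pi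 i\omega a}}{(2\pi i\omega h)^{j+1}}-\sum_{t=1}^j\frac{e^{2\pi i\omega(a+h)}K_{\omega,m}\Delta^t0^j}{(e^{2\pi i\omega h}-1)^{t+1}},$$ and, for $j=1,2,\dots,m-1$, $$\begin{aligned} &\sum_{k=1}^{m-1}a_k\left[\sum_{t=1}^j\frac{q_k^t\Delta^t0^j}{(1-q_k)^{t+1}}-\sum_{\alpha=1}^{j}\left(\tfrac{h}{b-a}\right)^{\alpha-j}\binom{j}{\alpha}\sum_{t=1}^{\alpha}\frac{q_k^{N+t}\Delta^t0^{\alpha}}{(1-q_k)^{t+1}}\right]\\ &+\sum_{k=1}^{m-1}b_k\left[\sum_{t=1}^j\frac{q_k^{N+1}\Delta^t0^j}{(q_k-1)^{t+1}}-\sum_{\alpha=1}^{j}\left(\tfrac{h}{b-a}\right)^{\alpha-j}\binom{j}{\alpha}\sum_{t=1}^{\alpha}\frac{q_k\Delta^t0^{\alpha}}{(q_k-1)^{t+1}}\right]\\ &=\frac{(-1)^{j+1}j!\,e^{2\pi i\omega a}}{(2\pi i\omega h)^{j+1}}+\sum_{\alpha=1}^{j}\left(\tfrac{h}{b-a}\right)^{\alpha-j}\frac{(-1)^{\alpha}j!\,e^{2\pi i\omega b}}{(j-\alpha)!(2\pi i\omega h)^{\alpha+1}}\\ &\quad-\frac{K_{\omega,m}e^{2\pi i\omega a}}{1-e^{2\pi i\omega h}}\sum_{t=1}^j\left(\frac{e^{2\pi i\omega h}}{1-e^{2\pi i\omega h}}\right)^t\Delta^t0^j\\ &\quad+\frac{K_{\omega,m}e^{2\pi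 i\omega b}}{1-e^{2\pi i\omega h}}\sum_{\alpha=1}^{j}\left(\tfrac{h}{b-a}\right)^{\alpha-j}\binom{j}{\alpha}\sum_{t=1}^{\alpha}\left(\frac{e^{2\pi i\omega h}}{1-e^{2\pi i\omega h}}\right)^t\Delta^t0^\alpha . \end{aligned}$$ Here $q_1,\dots,q_{m-1}$ are the roots of the Euler-Frobenius polynomial $E_{2m-2}(x)$ with $|q_k|<1$, and $$K_{\omega,m}=\left(\frac{\sin \pi\omega h}{\pi\omega h}\right)^{2m}\frac{(2m-1)!}{2\sum_{\alpha=0}^{m-2}\mathrm{a}_{\alpha}\cos[2\pi\omega h(m-1-\alpha)]+\mathrm{a}_{m-1}},$$ where $\mathrm{a}_{\alpha}=\sum_{j=0}^{\alpha}(-1)^j\binom{2m}{j}(\alpha+1-j)^{2m-1}$ are the coefficients of $E_{2m-2}(x)=\sum_{s=0}^{2m-2}\mathrm{a}_sx^s$.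
   Context: $i^2=-1$. $L_2^{(m)}[a,b]$ is the Sobolev space of complex-valued functions on $[a,b]$ having an absolutely continuous $(m-1)$-th derivative on $[a,b]$ and square integrable $m$-th derivative, with inner product $\langle\varphi,\psi\rangle=\int_a^b\varphi^{(m)}(x)\overline{\psi^{(m)}(x)}\,dx$ and (semi)norm $\|\varphi\|_{L_2^{(m)}[a,b]}=\langle\varphi,\varphi\rangle^{1/2}$. For nodes $x_\beta=h\beta+a$, the error functional of a quadrature formula $\int_a^b e^{2\pi i\omega x}\varphi(x)\,dx\cong\sum_{\beta=0}^NC_\beta\varphi(x_\beta)$ (with $C_\beta\in\mathbb{C}$) is $(\ell,\varphi)=\int_a^b e^{2\pi i\omega x}\varphi(x)\,dx-\sum_{\beta=0}^NC_\beta\varphi(x_\beta)$. It is required that $(\ell,x^\alpha)=0$ for $\alpha=0,1,\dots,m-1$, so that $\ell$ is a bounded functional with norm $\|\ell\|_{L_2^{(m)*}[a,b]}=\sup\{|(\ell,\varphi)|:\|\varphi\|_{L_2^{(m)}[a,b]}\le1\}$. The formula is optimal in the sense of Sard, with optimal coefficients denoted $\mathring{C}$, if these coefficients minimize $\|\ell\|_{L_2^{(m)*}[a,b]}$ over all coefficient vectors $(C_0,\dots,C_N)$ satisfying these conditions, the nodes being fixed. The Euler-Frobenius polynomials are $E_k(x)=\frac{(1-x)^{k+2}}{x}\left(x\frac{d}{dx}\right)^k\frac{x}{(1-x)^2}$, $k=0,1,2,\dots$; $E_k$ has degree $k$, its roots are real, negative and distinct, and $E_{2m-2}$ has exactly $m-1$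 roots with absolute value less than $1$. $\Delta^t0^j=\sum_{l=1}^t(-1)^{t-l}\binom{t}{l}l^j$ for $t,j\ge1$. Empty sums are zero. *)

theory Defs
  imports "HOL-Analysis.Analysis" "HOL-Computational_Algebra.Polynomial"
begin

section \<open>The Sobolev space\<close>

definition abs_continuous_on :: "real \<Rightarrow> real \<Rightarrow> (real \<Rightarrow> complex) \<Rightarrow> bool" where
  "abs_continuous_on a b f \<longleftrightarrow>
     (\<forall>\<epsilon>>0. \<exists>\<delta>>0. \<forall>S :: (real \<times> real) set.
        finite S \<longrightarrow>
        (\<forall>(u, v)\<in>S. a \<le> u \<and> u < v \<and> v \<le> b) \<longrightarrow>
        pairwise (\<lambda>(u, v) (u', v'). {u<..<v} \<inter> {u'<..<v'} = {}) S \<longrightarrow>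
        (\<Sum>(u, v)\<in>S. v - u) < \<delta> \<longrightarrow>
        (\<Sum>(u, v)\<in>S. cmod (f v - f u)) < \<epsilon>)"

text \<open>The derivatives are taken within \<open>[a, b]\<close>, so they are one-sided at the end points and do
  not depend on the values outside the interval.\<close>

definition iter_deriv :: "real \<Rightarrow> real \<Rightarrow> nat \<Rightarrow> (real \<Rightarrow> complex) \<Rightarrow> real \<Rightarrow> complex" where
  "iter_deriv a b k \<phi> = ((\<lambda>f x. vector_derivative f (at x within {a..b})) ^^ k) \<phi>"

text \<open>An absolutely continuous function is differentiable almost everywhere, so the third
  conjunct is not a restriction; it is spelled out because the derivative of order \<open>m\<close> is
  only an almost everywhere derivative, and \<^const>\<open>vector_derivative\<close> is unspecified
  at the exceptional points.\<close>

definition sobolev_space :: "nat \<Rightarrow> real \<Rightarrow> real \<Rightarrow> (real \<Rightarrow> complex) set" where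
  "sobolev_space m a b = {\<phi>.
     (\<forall>k<m - 1. \<forall>x\<in>{a..b}. iter_deriv a b k \<phi> differentiable (at x within {a..b})) \<and>
     abs_continuous_on a b (iter_deriv a b (m - 1) \<phi>) \<and>
     (AE x in lebesgue_on {a..b}. iter_deriv a b (m - 1) \<phi> differentiable (at x within {a..b})) \<and>
     iter_deriv a b m \<phi> \<in> borel_measurable (lebesgue_on {a..b}) \<and>
     integrable (lebesgue_on {a..b}) (\<lambda>x. (cmod (iter_deriv a b m \<phi> x))\<^sup>2)}"

definition sobolev_inner ::
    "nat \<Rightarrow> real \<Rightarrow> real \<Rightarrow> (real \<Rightarrow> complex) \<Rightarrow> (real \<Rightarrow> complex) \<Rightarrow> complex" where
  "sobolev_inner m a b \<phi> \<psi> =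
     (LINT x|lebesgue_on {a..b}. iter_deriv a b m \<phi> x * cnj (iter_deriv a b m \<psi> x))"

definition sobolev_norm :: "nat \<Rightarrow> real \<Rightarrow> real \<Rightarrow> (real \<Rightarrow> complex) \<Rightarrow> real" where
  "sobolev_norm m a b \<phi> = sqrt (Re (sobolev_inner m a b \<phi> \<phi>))"

section \<open>Optimal quadrature formulas\<close>

definition wave :: "real \<Rightarrow> real \<Rightarrow> complex" where
  "wave \<omega> x = exp (2 * of_real pi * \<i> * of_real \<omega> * of_real x)"

definition error_functional ::
    "nat \<Rightarrow> real \<Rightarrow> real \<Rightarrow> real \<Rightarrow> (nat \<Rightarrow> complex) \<Rightarrow> (real \<Rightarrow> complex) \<Rightarrow> complex" where
  "error_functional N a b \<omega> C \<phi> =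
     (LINT x|lebesgue_on {a..b}. wave \<omega> x * \<phi> x)
       - (\<Sum>\<beta>=0..N. C \<beta> * \<phi> ((b - a) / real N * real \<beta> + a))"

definition exact_on_polynomials ::
    "nat \<Rightarrow> nat \<Rightarrow> real \<Rightarrow> real \<Rightarrow> real \<Rightarrow> (nat \<Rightarrow> complex) \<Rightarrow> bool" where
  "exact_on_polynomials m N a b \<omega> C \<longleftrightarrow>
     (\<forall>\<alpha><m. error_functional N a b \<omega> C (\<lambda>x. of_real x ^ \<alpha>) = 0)"

definition error_norm ::
    "nat \<Rightarrow> nat \<Rightarrow> real \<Rightarrow> real \<Rightarrow> real \<Rightarrow> (nat \<Rightarrow> complex) \<Rightarrow> ereal" where
  "error_norm m N a b \<omega> C =
     (SUP \<phi>\<in>{\<phi> \<in> sobolev_space m a b. sobolev_norm m a b \<phi> \<le> 1}.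
        ereal (cmod (error_functional N a b \<omega> C \<phi>)))"

definition sard_optimal ::
    "nat \<Rightarrow> nat \<Rightarrow> real \<Rightarrow> real \<Rightarrow> real \<Rightarrow> (nat \<Rightarrow> complex) \<Rightarrow> bool" where
  "sard_optimal m N a b \<omega> C \<longleftrightarrow>
     exact_on_polynomials m N a b \<omega> C \<and>
     (\<forall>C'. exact_on_polynomials m N a b \<omega> C' \<longrightarrow>
        error_norm m N a b \<omega> C \<le> error_norm m N a b \<omega> C')"

section \<open>Euler-Frobenius polynomials\<close>

definition euler_frobenius :: "nat \<Rightarrow> complex poly" where
  "euler_frobenius k = (THE p. \<forall>x. x \<noteq> 0 \<longrightarrow> x \<noteq> 1 \<longrightarrow>
     poly p x = (1 - x) ^ (k + 2) / x * ((\<lambda>f x. x * deriv f x) ^^ k) (\<lambda>x. x / (1 - x)\<^sup>2) x)"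

lemma iterated_euler_operator:
  "\<exists>p :: complex poly. \<forall>x. x \<noteq> 1 \<longrightarrow>
     ((\<lambda>f x. x * deriv f x) ^^ k) (\<lambda>x. x / (1 - x)\<^sup>2) x = x * poly p x / (1 - x) ^ (k + 2)"
proof (induction k)
  case 0
  show ?case by (rule exI[of _ 1]) (simp add: power2_eq_square)
next
  case (Suc k)
  let ?F = "((\<lambda>f x. x * deriv f x) ^^ k) (\<lambda>x :: complex. x / (1 - x)\<^sup>2)"
  obtain p where p: "\<And>x. x \<noteq> 1 \<Longrightarrow> ?F x = x * poly p x / (1 - x) ^ (k + 2)"
    using Suc.IH by blast
  define r where "r = (p + [:0, 1:] * pderiv p) * [:1, -1:] + smult (of_nat (k + 2)) ([:0, 1:] * p)"
  have "x * deriv ?F x = x * poly r x / (1 - x) ^ (Suc k + 2)" if x: "x \<noteq> 1" for x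
  proof -
    have ev: "\<forall>\<^sub>F y in nhds x. ?F y = y * poly p y / (1 - y) ^ (k + 2)"
      using t1_space_nhds[OF x] by (rule eventually_mono) (rule p)
    have nz: "1 - x \<noteq> 0"
      using x by simp
    have num: "((\<lambda>y. y * poly p y) has_field_derivative (poly p x + x * poly (pderiv p) x)) (at x)"
      by (auto intro!: derivative_eq_intros poly_DERIV)
    have den: "((\<lambda>y. (1 - y) ^ (k + 2)) has_field_derivative
        - (of_nat (k + 2) * (1 - x) ^ (k + 1))) (at x)"
      by (rule derivative_eq_intros refl)+ simp
    have "((\<lambda>y. y * poly p y / (1 - y) ^ (k + 2)) has_field_derivative
        ((poly p x + x * poly (pderiv p) x) * (1 - x) ^ (k + 2)
          + x * poly p x * (of_nat (k + 2) * (1 - x) ^ (k + 1)))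
        / ((1 - x) ^ (k + 2) * (1 - x) ^ (k + 2))) (at x)"
      using DERIV_divide[OF num den] nz by simp
    also have "((poly p x + x * poly (pderiv p) x) * (1 - x) ^ (k + 2)
          + x * poly p x * (of_nat (k + 2) * (1 - x) ^ (k + 1)))
        / ((1 - x) ^ (k + 2) * (1 - x) ^ (k + 2)) =
        (((poly p x + x * poly (pderiv p) x) * (1 - x)
          + x * poly p x * of_nat (k + 2)) * (1 - x) ^ (k + 1))
        / ((1 - x) ^ (Suc k + 2) * (1 - x) ^ (k + 1))"
      by (intro arg_cong2[where f = "(/)"]) (simp_all add: algebra_simps)
    also have "\<dots> = poly r x / (1 - x) ^ (Suc k + 2)"
    proof -
      have "poly r x = (poly p x + x * poly (pderiv p) x) * (1 - x) + x * poly p x * of_nat (k + 2)"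
        by (simp add: r_def algebra_simps)
      then show ?thesis
        using nz nonzero_mult_divide_mult_cancel_right[of "(1 - x) ^ (k + 1)"] by (simp only: power_not_zero not_False_eq_True)
    qed
    finally have "deriv ?F x = poly r x / (1 - x) ^ (Suc k + 2)"
      using deriv_cong_ev[OF ev refl] DERIV_imp_deriv by metis
    then show ?thesis by simp
  qed
  then show ?case by (intro exI[of _ r]) simp
qed

lemma euler_frobenius_eq:
  assumes "x \<noteq> 0" "x \<noteq> 1"
  shows "poly (euler_frobenius k) x =
    (1 - x) ^ (k + 2) / x * ((\<lambda>f x. x * deriv f x) ^^ k) (\<lambda>x. x / (1 - x)\<^sup>2) x"
proof -
  let ?P = "\<lambda>p :: complex poly. \<forall>x. x \<noteq> 0 \<longrightarrow> x \<noteq> 1 \<longrightarrow>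
     poly p x = (1 - x) ^ (k + 2) / x * ((\<lambda>f x. x * deriv f x) ^^ k) (\<lambda>x. x / (1 - x)\<^sup>2) x"
  obtain p :: "complex poly" where p: "\<And>x. x \<noteq> 1 \<Longrightarrow>
     ((\<lambda>f x. x * deriv f x) ^^ k) (\<lambda>x. x / (1 - x)\<^sup>2) x = x * poly p x / (1 - x) ^ (k + 2)"
    using iterated_euler_operator by blast
  have 1: "?P p"
    by (auto simp: p)
  have 2: "p' = p" if "?P p'" for p'
  proof (rule ccontr)
    assume "p' \<noteq> p"
    then have "finite {x. poly (p' - p) x = 0}"
      by (intro poly_roots_finite) simp
    moreover have "UNIV - {0, 1} \<subseteq> {x. poly (p' - p) x = 0}"
      using 1 that by auto
    ultimately have "finite (UNIV - {0, 1 :: complex})"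
      by (rule rev_finite_subset)
    then show False
      by (simp add: infinite_UNIV_char_0)
  qed
  have "?P (THE p. ?P p)"
    using 1 2 by (rule theI)
  with assms show ?thesis
    unfolding euler_frobenius_def by blast
qed

definition ef_coeff :: "nat \<Rightarrow> nat \<Rightarrow> real" where
  "ef_coeff m \<alpha> =
     (\<Sum>j=0..\<alpha>. (-1) ^ j * real ((2 * m) choose j) * real (\<alpha> + 1 - j) ^ (2 * m - 1))"

section \<open>The ingredients of the coefficient formulas\<close>

definition diff_zero :: "nat \<Rightarrow> nat \<Rightarrow> complex" where
  "diff_zero t j = (\<Sum>l=1..t. (-1) ^ (t - l) * of_nat (t choose l) * of_nat l ^ j)"

text \<open>The index range \<open>\<alpha> < m - 1\<close> is \<open>0, \<dots>, m - 2\<close>, empty for \<open>m = 1\<close>.\<close>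

definition K_const :: "nat \<Rightarrow> real \<Rightarrow> real \<Rightarrow> real" where
  "K_const m h \<omega> =
     (sin (pi * \<omega> * h) / (pi * \<omega> * h)) ^ (2 * m) *
     (fact (2 * m - 1) /
       (2 * (\<Sum>\<alpha><m - 1. ef_coeff m \<alpha> * cos (2 * pi * \<omega> * h * real (m - 1 - \<alpha>)))
         + ef_coeff m (m - 1)))"

definition system_left ::
    "nat \<Rightarrow> nat \<Rightarrow> real \<Rightarrow> real \<Rightarrow> real \<Rightarrow> (nat \<Rightarrow> complex) \<Rightarrow> (nat \<Rightarrow> complex) \<Rightarrow> (nat \<Rightarrow> complex) \<Rightarrow> bool"
where
  "system_left m N a h \<omega> q A B \<longleftrightarrow> (\<forall>j\<in>{1..m - 1}.
     (\<Sum>k=1..m - 1. A k * (\<Sum>t=1..j. q k * diff_zero t j / (q k - 1) ^ (t + 1)))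
     + (\<Sum>k=1..m - 1. B k * (\<Sum>t=1..j. q k ^ (N + t) * diff_zero t j / (1 - q k) ^ (t + 1)))
     = fact j * wave \<omega> a / (2 * of_real pi * \<i> * of_real \<omega> * of_real h) ^ (j + 1)
       - (\<Sum>t=1..j. wave \<omega> (a + h) * of_real (K_const m h \<omega>) * diff_zero t j
            / (wave \<omega> h - 1) ^ (t + 1)))"

definition system_right ::
    "nat \<Rightarrow> nat \<Rightarrow> real \<Rightarrow> real \<Rightarrow> real \<Rightarrow> real \<Rightarrow> (nat \<Rightarrow> complex) \<Rightarrow> (nat \<Rightarrow> complex) \<Rightarrow> (nat \<Rightarrow> complex)
      \<Rightarrow> bool"
where
  "system_right m N a b h \<omega> q A B \<longleftrightarrow> (\<forall>j\<in>{1..m - 1}.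
     (\<Sum>k=1..m - 1. A k *
        ((\<Sum>t=1..j. q k ^ t * diff_zero t j / (1 - q k) ^ (t + 1))
         - (\<Sum>\<alpha>=1..j. of_real (h / (b - a)) powi (int \<alpha> - int j) * of_nat (j choose \<alpha>) *
              (\<Sum>t=1..\<alpha>. q k ^ (N + t) * diff_zero t \<alpha> / (1 - q k) ^ (t + 1)))))
     + (\<Sum>k=1..m - 1. B k *
        ((\<Sum>t=1..j. q k ^ (N + 1) * diff_zero t j / (q k - 1) ^ (t + 1))
         - (\<Sum>\<alpha>=1..j. of_real (h / (b - a)) powi (int \<alpha> - int j) * of_nat (j choose \<alpha>) *
              (\<Sum>t=1..\<alpha>. q k * diff_zero t \<alpha> / (q k - 1) ^ (t + 1)))))
     = (-1) ^ (j + 1) * fact j * wave \<omega> a / (2 * of_real pi * \<i> * of_real \<omega> * of_real h) ^ (j + 1)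
       + (\<Sum>\<alpha>=1..j. of_real (h / (b - a)) powi (int \<alpha> - int j) *
            ((-1) ^ \<alpha> * fact j * wave \<omega> b
              / (fact (j - \<alpha>) * (2 * of_real pi * \<i> * of_real \<omega> * of_real h) ^ (\<alpha> + 1))))
       - of_real (K_const m h \<omega>) * wave \<omega> a / (1 - wave \<omega> h) *
            (\<Sum>t=1..j. (wave \<omega> h / (1 - wave \<omega> h)) ^ t * diff_zero t j)
       + of_real (K_const m h \<omega>) * wave \<omega> b / (1 - wave \<omega> h) *
            (\<Sum>\<alpha>=1..j. of_real (h / (b - a)) powi (int \<alpha> - int j) * of_nat (j choose \<alpha>) *
              (\<Sum>t=1..\<alpha>. (wave \<omega> h / (1 - wave \<omega> h)) ^ t * diff_zero t \<alpha>)))"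

end

theory Submission
  imports Defs "HOL-Computational_Algebra.Polynomial_FPS"
begin

text \<open>The formula is optimal iff its error functional is represented by a function \<open>\<psi>\<close> that
  vanishes at the nodes. Such a \<open>\<psi>\<close> is the conjugate of the error of interpolating
  \<open>W = wave \<omega> / (2 \<pi> \<i> \<omega>) ^ (2 * m)\<close> (up to sign) by a spline \<open>s\<close> of degree \<open>2 * m - 1\<close> whose
  derivatives of orders \<open>m, \<dots>, 2 * m - 2\<close> agree with those of \<open>W\<close> at \<open>a\<close> and \<open>b\<close>; the optimal
  coefficients are the jumps of \<open>s\<close> in order \<open>2 * m - 1\<close>, corrected at the ends by \<open>W\<close>.
  Now \<open>s\<close> is the exponential spline of base \<open>wave \<omega> h\<close> with factor \<open>K\<close>, which already interpolates
  \<open>W\<close> at the nodes, plus a null spline, that is, a combination of the exponential splines whose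
  bases are the roots \<open>q k\<close>, \<open>1 / q k\<close> of the Euler-Frobenius polynomial. Its \<open>2 * m - 2\<close>
  coordinates \<open>A k\<close>, \<open>B k * q k ^ N\<close> are fixed by the end conditions, which are the linear system.
  That system is uniquely solvable because a natural null spline has zero energy.\<close>

text \<open>Every sum over t in the linear system is a value of one family of rational functions,
  \<open>abel_sum\<close>, at \<open>q k\<close>, \<open>1 / q k\<close> or
  \<open>wave \<omega> h\<close>. The Euler operator z d/dz raises their order by one, so their
  identities propagate from order 1 by differentiation. The shift identity makes the spline pieces
  fit together. The symmetry under z to 1 / z makes the Euler-Frobenius polynomial palindromic,
  pairs its roots and reconciles the given form of the system with the end conditions. Two obstacles
  shape the analytic side. The derivative of order m of a Sobolev function exists only almost
  everywhere, so the first integration by parts needs a fundamental theorem for absolutely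
  continuous functions, proved with a gauge. And the norm is only a seminorm on a space whose
  derivatives are iterated choice terms; hence functionals are compared on glued families of smooth
  pieces, whose derivatives are carried along explicitly.\<close>

section \<open>Abel sums and Euler-Frobenius polynomials\<close>

text \<open>For j \<ge> 1 these numbers are \<open>fact t\<close> times Stirling numbers of the
  second kind, and this is the Stirling recurrence. One factor l is absorbed into the binomial
  coefficient and Pascal's rule splits the result; the alternating sign turns Pascal's difference
  into a sum.\<close>

lemma diff_zero_Suc_Suc:
  "diff_zero (Suc s) (Suc j) = of_nat (Suc s) * (diff_zero (Suc s) j + diff_zero s j)"
proof -
  let ?e = "\<lambda>l. (-1) ^ (Suc s - l) :: complex"
  have ext: "diff_zero s j = (\<Sum>l=1..Suc s. (-1) ^ (s - l) * of_nat (s choose l) * of_nat l ^ j)"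
    by (simp add: diff_zero_def)
  have "?e l * of_nat (Suc s choose l) * of_nat l ^ Suc j =
      of_nat (Suc s) * (?e l * of_nat (Suc s choose l) * of_nat l ^ j
        + (-1) ^ (s - l) * of_nat (s choose l) * of_nat l ^ j)"
    if l: "l \<in> {1..Suc s}" for l
  proof -
    obtain i where i: "l = Suc i" using l by (cases l) auto
    have abs: "of_nat l * of_nat (Suc s choose l) = of_nat (Suc s) * (of_nat (s choose i) :: complex)"
      unfolding i of_nat_mult[symmetric] using Suc_times_binomial[of i s] by (simp only: mult.commute)
    \<comment> \<open>At l = Suc s truncated subtraction breaks the sign relation, but there the
      binomial coefficient vanishes.\<close>
    have "(-1) ^ (s - l) * (of_nat (s choose l) :: complex) = - (?e l * of_nat (s choose l))"
      using l by (cases "l = Suc s") (auto simp: Suc_diff_le)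
    then have "?e l * of_nat (Suc s choose l) + (-1) ^ (s - l) * of_nat (s choose l)
        = ?e l * of_nat (s choose i)"
      by (simp add: i algebra_simps)
    then have "of_nat (Suc s) * (?e l * of_nat (Suc s choose l) * of_nat l ^ j
        + (-1) ^ (s - l) * of_nat (s choose l) * of_nat l ^ j)
        = of_nat (Suc s) * (?e l * of_nat (s choose i) * of_nat l ^ j)"
      by (metis distrib_right)
    also have "\<dots> = ?e l * (of_nat (Suc s) * of_nat (s choose i)) * of_nat l ^ j"
      by (simp only: ac_simps)
    also have "\<dots> = ?e l * (of_nat l * of_nat (Suc s choose l)) * of_nat l ^ j"
      by (simp only: abs)
    finally show ?thesis
      by (simp only: ac_simps power_Suc)
  qed
  then have "diff_zero (Suc s) (Suc j) = (\<Sum>l=1..Suc s. of_nat (Suc s) * (?e l * of_nat (Suc s choose l) * of_nat l ^ j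
        + (-1) ^ (s - l) * of_nat (s choose l) * of_nat l ^ j))"
    unfolding diff_zero_def by (intro sum.cong) auto
  then show ?thesis
    unfolding ext by (simp only: diff_zero_def sum_distrib_left sum.distrib distrib_left)
qed

text \<open>The sum starts at l = 1, so the binomial theorem leaves minus the omitted term l = 0
  instead of 0. Consecutive values cancel in the recurrence, which starts the vanishing of the
  higher differences.\<close>

lemma diff_zero_exponent_0: "diff_zero (Suc s) 0 = (-1) ^ s"
proof -
  have "(0::complex) = (\<Sum>l\<le>Suc s. of_nat (Suc s choose l) * 1 ^ l * (-1) ^ (Suc s - l))"
    using binomial_ring[of "1::complex" "-1" "Suc s"] by simp
  also have "{..Suc s} = insert 0 {1..Suc s}" by auto
  also have "(\<Sum>l\<in>insert 0 {1..Suc s}. of_nat (Suc s choose l) * 1 ^ l * (-1) ^ (Suc s - l) :: complex)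
      = (-1) ^ Suc s + diff_zero (Suc s) 0"
    by (subst sum.insert) (auto simp: diff_zero_def algebra_simps)
  finally show ?thesis by (simp add: algebra_simps eq_neg_iff_add_eq_0)
qed

lemma diff_zero_0 [simp]: "diff_zero 0 j = 0"
  by (simp add: diff_zero_def)

lemma diff_zero_eq_0: "1 \<le> j \<Longrightarrow> j < t \<Longrightarrow> diff_zero t j = 0"
proof (induction j arbitrary: t rule: dec_induct)
  case base
  then obtain s where "t = Suc (Suc s)"
    by (metis One_nat_def Suc_less_eq gr0_implies_Suc lessE less_imp_Suc_add)
  then show ?case by (simp add: diff_zero_Suc_Suc diff_zero_exponent_0)
next
  case (step j)
  then obtain s where "t = Suc s" by (metis Suc_lessE)
  with step show ?case by (simp add: diff_zero_Suc_Suc)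
qed

lemma diff_zero_diag: "1 \<le> j \<Longrightarrow> diff_zero j j = fact j"
proof (induction j rule: dec_induct)
  case base
  show ?case by (simp add: diff_zero_def)
next
  case (step j)
  then show ?case by (simp add: diff_zero_Suc_Suc diff_zero_eq_0)
qed

section \<open>Generating functions of powers and their functional equations\<close>

text \<open>The Abel sum \<open>\<Sum>\<gamma>\<ge>1. \<gamma> ^ j * z ^ \<gamma>\<close>, continued to a rational function of \<open>z\<close>.\<close>

definition abel_sum :: "nat \<Rightarrow> complex \<Rightarrow> complex" where
  "abel_sum j z = (if j = 0 then z / (1 - z)
     else \<Sum>t=1..j. diff_zero t j * (z ^ t / (1 - z) ^ (t + 1)))"

lemma has_field_derivative_basic_abel_term:
  assumes "z \<noteq> 0" "z \<noteq> 1"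
  shows "((\<lambda>z. z ^ t / (1 - z) ^ (t + 1)) has_field_derivative
    (of_nat t * (z ^ t / (1 - z) ^ (t + 1)) + of_nat (Suc t) * (z ^ Suc t / (1 - z) ^ (Suc t + 1))) / z)
    (at z :: complex filter)"
proof -
  have nz: "1 - z \<noteq> 0" using assms by simp
  have den: "((\<lambda>y. (1 - y) ^ (t + 1)) has_field_derivative
      - (of_nat (t + 1) * (1 - z) ^ t)) (at z)"
    by (rule derivative_eq_intros refl)+ simp
  have num: "((\<lambda>y. y ^ t) has_field_derivative (of_nat t * z ^ t / z)) (at z)"
  proof -
    have "((\<lambda>y. y ^ t) has_field_derivative (of_nat t * z ^ (t - 1))) (at z)"
      by (rule derivative_eq_intros refl)+ simp
    moreover have "of_nat t * z ^ (t - 1) = of_nat t * z ^ t / z"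
      using assms by (cases t) auto
    ultimately show ?thesis by simp
  qed
  have "(of_nat t * z ^ t / z * (1 - z) ^ (t + 1) - z ^ t * - (of_nat (t + 1) * (1 - z) ^ t)) /
      ((1 - z) ^ (t + 1) * (1 - z) ^ (t + 1))
    = (of_nat t * (z ^ t / (1 - z) ^ (t + 1)) + of_nat (Suc t) * (z ^ Suc t / (1 - z) ^ (Suc t + 1))) / z"
    using nz assms by (simp add: divide_simps) (simp add: algebra_simps)
  then show ?thesis
    using DERIV_divide[OF num den] nz by simp
qed

text \<open>Multiplying the coefficient of z^\<gamma> by \<gamma> is the operator z d/dz. On u t =
  z^t / (1 - z)^(t + 1) it gives t * u t + (t + 1) * u (t + 1), which is dual to the recurrence
  \<open>diff_zero_Suc_Suc\<close>.\<close>

lemma has_field_derivative_abel_sum: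
  assumes z: "z \<noteq> 0" "z \<noteq> 1"
  shows "(abel_sum n has_field_derivative abel_sum (Suc n) z / z) (at z)"
proof (cases "n = 0")
  case True
  have "((\<lambda>z. z / (1 - z)) has_field_derivative (1 * (1 - z) - z * (0 - 1)) / ((1 - z) * (1 - z))) (at z)"
    using z by (intro DERIV_divide DERIV_ident DERIV_diff DERIV_const) simp
  moreover have "(1 * (1 - z) - z * (0 - 1)) / ((1 - z) * (1 - z)) = (z / (1 - z)\<^sup>2) / z"
    using z by (simp add: power2_eq_square)
  moreover have "abel_sum 0 = (\<lambda>z. z / (1 - z))" by (auto simp: abel_sum_def)
  moreover have "abel_sum (Suc 0) z = z / (1 - z)\<^sup>2"
    by (simp add: abel_sum_def diff_zero_def power2_eq_square)
  ultimately show ?thesis using True by simp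
next
  case False
  define u where "u = (\<lambda>t. z ^ t / (1 - z) ^ (t + 1))"
  have eq: "abel_sum n = (\<lambda>z. \<Sum>t=1..n. diff_zero t n * (z ^ t / (1 - z) ^ (t + 1)))"
    using False by (auto simp: abel_sum_def)
  have "(abel_sum n has_field_derivative
      (\<Sum>t=1..n. diff_zero t n * ((of_nat t * u t + of_nat (Suc t) * u (Suc t)) / z))) (at z)"
    unfolding eq u_def
    by (intro DERIV_sum DERIV_cmult has_field_derivative_basic_abel_term z)
  also have "(\<Sum>t=1..n. diff_zero t n * ((of_nat t * u t + of_nat (Suc t) * u (Suc t)) / z))
     = (\<Sum>t=1..n. of_nat t * diff_zero t n * u t + of_nat (Suc t) * diff_zero t n * u (Suc t)) / z"
    by (simp add: sum_divide_distrib algebra_simps)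
  \<comment> \<open>Both sums are brought to the range 1..Suc n: the first gains its last term
    because \<open>diff_zero (Suc n) n = 0\<close> for n \<ge> 1, the second gains t = 0 before the
    shift because \<open>diff_zero 0 n = 0\<close>.\<close>
  also have "(\<Sum>t=1..n. of_nat t * diff_zero t n * u t + of_nat (Suc t) * diff_zero t n * u (Suc t))
     = (\<Sum>t=1..Suc n. of_nat t * diff_zero t n * u t)
       + (\<Sum>t=1..n. of_nat (Suc t) * diff_zero t n * u (Suc t))"
    using False by (simp add: sum.distrib diff_zero_eq_0)
  also have "(\<Sum>t=1..n. of_nat (Suc t) * diff_zero t n * u (Suc t))
     = (\<Sum>t=0..n. of_nat (Suc t) * diff_zero t n * u (Suc t))"
    by (simp add: sum.atLeast_Suc_atMost)
  also have "\<dots> = (\<Sum>t=1..Suc n. of_nat t * diff_zero (t - 1) n * u t)"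
    using sum.shift_bounds_cl_Suc_ivl[of "\<lambda>t. of_nat t * diff_zero (t - 1) n * u t" 0 n] by simp
  also have "(\<Sum>t=1..Suc n. of_nat t * diff_zero t n * u t)
      + (\<Sum>t=1..Suc n. of_nat t * diff_zero (t - 1) n * u t) = abel_sum (Suc n) z"
    unfolding abel_sum_def sum.distrib[symmetric] u_def
  proof (simp only: nat.simps if_False, intro sum.cong refl)
    fix t assume "t \<in> {1..Suc n}"
    then obtain s where "t = Suc s" by (cases t) auto
    then show "of_nat t * diff_zero t n * (z ^ t / (1 - z) ^ (t + 1))
        + of_nat t * diff_zero (t - 1) n * (z ^ t / (1 - z) ^ (t + 1))
      = diff_zero t (Suc n) * (z ^ t / (1 - z) ^ (t + 1))"
      by (simp only: diff_zero_Suc_Suc diff_Suc_1 distrib_left distrib_right)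
  qed
  finally show ?thesis .
qed

text \<open>A difference of order n + 1 is the difference of order n of first differences. In this
  form the induction for \<open>abel_sum_shift\<close> meets its differentiated hypothesis.\<close>

lemma alternating_binomial_sum_Suc:
  fixes f :: "nat \<Rightarrow> complex"
  shows "(\<Sum>j\<le>Suc n. (-1) ^ (Suc n - j) * of_nat (Suc n choose j) * f j)
    = (\<Sum>j\<le>n. (-1) ^ (n - j) * of_nat (n choose j) * (f (Suc j) - f j))"
proof -
  have "(\<Sum>j\<le>Suc n. (-1) ^ (Suc n - j) * of_nat (Suc n choose j) * f j)
    = (-1) ^ Suc n * f 0 + (\<Sum>j\<le>n. (-1) ^ (n - j) * of_nat (Suc n choose Suc j) * f (Suc j))"
    by (subst sum.atMost_Suc_shift) simp
  also have "(\<Sum>j\<le>n. (-1) ^ (n - j) * of_nat (Suc n choose Suc j) * f (Suc j))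
    = (\<Sum>j\<le>n. (-1) ^ (n - j) * of_nat (n choose j) * f (Suc j))
      + (\<Sum>j\<le>n. (-1) ^ (n - j) * of_nat (n choose Suc j) * f (Suc j))"
    by (simp add: sum.distrib[symmetric] algebra_simps)
  also have "(-1) ^ Suc n * f 0 + ((\<Sum>j\<le>n. (-1) ^ (n - j) * of_nat (n choose j) * f (Suc j))
      + (\<Sum>j\<le>n. (-1) ^ (n - j) * of_nat (n choose Suc j) * f (Suc j)))
    = (\<Sum>j\<le>n. (-1) ^ (n - j) * of_nat (n choose j) * f (Suc j))
      + (\<Sum>j\<le>Suc n. (-1) ^ (Suc n - j) * of_nat (n choose j) * f j)"
    using sum.atMost_Suc_shift[of "\<lambda>j. (-1) ^ (Suc n - j) * of_nat (n choose j) * f j" n] by simp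
  also have "(\<Sum>j\<le>Suc n. (-1) ^ (Suc n - j) * of_nat (n choose j) * f j)
    = - (\<Sum>j\<le>n. (-1) ^ (n - j) * of_nat (n choose j) * f j)"
    by (simp add: sum_negf[symmetric] Suc_diff_le)
  finally show ?thesis by (simp add: sum_subtractf right_diff_distrib)
qed

text \<open>Formally, both sides are \<open>\<Sum>\<gamma>\<ge>1. (\<gamma> - 1) ^ n * z ^ \<gamma>\<close>.\<close>

lemma abel_sum_shift:
  assumes "n \<ge> 1" "z \<noteq> 0" "z \<noteq> 1"
  shows "(\<Sum>j\<le>n. (-1) ^ (n - j) * of_nat (n choose j) * abel_sum j z) = z * abel_sum n z"
  using assms
proof (induction n arbitrary: z rule: dec_induct)
  case base
  then have "1 - z \<noteq> 0" by simp
  then show ?case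
    by (simp add: abel_sum_def diff_zero_def divide_simps power2_eq_square) (simp add: algebra_simps)
next
  case (step n)
  let ?c = "\<lambda>j. (-1) ^ (n - j) * of_nat (n choose j) :: complex"
  have z: "z \<noteq> 0" "z \<noteq> 1" using step by auto
  have "((\<lambda>z. \<Sum>j\<le>n. ?c j * abel_sum j z) has_field_derivative
      (\<Sum>j\<le>n. ?c j * (abel_sum (Suc j) z / z))) (at z)"
    by (intro DERIV_sum DERIV_cmult has_field_derivative_abel_sum z)
  \<comment> \<open>By the induction hypothesis the same function is z * abel_sum n z near z, so its
    derivative is computed a second time and the two results are compared.\<close>
  moreover have "((\<lambda>z. \<Sum>j\<le>n. ?c j * abel_sum j z) has_field_derivative
      (abel_sum n z + abel_sum (Suc n) z)) (at z)"
  proof (rule has_field_derivative_transform_within_open)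
    show "((\<lambda>z. z * abel_sum n z) has_field_derivative (abel_sum n z + abel_sum (Suc n) z)) (at z)"
      by (rule derivative_eq_intros has_field_derivative_abel_sum z refl)+ (use z in simp)
    show "open (UNIV - {0, 1 :: complex})" by (intro open_Diff) auto
  qed (use z step in auto)
  ultimately have "(\<Sum>j\<le>n. ?c j * (abel_sum (Suc j) z / z)) = abel_sum n z + abel_sum (Suc n) z"
    by (rule DERIV_unique)
  then have "(\<Sum>j\<le>n. ?c j * abel_sum (Suc j) z) = z * (abel_sum n z + abel_sum (Suc n) z)"
    using z by (simp add: sum_divide_distrib[symmetric] divide_simps mult.commute)
  then show ?case
    using step unfolding alternating_binomial_sum_Suc
    by (simp add: right_diff_distrib sum_subtractf) (simp add: algebra_simps)
qed

text \<open>For n = 1 the function is z / (1 - z)^2, which is invariant under z to 1 / z. Inversion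
  turns z d/dz into its negative, so each further order contributes a sign.\<close>

lemma abel_sum_inverse:
  assumes "n \<ge> 1" "z \<noteq> 0" "z \<noteq> 1"
  shows "abel_sum n (1 / z) = (-1) ^ (n + 1) * abel_sum n z"
  using assms
proof (induction n arbitrary: z rule: dec_induct)
  case base
  then have "1 - z \<noteq> 0" "z - 1 \<noteq> 0" by simp_all
  with base show ?case
    by (simp add: abel_sum_def diff_zero_def divide_simps power2_eq_square) (simp add: algebra_simps)
next
  case (step n)
  have z: "z \<noteq> 0" "z \<noteq> 1" using step by auto
  have "((\<lambda>z. abel_sum n (1 / z)) has_field_derivative
      (abel_sum (Suc n) (1 / z) / (1 / z) * (- 1 / z\<^sup>2))) (at z)"
  proof (rule DERIV_chain2[where g = "\<lambda>z. 1 / z" and f = "abel_sum n"])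
    show "(abel_sum n has_field_derivative abel_sum (Suc n) (1 / z) / (1 / z)) (at (1 / z))"
      by (rule has_field_derivative_abel_sum) (use z in auto)
    show "((\<lambda>z. 1 / z) has_field_derivative - 1 / z\<^sup>2) (at z)"
      using z by (auto intro!: derivative_eq_intros simp: power2_eq_square)
  qed
  moreover have "((\<lambda>z. abel_sum n (1 / z)) has_field_derivative
      ((-1) ^ (n + 1) * (abel_sum (Suc n) z / z))) (at z)"
  proof (rule has_field_derivative_transform_within_open)
    show "((\<lambda>z. (-1) ^ (n + 1) * abel_sum n z) has_field_derivative ((-1) ^ (n + 1) * (abel_sum (Suc n) z / z))) (at z)"
      by (intro DERIV_cmult has_field_derivative_abel_sum z)
    show "open (UNIV - {0, 1 :: complex})" by (intro open_Diff) auto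
    show "z \<in> UNIV - {0, 1}" using z by simp
    show "(-1) ^ (n + 1) * abel_sum n x = abel_sum n (1 / x)" if "x \<in> UNIV - {0, 1}" for x
      using step.IH[of x] that by simp
  qed
  ultimately have "abel_sum (Suc n) (1 / z) / (1 / z) * (- 1 / z\<^sup>2) = (-1) ^ (n + 1) * (abel_sum (Suc n) z / z)"
    by (rule DERIV_unique)
  then show ?case using z by (simp add: divide_simps power2_eq_square)
qed

lemma iterated_euler_operator_abel_sum:
  assumes "x \<noteq> 0" "x \<noteq> 1"
  shows "((\<lambda>f x. x * deriv f x) ^^ k) (\<lambda>x. x / (1 - x)\<^sup>2) x = abel_sum (k + 1) x"
  using assms
proof (induction k arbitrary: x)
  case 0
  then show ?case by (simp add: abel_sum_def diff_zero_def power2_eq_square)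
next
  case (Suc k)
  let ?F = "((\<lambda>f x. x * deriv f x) ^^ k) (\<lambda>x :: complex. x / (1 - x)\<^sup>2)"
  have "(?F has_field_derivative abel_sum (Suc (k + 1)) x / x) (at x)"
  proof (rule has_field_derivative_transform_within_open)
    show "(abel_sum (k + 1) has_field_derivative abel_sum (Suc (k + 1)) x / x) (at x)"
      by (intro has_field_derivative_abel_sum Suc.prems)
    show "open (UNIV - {0, 1 :: complex})" by (intro open_Diff) auto
  qed (use Suc in auto)
  then show ?case using Suc.prems by (simp add: DERIV_imp_deriv)
qed

lemma abel_sum_euler_frobenius:
  assumes "x \<noteq> 0" "x \<noteq> 1"
  shows "abel_sum (k + 1) x = x * poly (euler_frobenius k) x / (1 - x) ^ (k + 2)"
  using assms euler_frobenius_eq[OF assms, of k] iterated_euler_operator_abel_sum[OF assms, of k]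
  by simp

section \<open>Coefficients, symmetry and roots of the Euler-Frobenius polynomials\<close>

lemma poly_eqI_except_01:
  fixes p p' :: "complex poly"
  assumes "\<And>x. x \<noteq> 0 \<Longrightarrow> x \<noteq> 1 \<Longrightarrow> poly p x = poly p' x"
  shows "p = p'"
proof (rule ccontr)
  assume "p \<noteq> p'"
  then have "finite {x. poly (p - p') x = 0}"
    by (intro poly_roots_finite) simp
  moreover have "UNIV - {0, 1} \<subseteq> {x. poly (p - p') x = 0}"
    using assms by auto
  ultimately have "finite (UNIV - {0, 1 :: complex})"
    by (rule rev_finite_subset)
  then show False
    by (simp add: infinite_UNIV_char_0)
qed

text \<open>The rational functions and the formal power series with coefficients g ^ n obey the same
  recursion for their numerators. The coefficients can therefore be read off a formal Cauchy
  product, with no question of convergence.\<close>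

lemma abel_sum_numerator_exists:
  assumes "n \<ge> 1"
  shows "\<exists>p. degree p \<le> n \<and> (\<forall>x. x \<noteq> 0 \<longrightarrow> x \<noteq> 1 \<longrightarrow> poly p x = (1 - x) ^ (n + 1) * abel_sum n x) \<and>
    fps_of_poly p = (1 - fps_X) ^ (n + 1) * Abs_fps (\<lambda>g. of_nat g ^ n :: complex)"
  using assms
proof (induction n rule: dec_induct)
  case base
  have "fps_X = (1 - fps_X) ^ 2 * Abs_fps (\<lambda>g. of_nat g :: complex)"
    (is "_ = ?R")
  proof (rule fps_ext)
    fix i
    have "?R = Abs_fps (\<lambda>g. of_nat g) - 2 * (fps_X * Abs_fps (\<lambda>g. of_nat g :: complex))
        + fps_X * (fps_X * Abs_fps (\<lambda>g. of_nat g))"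
      by (simp add: power2_eq_square algebra_simps)
    then show "fps_nth fps_X i = fps_nth ?R i"
      by (auto simp: numeral_fps_const of_nat_diff)
  qed
  then show ?case
    by (intro exI[of _ "[:0, 1:]"])
      (auto simp: abel_sum_def diff_zero_def fps_of_poly_pCons power2_eq_square)
next
  case (step n)
  then obtain p where deg: "degree p \<le> n"
    and p: "\<And>x. x \<noteq> 0 \<Longrightarrow> x \<noteq> 1 \<Longrightarrow> poly p x = (1 - x) ^ (n + 1) * abel_sum n x"
    and fps: "fps_of_poly p = (1 - fps_X) ^ (n + 1) * Abs_fps (\<lambda>g. of_nat g ^ n :: complex)"
    by blast
  define S where "S = (\<lambda>n. Abs_fps (\<lambda>g. of_nat g ^ n :: complex))"
  \<comment> \<open>The numerator of x d/dx applied to p / (1 - x)^(n + 1), over the denominator (1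
    - x)^(n + 2).\<close>
  define r where "r = [:1, -1:] * ([:0, 1:] * pderiv p) + smult (of_nat (n + 1)) ([:0, 1:] * p)"
  have X: "fps_of_poly [:0, 1:] = (fps_X :: complex fps)" "fps_of_poly [:1, -1:] = (1 - fps_X :: complex fps)"
    by (simp_all add: fps_of_poly_pCons)
  have "degree r \<le> Suc n"
    unfolding r_def
  proof (rule degree_add_le)
    have "degree [:1, -1 :: complex:] = 1" "degree [:0, 1 :: complex:] = 1" by simp_all
    then show "degree ([:1, -1:] * ([:0, 1:] * pderiv p)) \<le> Suc n"
      using degree_mult_le[of "[:1, -1:]" "[:0, 1:] * pderiv p"] degree_mult_le[of "[:0, 1:]" "pderiv p"]
        degree_pderiv[of p] deg step.hyps by linarith
    show "degree (smult (of_nat (n + 1)) ([:0, 1:] * p)) \<le> Suc n"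
      using degree_pCons_le[of 0 p] deg by simp
  qed
  moreover have "poly r x = (1 - x) ^ (Suc n + 1) * abel_sum (Suc n) x" if x: "x \<noteq> 0" "x \<noteq> 1" for x
  proof -
    have den: "((\<lambda>y. (1 - y) ^ (n + 1)) has_field_derivative - (of_nat (n + 1) * (1 - x) ^ n)) (at x)"
      by (rule derivative_eq_intros refl)+ simp
    have "(poly p has_field_derivative
        (- (of_nat (n + 1) * (1 - x) ^ n) * abel_sum n x + abel_sum (Suc n) x / x * (1 - x) ^ (n + 1))) (at x)"
    proof (rule has_field_derivative_transform_within_open)
      show "((\<lambda>x. (1 - x) ^ (n + 1) * abel_sum n x) has_field_derivative
        (- (of_nat (n + 1) * (1 - x) ^ n) * abel_sum n x + abel_sum (Suc n) x / x * (1 - x) ^ (n + 1))) (at x)"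
        by (intro DERIV_mult den has_field_derivative_abel_sum x)
      show "open (UNIV - {0, 1 :: complex})" by (intro open_Diff) auto
    qed (use x p in auto)
    then have "poly (pderiv p) x =
        - (of_nat (n + 1) * (1 - x) ^ n) * abel_sum n x + abel_sum (Suc n) x / x * (1 - x) ^ (n + 1)"
      using DERIV_unique poly_DERIV by blast
    then have "x * poly (pderiv p) x =
        - (x * of_nat (n + 1) * (1 - x) ^ n) * abel_sum n x + abel_sum (Suc n) x * (1 - x) ^ (n + 1)"
      using x by (simp add: field_simps)
    moreover have "poly r x = (1 - x) * (x * poly (pderiv p) x) + of_nat (n + 1) * x * poly p x"
      by (simp add: r_def algebra_simps)
    ultimately show ?thesis by (simp only: p[OF x]) (simp add: algebra_simps)
  qed
  moreover have "fps_of_poly r = (1 - fps_X) ^ (Suc n + 1) * S (Suc n)"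
  proof -
    have fpsS: "fps_of_poly p = (1 - fps_X) ^ (n + 1) * S n"
      by (simp only: fps S_def)
    have theta: "fps_X * fps_deriv (S n) = S (Suc n)"
      by (rule fps_ext) (auto simp: S_def gr0_conv_Suc)
    have d1: "fps_deriv ((1 - fps_X) ^ (n + 1) :: complex fps) = - of_nat (n + 1) * (1 - fps_X) ^ n"
      unfolding fps_deriv_power' by simp
    have d: "fps_deriv (fps_of_poly p) = (- of_nat (n + 1) * (1 - fps_X) ^ n) * S n + (1 - fps_X) ^ (n + 1) * fps_deriv (S n)"
      unfolding fps S_def fps_deriv_mult d1 by (simp only: add.commute)
    have c: "fps_of_poly r = (1 - fps_X) * (fps_X * fps_deriv (fps_of_poly p)) + of_nat (n + 1) * (fps_X * fps_of_poly p)"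
      unfolding r_def fps_of_poly_add fps_of_poly_mult fps_of_poly_smult X fps_of_poly_pderiv
      by (simp only: fps_of_nat)
    have "fps_of_poly r = (1 - fps_X) ^ (Suc n + 1) * (fps_X * fps_deriv (S n))"
      unfolding c d unfolding fpsS by (simp add: algebra_simps)
    then show ?thesis by (simp only: theta)
  qed
  ultimately show ?case unfolding S_def by (intro exI[of _ r]) blast
qed

text \<open>The numerator of \<open>abel_sum (2 * m - 1)\<close> is x times the polynomial, so the
  coefficient of order s + 1 in (1 - X)^(2 m) times the power series is the alternating sum in
  \<open>ef_coeff\<close>.\<close>

lemma euler_frobenius_expansion:
  assumes m: "m \<ge> 1"
  shows "euler_frobenius (2 * m - 2) = (\<Sum>s=0..2 * m - 2. monom (of_real (ef_coeff m s)) s)"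
proof -
  define n where "n = 2 * m - 1"
  have n: "n \<ge> 1" "2 * m - 2 + 1 = n" "2 * m - 2 + 2 = n + 1" "n + 1 = 2 * m"
    using m by (auto simp: n_def)
  obtain p where deg: "degree p \<le> n"
    and p: "\<And>x. x \<noteq> 0 \<Longrightarrow> x \<noteq> 1 \<Longrightarrow> poly p x = (1 - x) ^ (n + 1) * abel_sum n x"
    and fps: "fps_of_poly p = (1 - fps_X) ^ (n + 1) * Abs_fps (\<lambda>g. of_nat g ^ n :: complex)"
    using abel_sum_numerator_exists[OF n(1)] by blast
  have "p = pCons 0 (euler_frobenius (2 * m - 2))"
  proof (rule poly_eqI_except_01)
    fix x :: complex assume x: "x \<noteq> 0" "x \<noteq> 1"
    show "poly p x = poly (pCons 0 (euler_frobenius (2 * m - 2))) x"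
      using abel_sum_euler_frobenius[OF x, of "2 * m - 2"] x unfolding p[OF x] n by simp
  qed
  then have c: "coeff (euler_frobenius (2 * m - 2)) s = coeff p (Suc s)" for s
    by simp
  have "coeff p (Suc s) = of_real (ef_coeff m s)" for s
  proof -
    have *: "fps_nth ((1 - fps_X) ^ (n + 1)) j = ((-1) ^ j * of_nat ((2 * m) choose j) :: complex)" for j
    proof -
      have "(1 - fps_X) ^ (n + 1) = fps_of_poly ([:1, -1:] ^ (n + 1) :: complex poly)"
        by (simp add: fps_of_poly_pCons fps_of_poly_power)
      then have "fps_nth ((1 - fps_X) ^ (n + 1)) j = coeff ([:1, -1:] ^ (n + 1) :: complex poly) j"
        by (simp only: fps_of_poly_nth)
      also have "\<dots> = (-1) ^ j * of_nat ((2 * m) choose j)"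
      proof (cases "j \<le> n + 1")
        case True
        then show ?thesis unfolding n(4)[symmetric] by (subst coeff_linear_poly_power) auto
      next
        case False
        have "degree ([:1, -1:] ^ (n + 1) :: complex poly) \<le> n + 1"
          by (rule order_trans[OF degree_power_le]) simp
        with False show ?thesis unfolding n(4)[symmetric] by (simp add: coeff_eq_0 del: power_Suc)
      qed
      finally show ?thesis .
    qed
    have "coeff p (Suc s) = fps_nth (fps_of_poly p) (Suc s)" by simp
    also have "\<dots> = (\<Sum>j=0..Suc s. (-1) ^ j * of_nat ((2 * m) choose j) * of_nat (Suc s - j) ^ n)"
      unfolding fps fps_mult_nth * by simp
    \<comment> \<open>The summand j = Suc s contains 0 ^ n with n \<ge> 1 and drops out.\<close>
    also have "\<dots> = of_real (ef_coeff m s)"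
      using n(1) by (simp add: ef_coeff_def n_def del: of_nat_Suc) linarith
    finally show ?thesis .
  qed
  with c have cc: "coeff (euler_frobenius (2 * m - 2)) s = of_real (ef_coeff m s)" for s by simp
  have "coeff (euler_frobenius (2 * m - 2)) s = 0" if "s > 2 * m - 2" for s
    unfolding c using deg that by (intro coeff_eq_0) (auto simp: n_def)
  then show ?thesis
    by (intro poly_eqI) (auto simp: coeff_sum cc[symmetric] sum.delta')
qed

text \<open>Palindromicity: \<open>abel_sum_inverse\<close> after the factor x / (1 - x)^(k + 2) is
  cleared.\<close>

lemma poly_euler_frobenius_inverse:
  assumes "x \<noteq> 0" "x \<noteq> 1"
  shows "x ^ k * poly (euler_frobenius k) (1 / x) = poly (euler_frobenius k) x"
proof -
  have nz: "1 - x \<noteq> 0" "x - 1 \<noteq> 0" "1 / x \<noteq> 0" "1 / x \<noteq> 1" using assms by auto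
  have "1 - 1 / x = - ((1 - x) / x)" using assms by (simp add: field_simps)
  then have *: "(1 - 1 / x) ^ (k + 2) = (-1) ^ k * ((1 - x) ^ (k + 2) / x ^ (k + 2))"
    by (simp only: power_minus[of "(1 - x) / x"] power_divide) simp
  have "1 / x * poly (euler_frobenius k) (1 / x) / (1 - 1 / x) ^ (k + 2)
      = (-1) ^ k * (x * poly (euler_frobenius k) x / (1 - x) ^ (k + 2))"
    using abel_sum_inverse[of "k + 1" x] assms
      abel_sum_euler_frobenius[of x k] abel_sum_euler_frobenius[of "1 / x" k] nz by simp
  then have "x ^ (k + 2) / x * poly (euler_frobenius k) (1 / x) = x * poly (euler_frobenius k) x"
    unfolding * using nz assms by (cases "even k") (simp_all add: divide_simps mult_ac del: power_Suc)
  then have "x * (x ^ k * poly (euler_frobenius k) (1 / x)) = x * poly (euler_frobenius k) x"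
    using assms by (simp add: field_simps power2_eq_square)
  then show ?thesis using assms by simp
qed

lemma coeff_euler_frobenius:
  assumes "m \<ge> 1" "s \<le> 2 * m - 2"
  shows "coeff (euler_frobenius (2 * m - 2)) s = of_real (ef_coeff m s)"
  using assms by (subst euler_frobenius_expansion) (auto simp: coeff_sum)

lemma poly_euler_frobenius_sum:
  assumes "m \<ge> 1"
  shows "poly (euler_frobenius (2 * m - 2)) x = (\<Sum>s=0..2 * m - 2. of_real (ef_coeff m s) * x ^ s)"
  using assms by (subst euler_frobenius_expansion) (auto simp: poly_sum poly_monom)

text \<open>The reversed polynomial has the same values away from 0 and 1, so the coefficients agree
  without any work on the alternating sums.\<close>

lemma ef_coeff_symmetric:
  assumes m: "m \<ge> 1" and s: "s \<le> 2 * m - 2"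
  shows "ef_coeff m (2 * m - 2 - s) = ef_coeff m s"
proof -
  let ?n = "2 * m - 2"
  define p where "p = (\<Sum>s=0..?n. monom (of_real (ef_coeff m (?n - s)) :: complex) s)"
  have rev: "(\<Sum>s=0..n. of_real (f s) * x ^ (n - s)) = (\<Sum>s=0..n. of_real (f (n - s)) * x ^ s)"
    for n and x :: complex and f :: "nat \<Rightarrow> real"
    by (rule sum.reindex_bij_witness[of _ "\<lambda>s. n - s" "\<lambda>s. n - s"]) auto
  have "euler_frobenius ?n = p"
  proof (rule poly_eqI_except_01)
    fix x :: complex assume x: "x \<noteq> 0" "x \<noteq> 1"
    have "poly (euler_frobenius ?n) x = x ^ ?n * poly (euler_frobenius ?n) (1 / x)"
      using poly_euler_frobenius_inverse[OF x] by simp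
    also have "\<dots> = (\<Sum>s=0..?n. of_real (ef_coeff m s) * x ^ (?n - s))"
      unfolding poly_euler_frobenius_sum[OF m] sum_distrib_left
    proof (intro sum.cong refl)
      fix s assume "s \<in> {0..?n}"
      then have "?n - s + s = ?n" by simp
      then have "x ^ ?n = x ^ (?n - s) * x ^ s" by (metis power_add)
      then show "x ^ ?n * (of_real (ef_coeff m s) * (1 / x) ^ s) = of_real (ef_coeff m s) * x ^ (?n - s)"
        using x by (simp add: power_divide)
    qed
    also have "\<dots> = (\<Sum>s=0..?n. of_real (ef_coeff m (?n - s)) * x ^ s)"
      by (rule rev)
    finally show "poly (euler_frobenius ?n) x = poly p x"
      by (simp add: p_def poly_sum poly_monom)
  qed
  then have "of_real (ef_coeff m s) = coeff p s"
    using coeff_euler_frobenius[OF m s] by simp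
  also have "\<dots> = of_real (ef_coeff m (?n - s))"
    using s by (simp add: p_def coeff_sum)
  finally show ?thesis by (simp only: of_real_eq_iff)
qed

lemma ef_coeff_0: "m \<ge> 1 \<Longrightarrow> ef_coeff m 0 = 1"
  by (simp add: ef_coeff_def)

text \<open>The expansion bounds the degree from above only; by symmetry the top coefficient equals
  the constant one, which is 1.\<close>

lemma degree_euler_frobenius: "m \<ge> 1 \<Longrightarrow> degree (euler_frobenius (2 * m - 2)) = 2 * m - 2"
proof (rule antisym)
  assume m: "m \<ge> 1"
  show "degree (euler_frobenius (2 * m - 2)) \<le> 2 * m - 2"
    unfolding euler_frobenius_expansion[OF m]
    by (intro degree_sum_le) (auto intro: order_trans[OF degree_monom_le])
  show "2 * m - 2 \<le> degree (euler_frobenius (2 * m - 2))"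
    using coeff_euler_frobenius[OF m order_refl] ef_coeff_symmetric[OF m, of 0] ef_coeff_0[OF m]
    by (intro le_degree) auto
qed

lemma poly_euler_frobenius_0: "m \<ge> 1 \<Longrightarrow> poly (euler_frobenius (2 * m - 2)) 0 = 1"
  using coeff_euler_frobenius[of m 0] ef_coeff_0[of m] by (simp add: poly_0_coeff_0)

text \<open>The hypothesis on \<open>q\<close> supplies \<open>m - 1\<close> roots inside the unit disc; with their reciprocals
  they exhaust the degree, so no root lies on the unit circle.\<close>

lemma euler_frobenius_roots:
  fixes q :: "nat \<Rightarrow> complex"
  assumes m: "m \<ge> 1"
    and q: "bij_betw q {1..m - 1} {z. poly (euler_frobenius (2 * m - 2)) z = 0 \<and> cmod z < 1}"
  defines "Q \<equiv> q ` {1..m - 1}"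
  shows "{z. poly (euler_frobenius (2 * m - 2)) z = 0} = Q \<union> (\<lambda>z. 1 / z) ` Q"
    and "Q \<inter> (\<lambda>z. 1 / z) ` Q = {}" and "card (Q \<union> (\<lambda>z. 1 / z) ` Q) = 2 * m - 2"
    and "\<And>z. z \<in> Q \<union> (\<lambda>z. 1 / z) ` Q \<Longrightarrow> z \<noteq> 0 \<and> cmod z \<noteq> 1"
proof -
  let ?E = "euler_frobenius (2 * m - 2)"
  have Q: "Q = {z. poly ?E z = 0 \<and> cmod z < 1}"
    using q by (simp add: Q_def bij_betw_def)
  have cQ: "card Q = m - 1"
    using bij_betw_same_card[OF q] Q by simp
  have finQ: "finite Q" by (simp add: Q_def)
  have Q0: "0 \<notin> Q" using poly_euler_frobenius_0[OF m] by (auto simp: Q)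
  have R: "poly ?E z = 0" "cmod z > 1" if z: "z \<in> (\<lambda>z. 1 / z) ` Q" for z
  proof -
    obtain y where y: "y \<in> Q" "z = 1 / y" using z by blast
    then have yy: "y \<noteq> 0" "y \<noteq> 1" "poly ?E y = 0" "cmod y < 1" using Q0 by (auto simp: Q)
    show "poly ?E z = 0"
      using poly_euler_frobenius_inverse[OF yy(1,2), of "2 * m - 2"] yy y by auto
    show "cmod z > 1" unfolding y(2) norm_divide using yy by simp
  qed
  show disj: "Q \<inter> (\<lambda>z. 1 / z) ` Q = {}"
    using R(2) by (fastforce simp: Q)
  have "card ((\<lambda>z. 1 / z) ` Q) = m - 1"
    using cQ by (subst card_image) (auto simp: inj_on_def)
  then show card: "card (Q \<union> (\<lambda>z. 1 / z) ` Q) = 2 * m - 2"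
    using finQ disj cQ by (subst card_Un_disjoint) auto
  have "?E \<noteq> 0" using poly_euler_frobenius_0[OF m] by auto
  then have "finite {z. poly ?E z = 0}" "card {z. poly ?E z = 0} \<le> 2 * m - 2"
    using card_poly_roots_bound[of ?E] degree_euler_frobenius[OF m] by (auto simp: poly_roots_finite)
  moreover have "Q \<union> (\<lambda>z. 1 / z) ` Q \<subseteq> {z. poly ?E z = 0}"
    using R(1) Q by blast
  ultimately show "{z. poly ?E z = 0} = Q \<union> (\<lambda>z. 1 / z) ` Q"
    using card by (metis card_seteq)
  show "z \<noteq> 0 \<and> cmod z \<noteq> 1" if "z \<in> Q \<union> (\<lambda>z. 1 / z) ` Q" for z
  proof (cases "z \<in> Q")
    case True
    then have "cmod z < 1" using Q by blast
    with True Q0 show ?thesis by auto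
  next
    case False
    then have "cmod z > 1" using that R(2) by blast
    then show ?thesis by auto
  qed
qed

section \<open>Linear independence of Abel sums\<close>

text \<open>The matrix \<open>diff_zero t j\<close> is triangular with diagonal
  \<open>fact j\<close>, so vanishing passes from the Abel sums to the basic terms, order by
  order.\<close>

lemma basic_abel_term_sum_eq_0:
  assumes j: "1 \<le> j" "j \<le> n"
    and L: "\<And>j. 1 \<le> j \<Longrightarrow> j \<le> n \<Longrightarrow> (\<Sum>z\<in>Z. d z * abel_sum j z) = 0"
  shows "(\<Sum>z\<in>Z. d z * (z ^ j / (1 - z) ^ (j + 1))) = 0"
  using j
proof (induction j rule: less_induct)
  case (less j)
  let ?u = "\<lambda>t z. z ^ t / (1 - z) ^ (t + 1) :: complex"
  have "0 = (\<Sum>z\<in>Z. d z * (\<Sum>t=1..j. diff_zero t j * ?u t z))"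
    using L[of j] less.prems by (simp add: abel_sum_def)
  also have "\<dots> = (\<Sum>t=1..j. diff_zero t j * (\<Sum>z\<in>Z. d z * ?u t z))"
    unfolding sum_distrib_left by (subst sum.swap) (simp add: ac_simps)
  also have "\<dots> = diff_zero j j * (\<Sum>z\<in>Z. d z * ?u j z)"
  proof (subst sum.remove[of _ j])
    show "diff_zero j j * (\<Sum>z\<in>Z. d z * ?u j z) + (\<Sum>t\<in>{1..j} - {j}. diff_zero t j * (\<Sum>z\<in>Z. d z * ?u t z))
      = diff_zero j j * (\<Sum>z\<in>Z. d z * ?u j z)"
      using less by (intro trans[OF arg_cong2[where f = "(+)", OF refl sum.neutral]]) auto
  qed (use less in auto)
  finally show ?case using less.prems by (simp add: diff_zero_diag)
qed

text \<open>With u = z / (1 - z) the basic terms are u^j / (1 - z), and u is injective: a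
  Vandermonde argument at distinct points.\<close>

lemma abel_sums_independent:
  assumes Z: "finite Z" "0 \<notin> Z" "1 \<notin> Z" "card Z \<le> n"
    and L: "\<And>j. 1 \<le> j \<Longrightarrow> j \<le> n \<Longrightarrow> (\<Sum>z\<in>Z. d z * abel_sum j z) = 0"
    and w: "w \<in> Z"
  shows "d w = 0"
proof -
  define u where "u z = z / (1 - z)" for z :: complex
  have inj: "u z \<noteq> u w" if "z \<in> Z" "z \<noteq> w" for z
  proof
    assume "u z = u w"
    moreover have "1 - z \<noteq> 0" "1 - w \<noteq> 0" using Z that w by auto
    ultimately have "z = w" by (simp add: u_def frac_eq_eq algebra_simps)
    with that show False by simp
  qed
  \<comment> \<open>A Lagrange polynomial for the point u w. The extra factor u removes the constant
    term, because no relation of order 0 is available; it is nonzero at u w since w \<noteq> 0, and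
    the degree stays at most card Z.\<close>
  define p where "p = [:0, 1:] * (\<Prod>z\<in>Z - {w}. [:- u z, 1:])"
  have "degree (\<Prod>z\<in>Z - {w}. [:- u z, 1:]) \<le> sum (degree \<circ> (\<lambda>z. [:- u z, 1:])) (Z - {w})"
    by (rule degree_prod_sum_le) (simp add: Z)
  then have "degree (\<Prod>z\<in>Z - {w}. [:- u z, 1:]) \<le> card (Z - {w})" by simp
  then have "degree p \<le> 1 + card (Z - {w})"
    unfolding p_def by (intro order_trans[OF degree_mult_le] add_mono) auto
  also have "\<dots> = card Z" using Z w by (metis card_Suc_Diff1 plus_1_eq_Suc)
  also note Z(4)
  finally have deg: "degree p \<le> n" .
  have "(\<Sum>z\<in>Z. d z / (1 - z) * poly p (u z)) = (\<Sum>i\<le>degree p. coeff p i * (\<Sum>z\<in>Z. d z / (1 - z) * u z ^ i))"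
    unfolding poly_altdef sum_distrib_left by (subst sum.swap) (simp add: ac_simps)
  also have "\<dots> = 0"
  proof (intro sum.neutral ballI)
    fix i assume i: "i \<in> {..degree p}"
    show "coeff p i * (\<Sum>z\<in>Z. d z / (1 - z) * u z ^ i) = 0"
    proof (cases "i = 0")
      case True
      then show ?thesis by (simp add: p_def)
    next
      case False
      then have "(\<Sum>z\<in>Z. d z * (z ^ i / (1 - z) ^ (i + 1))) = 0"
        using i deg by (intro basic_abel_term_sum_eq_0[of i n] L) auto
      then show ?thesis by (simp add: u_def power_divide mult.commute)
    qed
  qed
  finally have 0: "(\<Sum>z\<in>Z. d z / (1 - z) * poly p (u z)) = 0" .
  have "(\<Sum>z\<in>Z. d z / (1 - z) * poly p (u z)) = d w / (1 - w) * poly p (u w)"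
  proof (subst sum.remove[OF Z(1) w])
    have "poly p (u z) = 0" if "z \<in> Z - {w}" for z
      unfolding p_def poly_mult poly_prod using Z that by (auto intro!: prod_zero)
    then show "d w / (1 - w) * poly p (u w) + (\<Sum>z\<in>Z - {w}. d z / (1 - z) * poly p (u z)) = d w / (1 - w) * poly p (u w)"
      by simp
  qed
  moreover have "poly p (u w) \<noteq> 0"
  proof -
    have "(\<Prod>z\<in>Z - {w}. u w - u z) \<noteq> 0"
    proof
      assume "(\<Prod>z\<in>Z - {w}. u w - u z) = 0"
      then obtain z where "z \<in> Z - {w}" "u w - u z = 0" using Z(1) by (auto simp: prod_zero_iff)
      then show False using inj[of z] by auto
    qed
    moreover have "u w \<noteq> 0" using w Z by (auto simp: u_def)
    ultimately show ?thesis by (simp add: p_def poly_prod)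
  qed
  moreover have "1 - w \<noteq> 0" using w Z by auto
  ultimately show ?thesis using 0 by simp
qed

section \<open>Exponential splines on one mesh interval\<close>

text \<open>The Taylor polynomials on one mesh interval of the spline with
  \<open>s (x + 1) = z * s x\<close> whose highest derivative jumps by \<open>z ^ \<beta>\<close> at the integer \<open>\<beta>\<close>.\<close>

definition spline_piece :: "complex \<Rightarrow> nat \<Rightarrow> complex \<Rightarrow> complex" where
  "spline_piece z n y =
     - (\<Sum>j\<le>n. (-1) ^ j * abel_sum j z / fact j * (y ^ (n - j) / fact (n - j)))"

lemma spline_piece_0: "spline_piece z n 0 = - ((-1) ^ n * abel_sum n z / fact n)"
proof -
  have "(\<Sum>j\<le>n. (-1) ^ j * abel_sum j z / fact j * (0 ^ (n - j) / fact (n - j)))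
     = (\<Sum>j\<in>{n}. (-1) ^ j * abel_sum j z / fact j * (0 ^ (n - j) / fact (n - j)))"
    by (intro sum.mono_neutral_right) auto
  then show ?thesis by (simp add: spline_piece_def)
qed

text \<open>Up to \<open>fact n\<close> and signs this is \<open>abel_sum_shift\<close>: a piece
  ends with the value from which the next one, z times the same polynomial, starts. At n = 0 the
  piece is constant, and that is where the jump arises.\<close>

lemma spline_piece_1:
  assumes "n \<ge> 1" "z \<noteq> 0" "z \<noteq> 1"
  shows "spline_piece z n 1 = z * spline_piece z n 0"
proof -
  have "fact n * (\<Sum>j\<le>n. (-1) ^ j * abel_sum j z / fact j * (1 ^ (n - j) / fact (n - j)))
    = (-1) ^ n * (\<Sum>j\<le>n. (-1) ^ (n - j) * of_nat (n choose j) * abel_sum j z)"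
    unfolding sum_distrib_left
  proof (intro sum.cong refl)
    fix j assume "j \<in> {..n}"
    moreover from this have "(-1) ^ n * (-1) ^ (n - j) = ((-1) ^ j :: complex)"
      by (simp add: minus_one_power_iff)
    ultimately show "fact n * ((-1) ^ j * abel_sum j z / fact j * (1 ^ (n - j) / fact (n - j)))
      = (-1) ^ n * ((-1) ^ (n - j) * of_nat (n choose j) * abel_sum j z)"
      by (simp add: binomial_fact mult.assoc[symmetric])
  qed
  then have "fact n * spline_piece z n 1 = - ((-1) ^ n * (z * abel_sum n z))"
    unfolding abel_sum_shift[OF assms] spline_piece_def by simp
  then show ?thesis
    unfolding spline_piece_0 by (simp add: field_simps)
qed

lemma has_field_derivative_spline_piece:
  "(spline_piece z (Suc n) has_field_derivative spline_piece z n y) (at y)"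
proof -
  have "((\<lambda>y. y ^ (Suc n - j) / fact (Suc n - j)) has_field_derivative
      (if j \<le> n then y ^ (n - j) / fact (n - j) else 0)) (at y)" for j and y :: complex
  proof (cases "j \<le> n")
    case True
    then have "Suc n - j = Suc (n - j)" by simp
    moreover have "((\<lambda>y. y ^ Suc (n - j) / fact (Suc (n - j))) has_field_derivative
       (y ^ (n - j) / fact (n - j))) (at y)"
      by (auto intro!: derivative_eq_intros simp del: power_Suc of_nat_Suc)
    ultimately show ?thesis using True by simp
  qed simp
  then have "((\<lambda>y. - (\<Sum>j\<le>Suc n. (-1) ^ j * abel_sum j z / fact j * (y ^ (Suc n - j) / fact (Suc n - j))))
    has_field_derivative - (\<Sum>j\<le>Suc n. (-1) ^ j * abel_sum j z / fact j *
       (if j \<le> n then y ^ (n - j) / fact (n - j) else 0))) (at y)"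
    by (intro DERIV_minus DERIV_sum DERIV_cmult)
  moreover have "(\<Sum>j\<le>Suc n. (-1) ^ j * abel_sum j z / fact j *
       (if j \<le> n then y ^ (n - j) / fact (n - j) else 0)) =
     (\<Sum>j\<le>n. (-1) ^ j * abel_sum j z / fact j * (y ^ (n - j) / fact (n - j)))"
    by (simp, rule sum.cong) auto
  ultimately show ?thesis unfolding spline_piece_def[abs_def] by (simp only:)
qed

lemma spline_piece_const: "spline_piece z 0 y = z / (z - 1)"
  by (simp add: spline_piece_def abel_sum_def) (metis minus_diff_eq minus_divide_right)

section \<open>The normalizing constant of the exponential spline\<close>

lemma wave_eq_1_iff: "wave \<omega> h = 1 \<longleftrightarrow> \<omega> * h \<in> \<int>"
proof -
  have "wave \<omega> h = 1 \<longleftrightarrow> (\<exists>n::int. \<omega> * h = of_int n)"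
    unfolding wave_def exp_eq_1 by (auto simp: algebra_simps)
  then show ?thesis by (auto elim!: Ints_cases)
qed

text \<open>K times \<open>wave \<omega> a\<close> is the weight with which the spline of base
  \<open>wave \<omega> h\<close> interpolates at the nodes. With \<theta> = \<pi> \<omega> h, the
  sines come from 1 - e^(2 i \<theta>) = -2 i sin \<theta> e^(i \<theta>), and the cosines from the
  palindromic polynomial on the unit circle.\<close>

lemma K_const_abel_sum:
  assumes m: "m \<ge> 1" and om: "\<omega> * h \<notin> \<int>"
    and E: "poly (euler_frobenius (2 * m - 2)) (wave \<omega> h) \<noteq> 0"
  shows "of_real (K_const m h \<omega>) * abel_sum (2 * m - 1) (wave \<omega> h)
     = fact (2 * m - 1) / (2 * of_real pi * \<i> * of_real \<omega> * of_real h) ^ (2 * m)"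
proof -
  define \<theta> where "\<theta> = pi * \<omega> * h"
  define l where "l = wave \<omega> h"
  have l: "l = cis (2 * \<theta>)" by (simp add: l_def wave_def \<theta>_def cis_conv_exp mult_ac)
  have l0: "l \<noteq> 0" by (simp add: l_def wave_def)
  have th: "\<theta> \<noteq> 0" using om by (auto simp: \<theta>_def)
  have sn: "sin \<theta> \<noteq> 0"
    using om sin_times_pi_eq_0[of "\<omega> * h"] by (simp add: \<theta>_def mult_ac)
  have "1 - l = - (2 * \<i> * sin \<theta> * cis \<theta>)"
    unfolding l complex_eq_iff by (simp add: cos_double_sin sin_double power2_eq_square)
  moreover have "cis \<theta> ^ (2 * m) = l ^ m"
    by (simp add: l Complex.DeMoivre mult_ac)
  ultimately have pw: "(1 - l) ^ (2 * m) = (2 * \<i> * sin \<theta>) ^ (2 * m) * l ^ m"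
    by (simp only: power_minus_even even_mult_iff even_numeral simp_thms) (simp only: power_mult_distrib)
  have l1: "l \<noteq> 1"
  proof
    assume "l = 1"
    with pw m have "(2 * \<i> * sin \<theta>) ^ (2 * m) = 0" by (simp add: zero_power)
    with sn show False by simp
  qed
  define den where "den = 2 * (\<Sum>\<alpha><m - 1. ef_coeff m \<alpha> * cos (2 * pi * \<omega> * h * real (m - 1 - \<alpha>)))
         + ef_coeff m (m - 1)"
  \<comment> \<open>The coefficients of orders s and 2 * m - 2 - s are equal; once the middle power
    l^(m - 1) is factored out, their powers pair to twice a cosine, and the middle coefficient stays
    single.\<close>
  have den: "poly (euler_frobenius (2 * m - 2)) l = l ^ (m - 1) * of_real den"
  proof -
    have "(\<Sum>s=0..2 * m - 2. of_real (ef_coeff m s) * l ^ s) =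
      (\<Sum>s\<in>{..<m - 1}. of_real (ef_coeff m s) * l ^ s) + of_real (ef_coeff m (m - 1)) * l ^ (m - 1)
      + (\<Sum>s\<in>{m..2 * m - 2}. of_real (ef_coeff m s) * l ^ s)"
    proof -
      have "{0..2 * m - 2} = ({..<m - 1} \<union> {m - 1}) \<union> {m..2 * m - 2}" using m by auto
      then show ?thesis using m by (simp only:) (subst sum.union_disjoint; auto)+
    qed
    also have "(\<Sum>s\<in>{m..2 * m - 2}. of_real (ef_coeff m s) * l ^ s) =
      (\<Sum>s\<in>{..<m - 1}. of_real (ef_coeff m s) * l ^ (2 * m - 2 - s))"
    proof (rule sum.reindex_bij_witness[of _ "\<lambda>s. 2 * m - 2 - s" "\<lambda>s. 2 * m - 2 - s"])
      fix s assume s: "s \<in> {m..2 * m - 2}"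
      then have "2 * m - 2 - (2 * m - 2 - s) = s" by auto
      then show "of_real (ef_coeff m (2 * m - 2 - s)) * l ^ (2 * m - 2 - (2 * m - 2 - s)) = of_real (ef_coeff m s) * l ^ s"
        using ef_coeff_symmetric[OF m, of s] s by simp
    qed (use m in auto)
    also have "(\<Sum>s\<in>{..<m - 1}. of_real (ef_coeff m s) * l ^ s) + of_real (ef_coeff m (m - 1)) * l ^ (m - 1)
      + (\<Sum>s\<in>{..<m - 1}. of_real (ef_coeff m s) * l ^ (2 * m - 2 - s))
      = (\<Sum>s\<in>{..<m - 1}. of_real (ef_coeff m s) * (l ^ s + l ^ (2 * m - 2 - s))) + of_real (ef_coeff m (m - 1)) * l ^ (m - 1)"
      by (simp add: sum.distrib distrib_left)
    also have "\<dots> = l ^ (m - 1) * of_real den"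
    proof -
      have "l ^ s + l ^ (2 * m - 2 - s) = l ^ (m - 1) * of_real (2 * cos (2 * pi * \<omega> * h * real (m - 1 - s)))"
        if "s < m - 1" for s
      proof -
        define r where "r = m - 1 - s"
        have r: "m - 1 = s + r" "2 * m - 2 - s = s + 2 * r" using that by (auto simp: r_def)
        have "of_real (2 * cos (2 * \<theta> * real r)) = cis (2 * \<theta> * r) + cis (- (2 * \<theta> * r))"
          by (simp add: complex_eq_iff)
        moreover have lr: "l ^ r = cis (2 * \<theta> * r)" by (simp add: l Complex.DeMoivre mult_ac)
        moreover have "cis (2 * \<theta> * r) * cis (- (2 * \<theta> * r)) = 1" by (simp add: cis_mult)
        moreover have "l ^ (2 * r) = cis (2 * \<theta> * r) * cis (2 * \<theta> * r)"
          unfolding mult_2 power_add lr ..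
        ultimately have "l ^ r * of_real (2 * cos (2 * \<theta> * real r)) = 1 + l ^ (2 * r)"
          by (simp only: distrib_left add.commute)
        then have "l ^ s + l ^ (s + 2 * r) = l ^ s * (l ^ r * of_real (2 * cos (2 * \<theta> * real r)))"
          by (simp add: power_add distrib_left)
        moreover have "l ^ (m - 1) = l ^ s * l ^ r" by (simp only: r(1) power_add)
        ultimately show ?thesis unfolding r_def[symmetric] r(2) by (simp add: \<theta>_def mult_ac)
      qed
      then have "(\<Sum>s\<in>{..<m - 1}. of_real (ef_coeff m s) * (l ^ s + l ^ (2 * m - 2 - s)))
        = (\<Sum>s\<in>{..<m - 1}. of_real (ef_coeff m s) * (l ^ (m - 1) * of_real (2 * cos (2 * pi * \<omega> * h * real (m - 1 - s)))))"
        by (intro sum.cong) auto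
      then show ?thesis
        by (simp add: den_def sum_distrib_left algebra_simps)
    qed
    finally show ?thesis unfolding poly_euler_frobenius_sum[OF m] .
  qed
  have den0: "of_real den \<noteq> (0 :: complex)" using E den l_def by auto
  have "abel_sum (2 * m - 1) l = l * poly (euler_frobenius (2 * m - 2)) l / (1 - l) ^ (2 * m)"
  proof -
    have "2 * m - 2 + 1 = 2 * m - 1" "2 * m - 2 + 2 = 2 * m" using m by auto
    then show ?thesis using abel_sum_euler_frobenius[OF l0 l1, of "2 * m - 2"] by simp
  qed
  also have "l * poly (euler_frobenius (2 * m - 2)) l = l ^ m * of_real den"
    unfolding den using m by (cases m) auto
  also have "l ^ m * of_real den / (1 - l) ^ (2 * m) = of_real den / (2 * \<i> * sin \<theta>) ^ (2 * m)"
    unfolding pw using l0 by simp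
  finally have A: "abel_sum (2 * m - 1) l = of_real den / (2 * \<i> * sin \<theta>) ^ (2 * m)" .
  have B: "of_real (K_const m h \<omega>) = (sin \<theta> / \<theta>) ^ (2 * m) * (fact (2 * m - 1) / of_real den :: complex)"
    by (simp add: K_const_def \<theta>_def den_def)
  have C: "2 * of_real pi * \<i> * of_real \<omega> * of_real h = 2 * \<i> * of_real \<theta>" by (simp add: \<theta>_def)
  show ?thesis
    unfolding l_def[symmetric] A B C power_mult_distrib power_divide
    using sn th den0 by (simp add: divide_simps)
qed

section \<open>Absolute continuity\<close>

definition small_family :: "real \<Rightarrow> real \<Rightarrow> real \<Rightarrow> (real \<times> real) set \<Rightarrow> bool" where
  "small_family a b \<delta> S \<longleftrightarrow> finite S \<and> (\<forall>(u, v)\<in>S. a \<le> u \<and> u < v \<and> v \<le> b) \<and>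
     pairwise (\<lambda>(u, v) (u', v'). {u<..<v} \<inter> {u'<..<v'} = {}) S \<and> (\<Sum>(u, v)\<in>S. v - u) < \<delta>"

lemma abs_continuous_on_iff:
  "abs_continuous_on a b f \<longleftrightarrow>
     (\<forall>\<epsilon>>0. \<exists>\<delta>>0. \<forall>S. small_family a b \<delta> S \<longrightarrow> (\<Sum>(u, v)\<in>S. cmod (f v - f u)) < \<epsilon>)"
  unfolding abs_continuous_on_def small_family_def imp_conjL ..

lemma abs_continuous_on_subinterval:
  assumes "abs_continuous_on a b f" "a \<le> u" "v \<le> b"
  shows "abs_continuous_on u v f"
proof -
  have "small_family a b \<delta> S" if "small_family u v \<delta> S" for \<delta> S
    using that assms(2,3) unfolding small_family_def by fastforce
  then show ?thesis using assms(1) unfolding abs_continuous_on_iff by meson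
qed

lemma abs_continuous_imp_continuous:
  assumes "abs_continuous_on a b f"
  shows "continuous_on {a..b} f"
  unfolding continuous_on_iff
proof (intro ballI allI impI)
  fix x \<epsilon> :: real assume x: "x \<in> {a..b}" and "\<epsilon> > 0"
  then obtain \<delta> where d: "\<delta> > 0"
    "\<And>S. small_family a b \<delta> S \<Longrightarrow> (\<Sum>(u, v)\<in>S. cmod (f v - f u)) < \<epsilon>"
    using assms unfolding abs_continuous_on_iff by meson
  show "\<exists>d>0. \<forall>x'\<in>{a..b}. dist x' x < d \<longrightarrow> dist (f x') (f x) < \<epsilon>"
  proof (intro exI[of _ \<delta>] conjI d(1) ballI impI)
    fix y assume y: "y \<in> {a..b}" "dist y x < \<delta>"
    consider "y = x" | "y < x" | "x < y" by linarith
    then show "dist (f y) (f x) < \<epsilon>"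
    proof cases
      case 2
      then show ?thesis using d(2)[of "{(y, x)}"] x y
        by (simp add: small_family_def dist_norm norm_minus_commute)
    next
      case 3
      then show ?thesis using d(2)[of "{(x, y)}"] x y
        by (simp add: small_family_def dist_norm norm_minus_commute)
    qed (use \<open>\<epsilon> > 0\<close> in simp)
  qed
qed

lemma lipschitz_imp_abs_continuous:
  assumes "L-lipschitz_on {a..b} f"
  shows "abs_continuous_on a b f"
  unfolding abs_continuous_on_iff
proof (intro allI impI)
  fix \<epsilon> :: real assume "\<epsilon> > 0"
  have L: "0 \<le> L" using assms by (rule lipschitz_on_nonneg)
  show "\<exists>\<delta>>0. \<forall>S. small_family a b \<delta> S \<longrightarrow> (\<Sum>(u, v)\<in>S. cmod (f v - f u)) < \<epsilon>"
  proof (intro exI[of _ "\<epsilon> / (L + 1)"] conjI allI impI)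
    show "\<epsilon> / (L + 1) > 0" using \<open>\<epsilon> > 0\<close> L by simp
    fix S assume "small_family a b (\<epsilon> / (L + 1)) S"
    then have S: "\<And>u v. (u, v) \<in> S \<Longrightarrow> a \<le> u \<and> u < v \<and> v \<le> b"
      and lt: "(\<Sum>(u, v)\<in>S. v - u) < \<epsilon> / (L + 1)"
      by (auto simp: small_family_def)
    have "(\<Sum>(u, v)\<in>S. cmod (f v - f u)) \<le> (\<Sum>(u, v)\<in>S. (L + 1) * (v - u))"
    proof (intro sum_mono, clarify)
      fix u v assume "(u, v) \<in> S"
      then have uv: "a \<le> u" "u < v" "v \<le> b" using S by auto
      then have "cmod (f v - f u) \<le> L * (v - u)"
        using lipschitz_onD[OF assms, of v u] by (simp add: dist_norm)
      also have "\<dots> \<le> (L + 1) * (v - u)" using uv by (intro mult_right_mono) auto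
      finally show "cmod (f v - f u) \<le> (L + 1) * (v - u)" .
    qed
    also have "\<dots> = (L + 1) * (\<Sum>(u, v)\<in>S. v - u)"
      by (simp add: sum_distrib_left case_prod_beta)
    also have "\<dots> < (L + 1) * (\<epsilon> / (L + 1))"
      using lt L by (intro mult_strict_left_mono) auto
    also have "\<dots> = \<epsilon>" using L by simp
    finally show "(\<Sum>(u, v)\<in>S. cmod (f v - f u)) < \<epsilon>" .
  qed
qed

lemma C1_imp_lipschitz:
  fixes f f' :: "real \<Rightarrow> complex"
  assumes f: "\<And>x. x \<in> {a..b} \<Longrightarrow> (f has_vector_derivative f' x) (at x within {a..b})"
    and cont: "continuous_on {a..b} f'"
  shows "\<exists>L. L-lipschitz_on {a..b} f"
proof -
  have "bounded (f' ` {a..b})"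
    by (intro compact_imp_bounded compact_continuous_image cont) simp
  then obtain B where B: "B > 0" "\<forall>x\<in>{a..b}. cmod (f' x) \<le> B"
    unfolding bounded_pos ball_simps by (elim exE conjE)
  have "B-lipschitz_on {a..b} f"
  proof (rule bounded_derivative_imp_lipschitz)
    fix x assume x: "x \<in> {a..b}"
    show "(f has_derivative (\<lambda>h. h *\<^sub>R f' x)) (at x within {a..b})"
      using f[OF x] by (simp add: has_vector_derivative_def)
    show "onorm (\<lambda>h. h *\<^sub>R f' x) \<le> B"
      using B x by (intro onorm_le) (auto simp: mult.commute[of B] intro!: mult_left_mono)
  qed (use B in auto)
  then show ?thesis ..
qed

lemma abs_continuous_on_mult:
  assumes f: "abs_continuous_on a b f" and g: "abs_continuous_on a b g"
  shows "abs_continuous_on a b (\<lambda>x. f x * g x)"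
  unfolding abs_continuous_on_iff
proof (intro allI impI)
  fix \<epsilon> :: real assume e: "\<epsilon> > 0"
  have "bounded (f ` {a..b})" "bounded (g ` {a..b})"
    using f g by (auto intro!: compact_imp_bounded compact_continuous_image abs_continuous_imp_continuous)
  then obtain A B where "\<forall>x\<in>{a..b}. cmod (f x) \<le> A" "\<forall>x\<in>{a..b}. cmod (g x) \<le> B"
    "A > 0" "B > 0"
    unfolding bounded_pos ball_simps by (elim exE conjE)
  then have AB: "\<And>x. x \<in> {a..b} \<Longrightarrow> cmod (f x) \<le> A" "\<And>x. x \<in> {a..b} \<Longrightarrow> cmod (g x) \<le> B"
    "A > 0" "B > 0" by auto
  have "\<epsilon> / (2 * B) > 0" "\<epsilon> / (2 * A) > 0" using e AB by auto
  obtain \<delta>1 where d1: "\<delta>1 > 0"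
    "\<And>S. small_family a b \<delta>1 S \<Longrightarrow> (\<Sum>(u, v)\<in>S. cmod (f v - f u)) < \<epsilon> / (2 * B)"
    using f \<open>\<epsilon> / (2 * B) > 0\<close> unfolding abs_continuous_on_iff by meson
  obtain \<delta>2 where d2: "\<delta>2 > 0"
    "\<And>S. small_family a b \<delta>2 S \<Longrightarrow> (\<Sum>(u, v)\<in>S. cmod (g v - g u)) < \<epsilon> / (2 * A)"
    using g \<open>\<epsilon> / (2 * A) > 0\<close> unfolding abs_continuous_on_iff by meson
  show "\<exists>\<delta>>0. \<forall>S. small_family a b \<delta> S \<longrightarrow>
        (\<Sum>(u, v)\<in>S. cmod (f v * g v - f u * g u)) < \<epsilon>"
  proof (intro exI[of _ "min \<delta>1 \<delta>2"] conjI allI impI)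
    show "min \<delta>1 \<delta>2 > 0" using d1 d2 by simp
    fix S assume S: "small_family a b (min \<delta>1 \<delta>2) S"
    then have S1: "small_family a b \<delta>1 S" and S2: "small_family a b \<delta>2 S"
      by (auto simp: small_family_def)
    note 1 = d1(2)[OF S1] and 2 = d2(2)[OF S2]
    have "(\<Sum>(u, v)\<in>S. cmod (f v * g v - f u * g u))
        \<le> (\<Sum>(u, v)\<in>S. B * cmod (f v - f u) + A * cmod (g v - g u))"
    proof (intro sum_mono, clarify)
      fix u v assume "(u, v) \<in> S"
      then have uv: "u \<in> {a..b}" "v \<in> {a..b}" using S by (auto simp: small_family_def)
      have "f v * g v - f u * g u = (f v - f u) * g v + f u * (g v - g u)"
        by (simp add: algebra_simps)
      then have "cmod (f v * g v - f u * g u) \<le> cmod (f v - f u) * cmod (g v) + cmod (f u) * cmod (g v - g u)"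
        by (metis norm_mult norm_triangle_ineq)
      also have "\<dots> \<le> cmod (f v - f u) * B + A * cmod (g v - g u)"
        using AB uv by (intro add_mono mult_mono) (auto intro: less_imp_le)
      finally show "cmod (f v * g v - f u * g u) \<le> B * cmod (f v - f u) + A * cmod (g v - g u)"
        by (simp add: mult.commute)
    qed
    also have "\<dots> = B * (\<Sum>(u, v)\<in>S. cmod (f v - f u)) + A * (\<Sum>(u, v)\<in>S. cmod (g v - g u))"
      by (simp add: sum_distrib_left case_prod_beta sum.distrib)
    also have "\<dots> < B * (\<epsilon> / (2 * B)) + A * (\<epsilon> / (2 * A))"
      using 1 2 AB by (intro add_strict_mono mult_strict_left_mono) auto
    also have "\<dots> = \<epsilon>" using AB by simp
    finally show "(\<Sum>(u, v)\<in>S. cmod (f v * g v - f u * g u)) < \<epsilon>" .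
  qed
qed

section \<open>The fundamental theorem of calculus for absolutely continuous functions\<close>

text \<open>The tagged intervals become a family as in the definition of absolute continuity:
  degenerate ones carry no increment and are dropped, and since the others do not overlap and lie in
  U, their total length is at most its measure.\<close>

lemma abs_continuous_tagged_sum_less:
  assumes d: "\<And>S. small_family a b \<delta> S \<Longrightarrow> (\<Sum>(u, v)\<in>S. cmod (f v - f u)) < \<epsilon>"
    and p: "p tagged_partial_division_of {a..b}"
    and U: "\<And>x K. (x, K) \<in> p \<Longrightarrow> K \<subseteq> U" "U \<in> lmeasurable" "measure lebesgue U < \<delta>"
  shows "(\<Sum>(x, K)\<in>p. cmod (f (Sup K) - f (Inf K))) < \<epsilon>"
proof -
  define D where "D = snd ` p"
  have D: "D division_of \<Union>D"
    unfolding D_def by (rule partial_division_of_tagged_division[OF p])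
  have p': "p tagged_division_of \<Union>D"
    unfolding D_def by (rule tagged_partial_division_of_Union_self[OF p])
  define D' where "D' = {K \<in> D. Inf K < Sup K}"
  define S where "S = (\<lambda>K. (Inf K, Sup K :: real)) ` D'"
  have finD: "finite D" using D by (rule division_of_finite)
  have intv: "\<exists>u v. u \<le> v \<and> K = {u..v} \<and> a \<le> u \<and> v \<le> b" if K: "K \<in> D" for K
  proof -
    obtain x where "(x, K) \<in> p" using K by (auto simp: D_def)
    then have "x \<in> K" "K \<subseteq> {a..b}" "\<exists>u v. K = cbox u v"
      using tagged_partial_division_ofD[OF p] by blast+
    then obtain u v where "K = {u..v}" "u \<le> v" by auto
    with \<open>K \<subseteq> {a..b}\<close> show ?thesis by (intro exI[of _ u] exI[of _ v]) auto
  qed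
  have inj: "inj_on (\<lambda>K. (Inf K, Sup K :: real)) D"
  proof (rule inj_onI)
    fix K K' assume "K \<in> D" "K' \<in> D" "(Inf K, Sup K) = (Inf K', Sup K' :: real)"
    then show "K = K'" using intv[of K] intv[of K'] by auto
  qed
  have inj': "inj_on (\<lambda>K. (Inf K, Sup K :: real)) D'"
    by (rule inj_on_subset[OF inj]) (auto simp: D'_def)
  \<comment> \<open>\<open>Sup\<close> and \<open>Inf\<close> of the empty set are unspecified. The
    case distinction makes the increment 0 on every degenerate box, as the passage from tagged pairs
    to intervals requires.\<close>
  define \<Delta> where "\<Delta> K = (if K = {} then 0 else cmod (f (Sup K) - f (Inf K)))" for K
  have "(\<Sum>(x, K)\<in>p. cmod (f (Sup K) - f (Inf K))) = (\<Sum>(x, K)\<in>p. \<Delta> K)"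
    using intv by (intro sum.cong refl) (force simp: D_def \<Delta>_def)
  also have "\<dots> = (\<Sum>K\<in>D. \<Delta> K)"
    unfolding D_def
  proof (rule sum.over_tagged_division_lemma[OF p'])
    fix u v :: real assume "box u v = {}"
    then have "v \<le> u" by simp
    then show "\<Delta> (cbox u v) = 0" by (cases "u = v") (auto simp: \<Delta>_def)
  qed
  also have "\<dots> = (\<Sum>K\<in>D. cmod (f (Sup K) - f (Inf K)))"
    using intv by (intro sum.cong refl) (force simp: \<Delta>_def)
  also have "\<dots> = (\<Sum>K\<in>D'. cmod (f (Sup K) - f (Inf K)))"
    using finD intv by (intro sum.mono_neutral_right) (force simp: D'_def)+
  also have "\<dots> = (\<Sum>(u, v)\<in>S. cmod (f v - f u))"
    unfolding S_def by (subst sum.reindex[OF inj']) (simp add: o_def)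
  also have "\<dots> < \<epsilon>"
  proof (rule d, unfold small_family_def, intro conjI)
    show "finite S" unfolding S_def D'_def using finD by auto
    show "\<forall>(u, v)\<in>S. a \<le> u \<and> u < v \<and> v \<le> b"
      using intv by (force simp: S_def D'_def)
    show "pairwise (\<lambda>(u, v) (u', v'). {u<..<v} \<inter> {u'<..<v'} = {}) S"
    proof (rule pairwiseI)
      fix s t assume st: "s \<in> S" "t \<in> S" "s \<noteq> t"
      obtain u v u' v' where "s = (u, v)" "t = (u', v')" by (cases s, cases t) auto
      with st have *: "(u, v) \<in> S" "(u', v') \<in> S" "(u, v) \<noteq> (u', v')" by auto
      then obtain K K' where K: "K \<in> D" "K' \<in> D" "u = Inf K" "v = Sup K" "u' = Inf K'" "v' = Sup K'"
        by (auto simp: S_def D'_def)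
      then have "K \<noteq> K'" using * by auto
      then have "interior K \<inter> interior K' = {}"
        using division_ofD(5)[OF D] K by blast
      moreover have "interior K = {u<..<v}" "interior K' = {u'<..<v'}"
        using intv[OF K(1)] intv[OF K(2)] K by auto
      ultimately show "(\<lambda>(u, v) (u', v'). {u<..<v} \<inter> {u'<..<v'} = {}) s t"
        using \<open>s = (u, v)\<close> \<open>t = (u', v')\<close> by simp
    qed
    have "(\<Sum>(u, v)\<in>S. v - u) = (\<Sum>K\<in>D'. Sup K - Inf K)"
      unfolding S_def by (subst sum.reindex[OF inj']) (simp add: o_def)
    also have "\<dots> = (\<Sum>K\<in>D. Sup K - Inf K)"
      using finD intv by (intro sum.mono_neutral_left) (force simp: D'_def)+
    also have "\<dots> = (\<Sum>K\<in>D. measure lebesgue K)"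
      using intv by (intro sum.cong refl) force
    also have "\<dots> = measure lebesgue (\<Union>D)"
      by (rule content_division[OF D])
    also have "\<dots> \<le> measure lebesgue U"
    proof (rule measure_mono_fmeasurable)
      show "\<Union>D \<subseteq> U" using U(1) by (fastforce simp: D_def)
      show "\<Union>D \<in> sets lebesgue" using lmeasurable_division[OF D] by auto
    qed (rule U(2))
    also have "\<dots> < \<delta>" by (rule U(3))
    finally show "(\<Sum>(u, v)\<in>S. v - u) < \<delta>" .
  qed
  finally show ?thesis .
qed

text \<open>The gauge is the usual one off the exceptional set \<open>E\<close>; on \<open>E\<close> it forces the intervals
  into an open set of small measure, where absolute continuity bounds the increments.\<close>

theorem fundamental_theorem_of_calculus_abs_continuous:
  fixes f :: "real \<Rightarrow> complex"
  assumes ab: "a \<le> b" and f: "abs_continuous_on a b f" and E: "negligible E"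
    and vecd: "\<And>x. x \<in> {a..b} - E \<Longrightarrow> (f has_vector_derivative f' x) (at x within {a..b})"
  shows "(f' has_integral (f b - f a)) {a..b}"
proof (cases "a = b")
  case True
  then show ?thesis by (simp add: has_integral_refl)
next
  case False
  with ab have ab: "a < b" by simp
  \<comment> \<open>Zero on E, so that a tag in E contributes only an increment of f; the change on
    a negligible set is undone at the end.\<close>
  define g where "g x = (if x \<in> E then 0 else f' x)" for x
  have "(g has_integral (f b - f a)) {a..b}"
    unfolding has_integral_factor_content_real
  proof safe
    fix e :: real assume e: "e > 0"
    have "\<forall>x. \<exists>d>0. x \<in> {a..b} - E \<longrightarrow>
         (\<forall>y\<in>{a..b}. norm (y-x) < d \<longrightarrow> norm (f y - f x - (y-x) *\<^sub>R f' x) \<le> e / 2 * norm (y-x))"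
      using vecd[unfolded has_vector_derivative_def has_derivative_within_alt] e
      by (meson half_gt_zero zero_less_one)
    then obtain d where d: "\<And>x. 0 < d x"
                 "\<And>x y. \<lbrakk>x \<in> {a..b} - E; y \<in> {a..b}; norm (y-x) < d x\<rbrakk>
                        \<Longrightarrow> norm (f y - f x - (y-x) *\<^sub>R f' x) \<le> e / 2 * norm (y-x)"
      by metis
    have eab: "e / 2 * (b - a) > 0" using e ab by simp
    obtain \<delta> where del: "\<delta> > 0"
      "\<And>S. small_family a b \<delta> S \<Longrightarrow> (\<Sum>(u, v)\<in>S. cmod (f v - f u)) < e / 2 * (b - a)"
      using f eab unfolding abs_continuous_on_iff by meson
    obtain U where U: "open U" "E \<subseteq> U" "U \<in> lmeasurable" "measure lebesgue U < \<delta>"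
    proof -
      obtain T where T: "open T" "E \<subseteq> T" "(T - E) \<in> lmeasurable" "emeasure lebesgue (T - E) < ennreal \<delta>"
        using sets_lebesgue_outer_open[OF negligible_imp_sets[OF E] del(1)] .
      have E0: "E \<in> lmeasurable" "measure lebesgue E = 0"
        using E by (auto simp: negligible_iff_measure)
      have "T = (T - E) \<union> E" using T by auto
      then have "T \<in> lmeasurable" using T(3) E0(1) by (metis fmeasurable.Un)
      have "measure lebesgue T \<le> measure lebesgue (T - E) + measure lebesgue E"
        using \<open>T = (T - E) \<union> E\<close> T(3) E0(1) by (metis measure_Un_le fmeasurableD)
      also have "\<dots> < \<delta>"
        using T(3,4) del(1) E0 by (simp add: emeasure_eq_measure2 ennreal_less_iff)
      finally show ?thesis using that[of T] T \<open>T \<in> lmeasurable\<close> by blast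
    qed
    define \<gamma> where "\<gamma> x = (if x \<in> E then U else ball x (d x))" for x
    show "\<exists>\<gamma>. gauge \<gamma> \<and> (\<forall>p. p tagged_division_of {a..b} \<and> \<gamma> fine p \<longrightarrow>
      norm ((\<Sum>(x, k)\<in>p. measure lborel k *\<^sub>R g x) - (f b - f a)) \<le> e * measure lborel {a..b})"
    proof (intro exI[of _ \<gamma>] conjI allI impI)
      show "gauge \<gamma>" using U d(1) by (auto simp: gauge_def \<gamma>_def)
      fix p assume "p tagged_division_of {a..b} \<and> \<gamma> fine p"
      then have p: "p tagged_division_of {a..b}" and fine: "\<gamma> fine p" by auto
      note tD = tagged_division_ofD[OF p]
      define p1 where "p1 = {(x, K) \<in> p. x \<in> E}"
      define p2 where "p2 = {(x, K) \<in> p. x \<notin> E}"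
      have pp: "p = p1 \<union> p2" "p1 \<inter> p2 = {}" "finite p1" "finite p2"
        using tD(1) finite_subset[of p1 p] finite_subset[of p2 p] by (auto simp: p1_def p2_def)
      have ba: "b - a = (\<Sum>(x,K)\<in>p. Sup K - Inf K)" "f b - f a = (\<Sum>(x,K)\<in>p. f(Sup K) - f(Inf K))"
        using additive_tagged_division_1[OF less_imp_le[OF ab] p, of "\<lambda>x. x"]
          additive_tagged_division_1[OF less_imp_le[OF ab] p, of f] by simp_all
      have intv: "\<exists>u v. u \<le> v \<and> K = {u..v} \<and> x \<in> K \<and> K \<subseteq> {a..b}" if "(x, K) \<in> p" for x K
      proof -
        have "x \<in> K" "K \<subseteq> {a..b}" "\<exists>u v. K = cbox u v"
          using tD(2-4)[OF that] by auto
        then show ?thesis by fastforce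
      qed
      have s1: "(\<Sum>(x, K)\<in>p1. cmod (f (Sup K) - f (Inf K))) < e / 2 * (b - a)"
      proof (rule abs_continuous_tagged_sum_less[OF del(2)])
        show "p1 tagged_partial_division_of {a..b}"
          using p pp(1) tagged_partial_division_subset tagged_division_of_def by (metis Un_upper1)
        show "K \<subseteq> U" if "(x, K) \<in> p1" for x K
          using that fineD[OF fine, of x K] by (auto simp: p1_def \<gamma>_def)
      qed (use U in auto)
      have s2: "(\<Sum>(x, K)\<in>p2. cmod (measure lborel K *\<^sub>R g x - (f (Sup K) - f (Inf K)))) \<le> e / 2 * (b - a)"
      proof -
        have "(\<Sum>(x, K)\<in>p2. cmod (measure lborel K *\<^sub>R g x - (f (Sup K) - f (Inf K))))
           \<le> (\<Sum>(x, K)\<in>p2. e / 2 * (Sup K - Inf K))"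
        proof (intro sum_mono, clarify)
          fix x K assume xK: "(x, K) \<in> p2"
          then have xp: "(x, K) \<in> p" "x \<notin> E" by (auto simp: p2_def)
          then obtain u v where uv: "u \<le> v" "K = {u..v}" "x \<in> K" "K \<subseteq> {a..b}" using intv by blast
          have ball: "K \<subseteq> ball x (d x)" using fineD[OF fine xp(1)] xp(2) by (simp add: \<gamma>_def)
          have "u \<in> K" "v \<in> K" using uv by auto
          then have "norm (u - x) < d x" "norm (v - x) < d x" "u \<in> {a..b}" "v \<in> {a..b}" "x \<in> {a..b} - E"
            using ball[THEN subsetD, of u] ball[THEN subsetD, of v] uv xp
            by (auto simp: dist_norm norm_minus_commute)
          then have bd: "norm (f u - f x - (u - x) *\<^sub>R f' x) \<le> e / 2 * norm (u - x)"
             "norm (f v - f x - (v - x) *\<^sub>R f' x) \<le> e / 2 * norm (v - x)"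
            using d(2) by blast+
          have "measure lborel K *\<^sub>R g x - (f (Sup K) - f (Inf K)) = (v - u) *\<^sub>R f' x - (f v - f u)"
            using uv xp by (simp add: g_def)
          \<comment> \<open>Both end points are compared with the tag x between them, so the two
            errors add up to e / 2 times the length of the interval.\<close>
          also have "\<dots> = (f u - f x - (u - x) *\<^sub>R f' x) - (f v - f x - (v - x) *\<^sub>R f' x)"
            by (simp add: algebra_simps)
          also have "norm \<dots> \<le> e / 2 * norm (u - x) + e / 2 * norm (v - x)"
            by (rule order_trans[OF norm_triangle_ineq4 add_mono[OF bd]])
          also have "\<dots> = e / 2 * (v - u)"
            using uv by (simp add: field_simps)
          also have "\<dots> = e / 2 * (Sup K - Inf K)" using uv by simp
          finally show "cmod (measure lborel K *\<^sub>R g x - (f (Sup K) - f (Inf K))) \<le> e / 2 * (Sup K - Inf K)" .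
        qed
        also have "\<dots> \<le> (\<Sum>(x, K)\<in>p. e / 2 * (Sup K - Inf K))"
        proof (rule sum_mono2)
          fix y assume "y \<in> p - p2"
          then obtain x K where y: "y = (x, K)" "(x, K) \<in> p" by (cases y) auto
          then show "0 \<le> (case y of (x, K) \<Rightarrow> e / 2 * (Sup K - Inf K))"
            using intv[of x K] e by auto
        qed (use pp tD(1) in auto)
        also have "\<dots> = e / 2 * (\<Sum>(x, K)\<in>p. Sup K - Inf K)"
          by (simp add: sum_distrib_left case_prod_beta)
        finally show ?thesis using ba by simp
      qed
      have "norm ((\<Sum>(x, k)\<in>p. measure lborel k *\<^sub>R g x) - (f b - f a))
        = norm (\<Sum>(x, K)\<in>p. measure lborel K *\<^sub>R g x - (f (Sup K) - f (Inf K)))"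
        unfolding ba by (simp add: sum_subtractf case_prod_beta)
      also have "\<dots> \<le> (\<Sum>(x, K)\<in>p. cmod (measure lborel K *\<^sub>R g x - (f (Sup K) - f (Inf K))))"
        by (rule order_trans[OF norm_sum]) (simp add: case_prod_beta)
      also have "\<dots> = (\<Sum>(x, K)\<in>p1. cmod (measure lborel K *\<^sub>R g x - (f (Sup K) - f (Inf K))))
          + (\<Sum>(x, K)\<in>p2. cmod (measure lborel K *\<^sub>R g x - (f (Sup K) - f (Inf K))))"
        using pp by (simp add: sum.union_disjoint)
      also have "(\<Sum>(x, K)\<in>p1. cmod (measure lborel K *\<^sub>R g x - (f (Sup K) - f (Inf K))))
          = (\<Sum>(x, K)\<in>p1. cmod (f (Sup K) - f (Inf K)))"
        by (intro sum.cong refl) (auto simp: p1_def g_def norm_minus_commute)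
      finally show "norm ((\<Sum>(x, k)\<in>p. measure lborel k *\<^sub>R g x) - (f b - f a)) \<le> e * measure lborel {a..b}"
        using s1 s2 ab by simp
    qed
  qed
  then show ?thesis
    by (rule has_integral_spike[OF E, rotated]) (auto simp: g_def)
qed

section \<open>Piecewise smooth functions in the Sobolev space\<close>

lemma has_vector_derivative_within_Un:
  assumes "(f has_vector_derivative D) (at x within S)" "(f has_vector_derivative D) (at x within T)"
  shows "(f has_vector_derivative D) (at x within S \<union> T)"
  using assms unfolding has_vector_derivative_def has_derivative_iff_norm Lim_within_Un by simp

text \<open>The filter is trivial, so D is arbitrary. Mesh intervals that miss the point can thus be
  united with the others without ado.\<close>

lemma has_vector_derivative_within_closed_trivial:
  assumes "closed S" "x \<notin> S"
  shows "(f has_vector_derivative D) (at x within S)"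
proof -
  have "at x within S = bot"
    using assms by (metis closure_closed not_in_closure_trivial_limitI trivial_limit_def)
  then show ?thesis
    unfolding has_vector_derivative_def has_derivative_iff_norm
    by (simp add: bounded_linear_scaleR_left)
qed

definition node :: "nat \<Rightarrow> real \<Rightarrow> real \<Rightarrow> nat \<Rightarrow> real" where
  "node N a b i = (b - a) / real N * real i + a"

text \<open>At an interior node the piece to the left is chosen.\<close>

definition glue :: "nat \<Rightarrow> real \<Rightarrow> real \<Rightarrow> (nat \<Rightarrow> nat \<Rightarrow> real \<Rightarrow> complex) \<Rightarrow> nat \<Rightarrow> real \<Rightarrow> complex" where
  "glue N a b F k x = F (LEAST i. x \<le> node N a b (Suc i)) k x"

text \<open>\<open>F i k\<close> is the \<open>k\<close>-th derivative of the \<open>i\<close>-th piece; the pieces join up to order \<open>2 * m - 2\<close>.\<close>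

locale smooth_pieces =
  fixes m N :: nat and a b :: real and F :: "nat \<Rightarrow> nat \<Rightarrow> real \<Rightarrow> complex"
  assumes m: "m \<ge> 1" and N: "N \<ge> 1" and ab: "a < b"
    and deriv: "\<And>i k x. (F i k has_vector_derivative F i (Suc k) x) (at x)"
    and match: "\<And>i k. Suc i < N \<Longrightarrow> k \<le> 2 * m - 2 \<Longrightarrow>
      F i k (node N a b (Suc i)) = F (Suc i) k (node N a b (Suc i))"
begin

abbreviation xn :: "nat \<Rightarrow> real" where "xn \<equiv> node N a b"
abbreviation g :: "nat \<Rightarrow> real \<Rightarrow> complex" where "g \<equiv> glue N a b F"

lemma node_0: "xn 0 = a" and node_N: "xn N = b"
  using N by (auto simp: node_def)

lemma node_less_iff: "xn i < xn j \<longleftrightarrow> i < j"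
  using N ab by (auto simp: node_def mult_less_cancel_left_pos divide_less_cancel)

lemma node_le_iff: "xn i \<le> xn j \<longleftrightarrow> i \<le> j"
  using node_less_iff by (metis linorder_not_le)

lemma node_eq_iff: "xn i = xn j \<longleftrightarrow> i = j"
  using node_less_iff by (metis linorder_neq_iff)

lemma node_bounds: "i \<le> N \<Longrightarrow> a \<le> xn i \<and> xn i \<le> b"
  using node_le_iff[of 0 i] node_le_iff[of i N] by (simp add: node_0 node_N)

lemma glue_piece_exists:
  assumes x: "x \<in> {a..b}"
  shows "\<exists>i<N. x \<in> {xn i..xn (Suc i)} \<and> (\<forall>k. g k x = F i k x)"
proof -
  define i where "i = (LEAST i. x \<le> xn (Suc i))"
  have "x \<le> xn (Suc (N - 1))" using x N node_N by simp
  then have i: "x \<le> xn (Suc i)" "i \<le> N - 1"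
    unfolding i_def by (rule LeastI, rule Least_le)
  have "xn i \<le> x"
  proof (cases i)
    case 0
    then show ?thesis using x node_0 by simp
  next
    case (Suc j)
    then have "\<not> x \<le> xn (Suc j)"
      using not_less_Least[of j "\<lambda>i. x \<le> xn (Suc i)"] by (simp add: i_def)
    then show ?thesis using Suc by simp
  qed
  then show ?thesis
    using i N by (intro exI[of _ i]) (auto simp: glue_def i_def)
qed

lemma pieces_cover: "{a..b} = (\<Union>i<N. {xn i..xn (Suc i)})"
proof
  show "(\<Union>i<N. {xn i..xn (Suc i)}) \<subseteq> {a..b}"
  proof clarify
    fix i x assume "i < N" "x \<in> {xn i..xn (Suc i)}"
    then show "x \<in> {a..b}" using node_bounds[of i] node_bounds[of "Suc i"] by auto
  qed
qed (use glue_piece_exists in blast)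

lemma glue_left_open:
  assumes "xn i < x" "x \<le> xn (Suc i)"
  shows "g k x = F i k x"
proof -
  have "(LEAST i. x \<le> xn (Suc i)) = i"
  proof (rule Least_equality)
    fix j assume "x \<le> xn (Suc j)"
    then have "xn i < xn (Suc j)" using assms by linarith
    then show "i \<le> j" by (simp add: node_less_iff)
  qed (rule assms)
  then show ?thesis by (simp add: glue_def)
qed

lemma glue_a: "g k a = F 0 k a"
proof -
  have "(LEAST i. a \<le> xn (Suc i)) = 0"
    using node_le_iff[of 0 "Suc 0"] by (intro Least_equality) (auto simp: node_0)
  then show ?thesis by (simp add: glue_def)
qed

lemma glue_b: "g k b = F (N - 1) k b"
  using glue_left_open[of "N - 1" b k] N node_less_iff[of "N - 1" N] by (simp add: node_N)

lemma glue_eq: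
  assumes i: "i < N" and x: "x \<in> {xn i..xn (Suc i)}" and k: "k \<le> 2 * m - 2"
  shows "g k x = F i k x"
proof (cases "x = xn i")
  case False
  then show ?thesis using x by (intro glue_left_open) auto
next
  case x: True
  show ?thesis
  proof (cases i)
    case 0
    then show ?thesis using x glue_a node_0 by simp
  next
    case (Suc j)
    then have "g k x = F j k x"
      using x node_less_iff[of j i] by (intro glue_left_open) auto
    then show ?thesis using match[of j k] Suc i k x by simp
  qed
qed

lemma continuous_piece: "continuous_on S (F i k)"
  using deriv by (meson continuous_at_imp_continuous_on has_vector_derivative_continuous)

lemma glue_bounded: "\<exists>B\<ge>0. \<forall>x\<in>{a..b}. cmod (g k x) \<le> B"
proof -
  have "\<exists>B\<ge>0. \<forall>x\<in>{a..b}. cmod (F i k x) \<le> B" for i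
  proof -
    have "bounded (F i k ` {a..b})"
      by (intro compact_imp_bounded compact_continuous_image continuous_piece) simp
    then obtain B where "B > 0" "\<forall>x\<in>{a..b}. cmod (F i k x) \<le> B"
      unfolding bounded_pos ball_simps by (elim exE conjE)
    then show ?thesis by (intro exI[of _ B]) auto
  qed
  then obtain B where B: "\<And>i. B i \<ge> 0" "\<And>i x. x \<in> {a..b} \<Longrightarrow> cmod (F i k x) \<le> B i" by metis
  show ?thesis
  proof (intro exI[of _ "(\<Sum>i<N. B i)"] conjI ballI)
    show "0 \<le> (\<Sum>i<N. B i)" using B by (intro sum_nonneg) auto
    fix x assume x: "x \<in> {a..b}"
    then obtain i where "i < N" "g k x = F i k x" using glue_piece_exists by blast
    then have "cmod (g k x) \<le> B i" using B x by simp
    also have "\<dots> \<le> (\<Sum>i<N. B i)" using B \<open>i < N\<close> by (intro member_le_sum) auto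
    finally show "cmod (g k x) \<le> (\<Sum>i<N. B i)" .
  qed
qed

text \<open>Nothing is assumed at the nodes, where a derivative of order m may be an unspecified
  value; they enter through a finite sum of point indicators.\<close>

lemma borel_measurable_piecewise:
  fixes f :: "real \<Rightarrow> complex"
  assumes f: "\<And>i x. i < N \<Longrightarrow> xn i < x \<Longrightarrow> x < xn (Suc i) \<Longrightarrow> f x = G i x"
    and G: "\<And>i. i < N \<Longrightarrow> continuous_on UNIV (G i)"
  shows "f \<in> borel_measurable (lebesgue_on {a..b})"
proof -
  define h where "h x = (\<Sum>i<N. indicator {xn i<..<xn (Suc i)} x * G i x)
    + (\<Sum>i\<le>N. indicator {xn i} x * f (xn i))" for x
  have "h \<in> borel_measurable borel"
    unfolding h_def using G
    by (intro borel_measurable_add borel_measurable_sum borel_measurable_times borel_measurable_indicator)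
      (auto intro: borel_measurable_continuous_onI)
  then have "h \<in> borel_measurable (lebesgue_on {a..b})"
    by (intro measurable_restrict_space1 measurable_completion) simp
  moreover have "h x = f x" if x: "x \<in> {a..b}" for x
  proof (cases "\<exists>j\<le>N. x = xn j")
    case True
    then obtain j where j: "j \<le> N" "x = xn j" by blast
    have "(\<Sum>i<N. indicator {xn i<..<xn (Suc i)} x * G i x) = 0"
      unfolding j by (intro sum.neutral) (auto simp: indicator_def node_less_iff)
    moreover have "(\<Sum>i\<le>N. indicator {xn i} x * f (xn i)) = (\<Sum>i\<in>{j}. indicator {xn i} x * f (xn i))"
      using j node_eq_iff by (intro sum.mono_neutral_right) (auto simp: indicator_def)
    ultimately show ?thesis by (simp add: h_def j)
  next
    case False
    obtain i where i: "i < N" "x \<in> {xn i..xn (Suc i)}" using x pieces_cover by auto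
    then have i': "xn i < x" "x < xn (Suc i)" using False by (force simp: less_le)+
    have "(\<Sum>i\<le>N. indicator {xn i} x * f (xn i)) = 0"
      using False by (intro sum.neutral) (auto simp: indicator_def)
    moreover have "(\<Sum>i<N. indicator {xn i<..<xn (Suc i)} x * G i x)
      = (\<Sum>j\<in>{i}. indicator {xn j<..<xn (Suc j)} x * G j x)"
    proof (intro sum.mono_neutral_right)
      show "\<forall>j\<in>{..<N} - {i}. indicator {xn j<..<xn (Suc j)} x * G j x = 0"
      proof
        fix j assume j: "j \<in> {..<N} - {i}"
        have "\<not> (xn j < x \<and> x < xn (Suc j))"
        proof
          assume "xn j < x \<and> x < xn (Suc j)"
          then have "xn j < xn (Suc i)" "xn i < xn (Suc j)" using i' by linarith+
          then show False using j by (simp add: node_less_iff)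
        qed
        then show "indicator {xn j<..<xn (Suc j)} x * G j x = 0" by (simp add: indicator_def)
      qed
    qed (use i in auto)
    ultimately show ?thesis using f[OF i(1) i'] i' by (simp add: h_def)
  qed
  ultimately show ?thesis
    by (subst measurable_cong[of _ f h]) (auto simp: space_restrict_space)
qed

lemma glue_measurable: "g k \<in> borel_measurable (lebesgue_on {a..b})"
  by (rule borel_measurable_piecewise[of _ "\<lambda>i. F i k"]) (auto intro: glue_left_open continuous_piece)

text \<open>At an interior node two one-sided derivatives meet. Asking for the same D on every mesh
  interval that contains x covers this case, and the intervals are then united one by one.\<close>

lemma glue_has_vector_derivative:
  assumes k: "k \<le> 2 * m - 2"
    and D: "\<And>i. i < N \<Longrightarrow> x \<in> {xn i..xn (Suc i)} \<Longrightarrow> F i (Suc k) x = D"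
  shows "(g k has_vector_derivative D) (at x within {a..b})"
proof -
  have piece: "(g k has_vector_derivative D) (at x within {xn i..xn (Suc i)})" if i: "i < N" for i
  proof (cases "x \<in> {xn i..xn (Suc i)}")
    case True
    then have "(F i k has_vector_derivative D) (at x within {xn i..xn (Suc i)})"
      using deriv[of i k x] D[OF i] by (auto intro: has_vector_derivative_at_within)
    then show ?thesis
      using True by (rule has_vector_derivative_transform[rotated 2]) (use glue_eq[OF i _ k] in auto)
  next
    case False
    then show ?thesis by (intro has_vector_derivative_within_closed_trivial) auto
  qed
  have "n \<le> N \<Longrightarrow> (g k has_vector_derivative D) (at x within (\<Union>i<n. {xn i..xn (Suc i)}))" for n
  proof (induction n)
    case 0
    then show ?case using has_vector_derivative_within_closed_trivial[of "{}" x] by simp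
  next
    case (Suc n)
    have "(\<Union>i<Suc n. {xn i..xn (Suc i)}) = (\<Union>i<n. {xn i..xn (Suc i)}) \<union> {xn n..xn (Suc n)}"
      by (simp only: lessThan_Suc UN_insert Un_commute)
    with Suc piece[of n] show ?case
      by (simp only: has_vector_derivative_within_Un)
  qed
  then show ?thesis unfolding pieces_cover by blast
qed

lemma iter_deriv_glue_has_vector_derivative:
  assumes k: "k \<le> 2 * m - 2" and x: "x \<in> {a..b}"
    and eq: "\<And>y. y \<in> {a..b} \<Longrightarrow> iter_deriv a b k (g 0) y = g k y"
    and D: "\<And>i. i < N \<Longrightarrow> x \<in> {xn i..xn (Suc i)} \<Longrightarrow> F i (Suc k) x = D"
  shows "(iter_deriv a b k (g 0) has_vector_derivative D) (at x within {a..b})"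
    and "iter_deriv a b (Suc k) (g 0) x = D"
proof -
  show *: "(iter_deriv a b k (g 0) has_vector_derivative D) (at x within {a..b})"
    using glue_has_vector_derivative[OF k D] x
    by (rule has_vector_derivative_transform[rotated 2]) (use eq in auto)
  show "iter_deriv a b (Suc k) (g 0) x = D"
    using vector_derivative_within_closed_interval[OF ab x *] by (simp add: iter_deriv_def)
qed

lemma iter_deriv_glue: "k \<le> m - 1 \<Longrightarrow> x \<in> {a..b} \<Longrightarrow> iter_deriv a b k (g 0) x = g k x"
proof (induction k arbitrary: x)
  case 0
  then show ?case by (simp add: iter_deriv_def)
next
  case (Suc k)
  show ?case
  proof (rule iter_deriv_glue_has_vector_derivative(2))
    show "k \<le> 2 * m - 2" using Suc by linarith
    show "F i (Suc k) x = g (Suc k) x" if "i < N" "x \<in> {xn i..xn (Suc i)}" for i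
      using Suc.prems by (subst glue_eq[OF that]) auto
  qed (use Suc in auto)
qed

text \<open>For m = 1 the order m exceeds 2 * m - 2, so the pieces may disagree at a node. The nodes
  are excluded here and later absorbed as a null set.\<close>

lemma iter_deriv_glue_order_m:
  assumes "x \<in> {a..b}" "x \<notin> xn ` {..N}"
  shows "(iter_deriv a b (m - 1) (g 0) has_vector_derivative g m x) (at x within {a..b})"
    and "iter_deriv a b m (g 0) x = g m x"
proof -
  have D: "F i (Suc (m - 1)) x = g m x" if "i < N" "x \<in> {xn i..xn (Suc i)}" for i
  proof -
    have "x \<noteq> xn i" using assms that by auto
    then show ?thesis using that m by (subst glue_left_open) auto
  qed
  have m2: "m - 1 \<le> 2 * m - 2" by simp
  note * = iter_deriv_glue_has_vector_derivative[OF m2 assms(1) iter_deriv_glue[OF order_refl] D]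
  show "(iter_deriv a b (m - 1) (g 0) has_vector_derivative g m x) (at x within {a..b})"
    by (rule *(1))
  show "iter_deriv a b m (g 0) x = g m x"
    using *(2) m by simp
qed

lemma AE_not_node: "AE x in lebesgue. x \<notin> xn ` {..N}"
  by (rule AE_not_in) (simp add: negligible_iff_null_sets[symmetric] negligible_finite)

lemma AE_iter_deriv_glue: "AE x in lebesgue_on {a..b}. iter_deriv a b m (g 0) x = g m x"
  using AE_not_node
  by (subst AE_restrict_space_iff) (auto simp: iter_deriv_glue_order_m(2) elim!: eventually_mono)

lemma iter_deriv_glue_measurable:
  "iter_deriv a b m (g 0) \<in> borel_measurable (lebesgue_on {a..b})"
proof (rule borel_measurable_piecewise[of _ "\<lambda>i. F i m"])
  fix i x assume i: "i < N" and x: "xn i < x" "x < xn (Suc i)"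
  have "x \<notin> xn ` {..N}"
  proof
    assume "x \<in> xn ` {..N}"
    then obtain j where "x = xn j" by blast
    then show False using x by (simp add: node_less_iff)
  qed
  moreover have "x \<in> {a..b}" using i x pieces_cover by fastforce
  ultimately show "iter_deriv a b m (g 0) x = F i m x"
    using x by (subst iter_deriv_glue_order_m) (auto intro: glue_left_open)
qed (rule continuous_piece)

lemma integrable_glue_square: "integrable (lebesgue_on {a..b}) (\<lambda>x. (cmod (g k x))\<^sup>2)"
proof -
  obtain B where B: "B \<ge> 0" "\<forall>x\<in>{a..b}. cmod (g k x) \<le> B" using glue_bounded by blast
  show ?thesis
  proof (rule Bochner_Integration.integrable_bound)
    show "integrable (lebesgue_on {a..b}) (\<lambda>x. B\<^sup>2)"
      by (rule continuous_imp_integrable_real) (rule continuous_on_const)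
    show "(\<lambda>x. (cmod (g k x))\<^sup>2) \<in> borel_measurable (lebesgue_on {a..b})"
      using glue_measurable by measurable
    show "AE x in lebesgue_on {a..b}. norm ((cmod (g k x))\<^sup>2) \<le> norm (B\<^sup>2)"
      using B by (intro AE_I2) (auto simp: space_restrict_space intro!: power_mono)
  qed
qed

text \<open>Absolute continuity comes from a Lipschitz bound: the derivative of order m - 1 is
  continuously differentiable on each closed mesh interval, and the sum of the local constants
  serves all intervals at once.\<close>

lemma glue_in_sobolev_space: "g 0 \<in> sobolev_space m a b"
  unfolding sobolev_space_def
proof (intro CollectI conjI allI impI ballI)
  fix k x assume k: "k < m - 1" and x: "x \<in> {a..b}"
  have "(iter_deriv a b k (g 0) has_vector_derivative g (Suc k) x) (at x within {a..b})"
  proof (rule iter_deriv_glue_has_vector_derivative(1)[OF _ x])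
    show "F i (Suc k) x = g (Suc k) x" if "i < N" "x \<in> {xn i..xn (Suc i)}" for i
      using k by (subst glue_eq[OF that]) auto
  qed (use k iter_deriv_glue in auto)
  then show "iter_deriv a b k (g 0) differentiable (at x within {a..b})"
    by (metis differentiableI_vector)
next
  have "\<exists>L. L-lipschitz_on {xn i..xn (Suc i)} (iter_deriv a b (m - 1) (g 0))" if i: "i < N" for i
  proof -
    have "(F i (m - 1) has_vector_derivative F i m x) (at x within {xn i..xn (Suc i)})" for x
      using deriv[of i "m - 1" x] m by (auto intro: has_vector_derivative_at_within)
    then obtain B where "B-lipschitz_on {xn i..xn (Suc i)} (F i (m - 1))"
      using C1_imp_lipschitz[OF _ continuous_piece] by blast
    moreover have "iter_deriv a b (m - 1) (g 0) x = F i (m - 1) x" if "x \<in> {xn i..xn (Suc i)}" for x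
    proof -
      have "x \<in> {a..b}" using that i pieces_cover by fastforce
      then show ?thesis using that i by (simp add: iter_deriv_glue glue_eq)
    qed
    ultimately have "B-lipschitz_on {xn i..xn (Suc i)} (iter_deriv a b (m - 1) (g 0))"
      by (rule lipschitz_on_transform)
    then show ?thesis ..
  qed
  then obtain L where L: "\<And>i. i < N \<Longrightarrow> (L i)-lipschitz_on {xn i..xn (Suc i)} (iter_deriv a b (m - 1) (g 0))"
    by metis
  have L0: "0 \<le> L i" if "i < N" for i using lipschitz_on_nonneg[OF L[OF that]] .
  have "(\<Sum>i<N. L i)-lipschitz_on {a..b} (iter_deriv a b (m - 1) (g 0))"
  proof (rule lipschitz_on_closed_Union[where I = "{..<N}" and U = "\<lambda>i. {xn i..xn (Suc i)}"])
    show "(\<Sum>i<N. L i)-lipschitz_on {xn i..xn (Suc i)} (iter_deriv a b (m - 1) (g 0))" if "i \<in> {..<N}" for i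
      using L[of i] that L0 by (intro lipschitz_on_mono[OF L[of i]] member_le_sum) auto
  qed (use L0 pieces_cover in \<open>auto intro!: sum_nonneg\<close>)
  then show "abs_continuous_on a b (iter_deriv a b (m - 1) (g 0))"
    by (rule lipschitz_imp_abs_continuous)
next
  show "AE x in lebesgue_on {a..b}. iter_deriv a b (m - 1) (g 0) differentiable at x within {a..b}"
    using AE_not_node by (subst AE_restrict_space_iff)
      (auto simp del: One_nat_def elim!: eventually_mono intro: differentiableI_vector[OF iter_deriv_glue_order_m(1)])
next
  show meas: "iter_deriv a b m (g 0) \<in> borel_measurable (lebesgue_on {a..b})"
    by (rule iter_deriv_glue_measurable)
  show "integrable (lebesgue_on {a..b}) (\<lambda>x. (cmod (iter_deriv a b m (g 0) x))\<^sup>2)"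
  proof (rule integrable_cong_AE_imp[OF integrable_glue_square[of m]])
    show "(\<lambda>x. (cmod (iter_deriv a b m (g 0) x))\<^sup>2) \<in> borel_measurable (lebesgue_on {a..b})"
      using meas by measurable
    show "AE x in lebesgue_on {a..b}. (cmod (g m x))\<^sup>2 = (cmod (iter_deriv a b m (g 0) x))\<^sup>2"
      using AE_iter_deriv_glue by eventually_elim simp
  qed
qed

end

section \<open>Regularity of Sobolev functions and integration by parts\<close>

lemma sobolev_space_has_vector_derivative:
  assumes "\<phi> \<in> sobolev_space m a b" "k < m - 1" "x \<in> {a..b}"
  shows "(iter_deriv a b k \<phi> has_vector_derivative iter_deriv a b (Suc k) \<phi> x) (at x within {a..b})"
  using assms by (auto simp: sobolev_space_def iter_deriv_def vector_derivative_works[symmetric])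

lemma sobolev_space_continuous:
  assumes "\<phi> \<in> sobolev_space m a b" "k \<le> m - 1"
  shows "continuous_on {a..b} (iter_deriv a b k \<phi>)"
proof (cases "k = m - 1")
  case True
  then show ?thesis using assms by (auto simp: sobolev_space_def intro: abs_continuous_imp_continuous)
next
  case False
  then have "k < m - 1" using assms by simp
  then show ?thesis
    unfolding continuous_on_eq_continuous_within
    using sobolev_space_has_vector_derivative[OF assms(1)] has_vector_derivative_continuous by blast
qed

lemma sobolev_space_AE_derivative:
  assumes "\<phi> \<in> sobolev_space m a b" "m \<ge> 1"
  obtains E where "negligible E"
    "\<And>x. x \<in> {a..b} - E \<Longrightarrow>
       (iter_deriv a b (m - 1) \<phi> has_vector_derivative iter_deriv a b m \<phi> x) (at x within {a..b})"
proof -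
  have "AE x in lebesgue_on {a..b}. iter_deriv a b (m - 1) \<phi> differentiable (at x within {a..b})"
    using assms by (simp add: sobolev_space_def)
  then have "AE x in lebesgue. x \<in> {a..b} \<longrightarrow> iter_deriv a b (m - 1) \<phi> differentiable (at x within {a..b})"
    by (subst (asm) AE_restrict_space_iff) auto
  then obtain E where E: "E \<in> null_sets lebesgue"
    "{x. \<not> (x \<in> {a..b} \<longrightarrow> iter_deriv a b (m - 1) \<phi> differentiable (at x within {a..b}))} \<subseteq> E"
    by (auto simp: eventually_ae_filter)
  show ?thesis
  proof (rule that)
    show "negligible E" using E by (simp add: negligible_iff_null_sets)
    fix x assume "x \<in> {a..b} - E"
    then have "iter_deriv a b (m - 1) \<phi> differentiable (at x within {a..b})" using E by blast
    moreover have "iter_deriv a b m \<phi> x = vector_derivative (iter_deriv a b (m - 1) \<phi>) (at x within {a..b})"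
      using assms(2) by (cases m) (auto simp: iter_deriv_def)
    ultimately show "(iter_deriv a b (m - 1) \<phi> has_vector_derivative iter_deriv a b m \<phi> x) (at x within {a..b})"
      by (simp add: vector_derivative_works)
  qed
qed

lemma borel_measurable_cnj:
  assumes "f \<in> borel_measurable M"
  shows "(\<lambda>x. cnj (f x)) \<in> borel_measurable M"
  by (intro measurable_compose[OF assms] borel_measurable_continuous_onI continuous_intros)

lemma integrable_mult_cnj_square_integrable:
  fixes f g :: "'a \<Rightarrow> complex"
  assumes "f \<in> borel_measurable M" "integrable M (\<lambda>x. (cmod (f x))\<^sup>2)"
    and "g \<in> borel_measurable M" "integrable M (\<lambda>x. (cmod (g x))\<^sup>2)"
  shows "integrable M (\<lambda>x. f x * cnj (g x))"
proof (rule Bochner_Integration.integrable_bound)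
  show "integrable M (\<lambda>x. (cmod (f x))\<^sup>2 + (cmod (g x))\<^sup>2)" using assms by simp
  show "(\<lambda>x. f x * cnj (g x)) \<in> borel_measurable M"
    using assms(1,3) by (intro borel_measurable_times borel_measurable_cnj)
  show "AE x in M. norm (f x * cnj (g x)) \<le> norm ((cmod (f x))\<^sup>2 + (cmod (g x))\<^sup>2)"
  proof (intro AE_I2)
    fix x
    have "0 \<le> (cmod (f x) - cmod (g x))\<^sup>2" by simp
    then have "2 * (cmod (f x) * cmod (g x)) \<le> (cmod (f x))\<^sup>2 + (cmod (g x))\<^sup>2"
      by (simp add: power2_diff)
    moreover have "0 \<le> cmod (f x) * cmod (g x)" by simp
    ultimately have "cmod (f x) * cmod (g x) \<le> (cmod (f x))\<^sup>2 + (cmod (g x))\<^sup>2" by linarith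
    then show "norm (f x * cnj (g x)) \<le> norm ((cmod (f x))\<^sup>2 + (cmod (g x))\<^sup>2)"
      by (simp add: norm_mult)
  qed
qed

context smooth_pieces
begin

lemma sobolev_inner_glue:
  assumes "\<phi> \<in> sobolev_space m a b"
  shows "sobolev_inner m a b \<phi> (g 0) = (LINT x|lebesgue_on {a..b}. iter_deriv a b m \<phi> x * cnj (g m x))"
  unfolding sobolev_inner_def
proof (rule integral_cong_AE)
  have meas: "iter_deriv a b m \<phi> \<in> borel_measurable (lebesgue_on {a..b})"
    using assms by (simp add: sobolev_space_def)
  show "(\<lambda>x. iter_deriv a b m \<phi> x * cnj (iter_deriv a b m (g 0) x)) \<in> borel_measurable (lebesgue_on {a..b})"
    "(\<lambda>x. iter_deriv a b m \<phi> x * cnj (g m x)) \<in> borel_measurable (lebesgue_on {a..b})"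
    by (intro borel_measurable_times meas borel_measurable_cnj iter_deriv_glue_measurable glue_measurable)+
  show "AE x in lebesgue_on {a..b}. iter_deriv a b m \<phi> x * cnj (iter_deriv a b m (g 0) x) = iter_deriv a b m \<phi> x * cnj (g m x)"
    using AE_iter_deriv_glue by eventually_elim simp
qed

text \<open>The alternating sum is a primitive whose derivative telescopes to the integrand. Only
  its summand k = 0 contains \<open>iter_deriv a b (m - 1) \<phi>\<close>, which is differentiable
  merely almost everywhere; that summand uses the theorem for absolutely continuous functions, the
  others the classical one.\<close>

lemma piece_integration_by_parts:
  assumes \<phi>: "\<phi> \<in> sobolev_space m a b" and mn: "m = Suc n" and i: "i < N"
  shows "((\<lambda>x. iter_deriv a b m \<phi> x * cnj (F i m x) + (-1) ^ n * (\<phi> x * cnj (F i (2 * m) x))) has_integral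
    ((\<Sum>k\<le>n. (-1) ^ k * (iter_deriv a b (n - k) \<phi> (xn (Suc i)) * cnj (F i (m + k) (xn (Suc i)))))
     - (\<Sum>k\<le>n. (-1) ^ k * (iter_deriv a b (n - k) \<phi> (xn i) * cnj (F i (m + k) (xn i))))))
    {xn i..xn (Suc i)}"
proof -
  define u where "u = xn i"
  define v where "v = xn (Suc i)"
  have uv: "u \<le> v" "{u..v} \<subseteq> {a..b}"
    using node_le_iff[of i "Suc i"] i pieces_cover by (auto simp: u_def v_def)
  define G where "G k x = cnj (F i k x)" for k x
  define p where "p k = iter_deriv a b k \<phi>" for k
  have G: "(G k has_vector_derivative G (Suc k) x) (at x within S)" for k x S
    unfolding G_def by (rule has_vector_derivative_cnj[OF has_vector_derivative_at_within[OF deriv]])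
  have p: "(p k has_vector_derivative p (Suc k) x) (at x within {u..v})" if "k < n" "x \<in> {u..v}" for k x
    using sobolev_space_has_vector_derivative[OF \<phi>, of k x] that uv mn
    by (auto simp: p_def intro: has_vector_derivative_within_subset)
  obtain E where E: "negligible E"
    "\<And>x. x \<in> {a..b} - E \<Longrightarrow> (p n has_vector_derivative p m x) (at x within {a..b})"
    using sobolev_space_AE_derivative[OF \<phi>] mn unfolding p_def by (metis diff_Suc_1 le_add1 plus_1_eq_Suc)
  have acp: "abs_continuous_on u v (p n)"
  proof (rule abs_continuous_on_subinterval)
    show "abs_continuous_on a b (p n)" using \<phi> mn by (simp add: sobolev_space_def p_def)
  qed (use uv in auto)
  have acG: "abs_continuous_on u v (G k)" for k
    using C1_imp_lipschitz[of u v "G k" "G (Suc k)"] G lipschitz_imp_abs_continuous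
    unfolding G_def by (blast intro: continuous_on_cnj continuous_piece)
  have 1: "((\<lambda>x. p n x * G (Suc m) x + p m x * G m x) has_integral (p n v * G m v - p n u * G m u)) {u..v}"
  proof (rule fundamental_theorem_of_calculus_abs_continuous[OF uv(1) _ E(1)])
    show "abs_continuous_on u v (\<lambda>x. p n x * G m x)"
      by (intro abs_continuous_on_mult acp acG)
    show "((\<lambda>x. p n x * G m x) has_vector_derivative p n x * G (Suc m) x + p m x * G m x) (at x within {u..v})"
      if "x \<in> {u..v} - E" for x
      by (intro has_vector_derivative_mult G has_vector_derivative_within_subset[OF E(2)]) (use that uv in auto)
  qed
  \<comment> \<open>\<open>R\<close> is the part k \<ge> 1 of the primitive and its derivative
    telescopes in \<open>t\<close>; the remaining \<open>t 0\<close> cancels against the product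
    rule for k = 0.\<close>
  define t where "t k x = (-1) ^ k * (p (n - k) x * G (Suc m + k) x)" for k x
  define R where "R x = (\<Sum>k<n. (-1) ^ Suc k * (p (n - Suc k) x * G (m + Suc k) x))" for x
  have 2: "((\<lambda>x. t n x - t 0 x) has_integral (R v - R u)) {u..v}"
  proof (rule fundamental_theorem_of_calculus[OF uv(1)])
    fix x assume x: "x \<in> {u..v}"
    have "(R has_vector_derivative (\<Sum>k<n. (-1) ^ Suc k *
        (p (n - Suc k) x * G (Suc (m + Suc k)) x + p (Suc (n - Suc k)) x * G (m + Suc k) x))) (at x within {u..v})"
      unfolding R_def
      by (intro has_vector_derivative_sum has_vector_derivative_mult_right has_vector_derivative_mult G p)
        (use x in auto)
    also have "(\<Sum>k<n. (-1) ^ Suc k *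
        (p (n - Suc k) x * G (Suc (m + Suc k)) x + p (Suc (n - Suc k)) x * G (m + Suc k) x))
       = (\<Sum>k<n. t (Suc k) x - t k x)"
      by (intro sum.cong) (auto simp: t_def algebra_simps Suc_diff_Suc)
    also have "\<dots> = t n x - t 0 x" by (rule sum_lessThan_telescope)
    finally show "(R has_vector_derivative t n x - t 0 x) (at x within {u..v})" .
  qed
  have 3: "(\<Sum>k\<le>n. (-1) ^ k * (p (n - k) x * G (m + k) x)) = p n x * G m x + R x" for x
    unfolding lessThan_Suc_atMost[symmetric] by (subst sum.lessThan_Suc_shift) (simp add: R_def)
  have "((\<lambda>x. (p n x * G (Suc m) x + p m x * G m x) + (t n x - t 0 x)) has_integral
    ((p n v * G m v - p n u * G m u) + (R v - R u))) {u..v}"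
    by (rule has_integral_add[OF 1 2])
  moreover have "(p n x * G (Suc m) x + p m x * G m x) + (t n x - t 0 x)
      = p m x * G m x + (-1) ^ n * (\<phi> x * G (2 * m) x)" for x
    using mn by (simp add: t_def p_def iter_deriv_def mult_2)
  moreover have "(p n v * G m v - p n u * G m u) + (R v - R u)
     = (\<Sum>k\<le>n. (-1) ^ k * (p (n - k) v * G (m + k) v)) - (\<Sum>k\<le>n. (-1) ^ k * (p (n - k) u * G (m + k) u))"
    unfolding 3 by simp
  ultimately have "((\<lambda>x. p m x * G m x + (-1) ^ n * (\<phi> x * G (2 * m) x)) has_integral
      ((\<Sum>k\<le>n. (-1) ^ k * (p (n - k) v * G (m + k) v)) - (\<Sum>k\<le>n. (-1) ^ k * (p (n - k) u * G (m + k) u)))) {u..v}"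
    by (simp only:)
  then show ?thesis by (simp only: p_def G_def u_def v_def)
qed

text \<open>The boundary terms that survive: those of order 2 * m - 1, where neighbouring pieces
  need not agree, so each interval keeps its own piece. Summation by parts regroups them into jumps
  at the nodes.\<close>

definition jump_sum :: "(real \<Rightarrow> complex) \<Rightarrow> complex" where
  "jump_sum \<phi> = (\<Sum>i<N. \<phi> (xn (Suc i)) * cnj (F i (2 * m - 1) (xn (Suc i)))
        - \<phi> (xn i) * cnj (F i (2 * m - 1) (xn i)))"

text \<open>Boundary terms with orders up to 2 * m - 2 of the glued function agree from both sides
  of a node, so they telescope to the ends, where the natural conditions annul them.\<close>

lemma sobolev_inner_glue_eq_jumps:
  assumes \<phi>: "\<phi> \<in> sobolev_space m a b"
    and nat_a: "\<And>k. m \<le> k \<Longrightarrow> k \<le> 2 * m - 2 \<Longrightarrow> F 0 k a = 0"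
    and nat_b: "\<And>k. m \<le> k \<Longrightarrow> k \<le> 2 * m - 2 \<Longrightarrow> F (N - 1) k b = 0"
  shows "sobolev_inner m a b \<phi> (g 0) =
    (-1) ^ m * (LINT x|lebesgue_on {a..b}. \<phi> x * cnj (g (2 * m) x))
    + (-1) ^ (m - 1) * jump_sum \<phi>"
proof -
  obtain n where mn: "m = Suc n" using m by (cases m) auto
  define J where "J x = iter_deriv a b m \<phi> x * cnj (g m x) + (-1) ^ n * (\<phi> x * cnj (g (2 * m) x))" for x
  define T where "T i x = (\<Sum>k\<le>n. (-1) ^ k * (iter_deriv a b (n - k) \<phi> x * cnj (F i (m + k) x)))" for i x
  define H where "H x = (\<Sum>k<n. (-1) ^ k * (iter_deriv a b (n - k) \<phi> x * cnj (g (m + k) x)))" for x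
  have J: "(J has_integral (T i (xn (Suc i)) - T i (xn i))) {xn i..xn (Suc i)}" if "i < N" for i
  proof (rule has_integral_spike_finite)
    \<comment> \<open>At the left node of its interval \<open>glue\<close> may take the previous
      piece; one point does not affect the integral.\<close>
    show "finite {xn i}" by simp
    show "((\<lambda>x. iter_deriv a b m \<phi> x * cnj (F i m x) + (-1) ^ n * (\<phi> x * cnj (F i (2 * m) x)))
      has_integral (T i (xn (Suc i)) - T i (xn i))) {xn i..xn (Suc i)}"
      unfolding T_def by (rule piece_integration_by_parts[OF \<phi> mn that])
    fix x assume "x \<in> {xn i..xn (Suc i)} - {xn i}"
    then have "xn i < x" "x \<le> xn (Suc i)" by auto
    then show "J x = iter_deriv a b m \<phi> x * cnj (F i m x) + (-1) ^ n * (\<phi> x * cnj (F i (2 * m) x))"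
      by (simp add: J_def glue_left_open)
  qed
  have sumJ: "j \<le> N \<Longrightarrow> (J has_integral (\<Sum>i<j. T i (xn (Suc i)) - T i (xn i))) {xn 0..xn j}" for j
  proof (induction j)
    case 0
    then show ?case using has_integral_refl(1)[of J "xn 0"] by simp
  next
    case (Suc j)
    have "(J has_integral ((\<Sum>i<j. T i (xn (Suc i)) - T i (xn i)) + (T j (xn (Suc j)) - T j (xn j)))) {xn 0..xn (Suc j)}"
      by (rule has_integral_combine[of _ "xn j"]) (use Suc J[of j] in \<open>auto simp: node_le_iff\<close>)
    then show ?case by simp
  qed
  have TH: "T i x = H x + (-1) ^ n * (\<phi> x * cnj (F i (2 * m - 1) x))"
    if "i < N" "x \<in> {xn i..xn (Suc i)}" for i x
  proof -
    have "T i x = (\<Sum>k<n. (-1) ^ k * (iter_deriv a b (n - k) \<phi> x * cnj (F i (m + k) x)))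
       + (-1) ^ n * (iter_deriv a b 0 \<phi> x * cnj (F i (m + n) x))"
      unfolding T_def lessThan_Suc_atMost[symmetric] by simp
    also have "(\<Sum>k<n. (-1) ^ k * (iter_deriv a b (n - k) \<phi> x * cnj (F i (m + k) x))) = H x"
      unfolding H_def
    proof (intro sum.cong refl)
      fix k assume "k \<in> {..<n}"
      then have "g (m + k) x = F i (m + k) x"
        using mn by (intro glue_eq that) auto
      then show "(-1) ^ k * (iter_deriv a b (n - k) \<phi> x * cnj (F i (m + k) x))
        = (-1) ^ k * (iter_deriv a b (n - k) \<phi> x * cnj (g (m + k) x))" by simp
    qed
    also have "m + n = 2 * m - 1" using mn by simp
    finally show ?thesis by (simp add: iter_deriv_def)
  qed
  have "H a = 0" "H b = 0"
    unfolding H_def using nat_a nat_b mn by (auto intro!: sum.neutral simp: glue_a glue_b)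
  have "(\<Sum>i<N. T i (xn (Suc i)) - T i (xn i)) =
     (\<Sum>i<N. (H (xn (Suc i)) - H (xn i)) + (-1) ^ n * (\<phi> (xn (Suc i)) * cnj (F i (2 * m - 1) (xn (Suc i)))
        - \<phi> (xn i) * cnj (F i (2 * m - 1) (xn i))))"
    by (intro sum.cong refl) (simp add: TH node_le_iff algebra_simps)
  also have "\<dots> = (\<Sum>i<N. H (xn (Suc i)) - H (xn i)) + (-1) ^ n * jump_sum \<phi>"
    by (simp add: jump_sum_def sum.distrib sum_distrib_left)
  also have "(\<Sum>i<N. H (xn (Suc i)) - H (xn i)) = 0"
    using sum_lessThan_telescope[of "\<lambda>i. H (xn i)" N] \<open>H a = 0\<close> \<open>H b = 0\<close> by (simp add: node_0 node_N)
  finally have jumps: "(J has_integral (-1) ^ n * jump_sum \<phi>) {a..b}"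
    using sumJ[of N] by (simp add: node_0 node_N)
  have int1: "integrable (lebesgue_on {a..b}) (\<lambda>x. iter_deriv a b m \<phi> x * cnj (g m x))"
    by (rule integrable_mult_cnj_square_integrable)
      (use \<phi> in \<open>auto simp: sobolev_space_def intro: glue_measurable integrable_glue_square\<close>)
  have "continuous_on {a..b} \<phi>" using sobolev_space_continuous[OF \<phi>, of 0] by (simp add: iter_deriv_def)
  then have int2: "integrable (lebesgue_on {a..b}) (\<lambda>x. \<phi> x * cnj (g (2 * m) x))"
    by (intro integrable_mult_cnj_square_integrable glue_measurable integrable_glue_square
        continuous_imp_integrable_real continuous_intros
        borel_measurable_integrable[OF continuous_imp_integrable_real])
  have "(LINT x|lebesgue_on {a..b}. iter_deriv a b m \<phi> x * cnj (g m x))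
      + (-1) ^ n * (LINT x|lebesgue_on {a..b}. \<phi> x * cnj (g (2 * m) x))
    = (LINT x|lebesgue_on {a..b}. J x)"
    unfolding J_def using int1 int2 by simp
  also have "\<dots> = integral {a..b} J"
    using int1 int2 by (intro lebesgue_integral_eq_integral) (auto simp: J_def[abs_def])
  also have "\<dots> = (-1) ^ n * jump_sum \<phi>"
    using jumps by (rule integral_unique)
  finally show ?thesis
    unfolding sobolev_inner_glue[OF \<phi>] using mn by (simp add: algebra_simps)
qed

end

section \<open>Optimality through a representer\<close>

text \<open>The usual quadratic in t, formed with the moduli of f and g; the complex integral is
  bounded by that of its modulus.\<close>

lemma Cauchy_Schwarz_square_integrable:
  fixes f g :: "'a \<Rightarrow> complex"
  assumes f: "f \<in> borel_measurable M" "integrable M (\<lambda>x. (cmod (f x))\<^sup>2)"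
    and g: "g \<in> borel_measurable M" "integrable M (\<lambda>x. (cmod (g x))\<^sup>2)"
  shows "(cmod (LINT x|M. f x * cnj (g x)))\<^sup>2 \<le> (LINT x|M. (cmod (f x))\<^sup>2) * (LINT x|M. (cmod (g x))\<^sup>2)"
proof -
  define A where "A = (LINT x|M. (cmod (f x))\<^sup>2)"
  define B where "B = (LINT x|M. (cmod (g x))\<^sup>2)"
  define X where "X = (LINT x|M. cmod (f x) * cmod (g x))"
  have fg: "integrable M (\<lambda>x. cmod (f x) * cmod (g x))"
    using integrable_norm[OF integrable_mult_cnj_square_integrable[OF f g]] by (simp add: norm_mult)
  have quad: "0 \<le> t\<^sup>2 * A - 2 * t * X + B" for t
  proof -
    have "0 \<le> (LINT x|M. (t * cmod (f x) - cmod (g x))\<^sup>2)" by simp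
    also have "\<dots> = (LINT x|M. t\<^sup>2 * (cmod (f x))\<^sup>2 - (2 * t) * (cmod (f x) * cmod (g x)) + (cmod (g x))\<^sup>2)"
      by (intro Bochner_Integration.integral_cong refl) (simp add: power2_eq_square algebra_simps)
    also have "\<dots> = t\<^sup>2 * A - 2 * t * X + B"
      using f g fg by (simp add: A_def B_def X_def)
    finally show ?thesis .
  qed
  have X0: "0 \<le> X" unfolding X_def by (intro Bochner_Integration.integral_nonneg) simp
  have "X\<^sup>2 \<le> A * B"
  proof (cases "A = 0")
    case True
    have "X = 0"
    proof (rule ccontr)
      assume "X \<noteq> 0"
      \<comment> \<open>For A = 0 the quadratic is linear, and this t would give it the value
        -1.\<close>
      then have "2 * ((B + 1) / (2 * X)) * X = B + 1" by simp
      then show False using quad[of "(B + 1) / (2 * X)"] True by simp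
    qed
    with True show ?thesis by simp
  next
    case False
    moreover have "0 \<le> A" unfolding A_def by (intro Bochner_Integration.integral_nonneg) simp
    ultimately have "A > 0" by simp
    have "(X / A)\<^sup>2 * A - 2 * (X / A) * X + B = B - X\<^sup>2 / A"
      using False by (simp add: power2_eq_square)
    then have "X\<^sup>2 / A \<le> B" using quad[of "X / A"] by simp
    then show ?thesis using \<open>A > 0\<close> by (simp add: divide_simps mult.commute)
  qed
  moreover have "cmod (LINT x|M. f x * cnj (g x)) \<le> X"
    using integral_norm_bound[of M "\<lambda>x. f x * cnj (g x)"] by (simp add: X_def norm_mult)
  then have "(cmod (LINT x|M. f x * cnj (g x)))\<^sup>2 \<le> X\<^sup>2" by (intro power_mono) auto
  ultimately show ?thesis by (simp add: A_def B_def)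
qed

section \<open>Linear combinations of glued families\<close>

text \<open>The optimality argument perturbs and rescales test functions. Done on families, this
  carries all derivatives along, so norms of combinations are computed without linearity of
  \<open>iter_deriv\<close>.\<close>

lemma smooth_pieces_lincomb:
  assumes "smooth_pieces m N a b F" "smooth_pieces m N a b G"
  shows "smooth_pieces m N a b (\<lambda>i k x. c * F i k x + d * G i k x)"
proof -
  interpret F: smooth_pieces m N a b F by fact
  interpret G: smooth_pieces m N a b G by fact
  show ?thesis
  proof
    show "((\<lambda>x. c * F i k x + d * G i k x) has_vector_derivative c * F i (Suc k) x + d * G i (Suc k) x) (at x)" for i k x
      by (intro has_vector_derivative_add has_vector_derivative_mult_right F.deriv G.deriv)
    show "c * F i k (node N a b (Suc i)) + d * G i k (node N a b (Suc i)) =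
        c * F (Suc i) k (node N a b (Suc i)) + d * G (Suc i) k (node N a b (Suc i))"
      if "Suc i < N" "k \<le> 2 * m - 2" for i k
      using F.match[OF that] G.match[OF that] by simp
  qed (use F.m F.N F.ab in auto)
qed

lemma glue_lincomb:
  "glue N a b (\<lambda>i k x. c * F i k x + d * G i k x) k x = c * glue N a b F k x + d * glue N a b G k x"
  by (simp add: glue_def)

lemma smooth_pieces_poly:
  assumes "m \<ge> 1" "N \<ge> 1" "a < b"
  shows "smooth_pieces m N a b (\<lambda>i k x. poly ((pderiv ^^ k) p) (of_real x))"
proof
  show "((\<lambda>x. poly ((pderiv ^^ k) p) (of_real x)) has_vector_derivative poly ((pderiv ^^ Suc k) p) (of_real x)) (at x)"
    for k and x :: real
    using has_vector_derivative_real_field[OF poly_DERIV, of "(pderiv ^^ k) p" x UNIV] by simp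
qed (use assms in auto)

lemma glue_poly: "glue N a b (\<lambda>i k x. poly ((pderiv ^^ k) p) (of_real x)) k x = poly ((pderiv ^^ k) p) (of_real x)"
  by (simp add: glue_def)

lemma pderiv_funpow_eq_0: "degree p < k \<Longrightarrow> (pderiv ^^ k) p = (0 :: complex poly)"
proof (induction k arbitrary: p)
  case (Suc k)
  show ?case
  proof (cases k)
    case 0
    then show ?thesis using Suc.prems by (simp add: pderiv_eq_0_iff)
  next
    case (Suc k')
    then have "degree (pderiv p) < k" using Suc.prems by (simp add: degree_pderiv)
    then show ?thesis using Suc.IH by (simp add: funpow_swap1)
  qed
qed simp

lemma error_functional_lincomb:
  assumes "continuous_on {a..b} \<phi>" "continuous_on {a..b} \<psi>"
  shows "error_functional N a b \<omega> C (\<lambda>x. c * \<phi> x + d * \<psi> x) =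
    c * error_functional N a b \<omega> C \<phi> + d * error_functional N a b \<omega> C \<psi>"
proof -
  have int: "integrable (lebesgue_on {a..b}) (\<lambda>x. wave \<omega> x * f x)" if "continuous_on {a..b} f" for f
    unfolding wave_def by (intro continuous_imp_integrable_real continuous_intros that)
  have "(LINT x|lebesgue_on {a..b}. wave \<omega> x * (c * \<phi> x + d * \<psi> x))
    = (LINT x|lebesgue_on {a..b}. c * (wave \<omega> x * \<phi> x) + d * (wave \<omega> x * \<psi> x))"
    by (simp add: algebra_simps)
  also have "\<dots> = c * (LINT x|lebesgue_on {a..b}. wave \<omega> x * \<phi> x) + d * (LINT x|lebesgue_on {a..b}. wave \<omega> x * \<psi> x)"
    using int[OF assms(1)] int[OF assms(2)] by simp
  finally show ?thesis
    unfolding error_functional_def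
    by (simp add: algebra_simps sum.distrib sum_distrib_left)
qed

lemma sobolev_inner_self:
  "sobolev_inner m a b \<phi> \<phi> = of_real (LINT x|lebesgue_on {a..b}. (cmod (iter_deriv a b m \<phi> x))\<^sup>2)"
  unfolding sobolev_inner_def integral_complex_of_real[symmetric]
  by (intro Bochner_Integration.integral_cong refl) (simp add: complex_mult_cnj cmod_power2)

lemma sobolev_norm_nonneg: "0 \<le> sobolev_norm m a b \<phi>"
  unfolding sobolev_norm_def sobolev_inner_self by simp

lemma sobolev_norm_power2:
  "(sobolev_norm m a b \<phi>)\<^sup>2 = (LINT x|lebesgue_on {a..b}. (cmod (iter_deriv a b m \<phi> x))\<^sup>2)"
  unfolding sobolev_norm_def sobolev_inner_self by simp

lemma sobolev_Cauchy_Schwarz: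
  assumes "\<phi> \<in> sobolev_space m a b" "\<psi> \<in> sobolev_space m a b"
  shows "cmod (sobolev_inner m a b \<phi> \<psi>) \<le> sobolev_norm m a b \<phi> * sobolev_norm m a b \<psi>"
proof (rule power2_le_imp_le)
  show "(cmod (sobolev_inner m a b \<phi> \<psi>))\<^sup>2 \<le> (sobolev_norm m a b \<phi> * sobolev_norm m a b \<psi>)\<^sup>2"
    unfolding power_mult_distrib sobolev_norm_power2 unfolding sobolev_inner_def
    by (rule Cauchy_Schwarz_square_integrable) (use assms in \<open>auto simp: sobolev_space_def\<close>)
qed (simp add: sobolev_norm_nonneg)

lemma sobolev_inner_glue_glue:
  assumes "smooth_pieces m N a b F" "smooth_pieces m N a b G"
  shows "sobolev_inner m a b (glue N a b F 0) (glue N a b G 0) =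
    (LINT x|lebesgue_on {a..b}. glue N a b F m x * cnj (glue N a b G m x))"
proof -
  interpret F: smooth_pieces m N a b F by fact
  interpret G: smooth_pieces m N a b G by fact
  show ?thesis
    unfolding G.sobolev_inner_glue[OF F.glue_in_sobolev_space]
  proof (rule integral_cong_AE)
    show "AE x in lebesgue_on {a..b}. iter_deriv a b m (glue N a b F 0) x * cnj (glue N a b G m x)
      = glue N a b F m x * cnj (glue N a b G m x)"
      using F.AE_iter_deriv_glue by eventually_elim simp
  qed (intro borel_measurable_times borel_measurable_cnj F.iter_deriv_glue_measurable F.glue_measurable G.glue_measurable)+
qed

lemma sobolev_norm_glue_power2:
  assumes "smooth_pieces m N a b F"
  shows "(sobolev_norm m a b (glue N a b F 0))\<^sup>2 = (LINT x|lebesgue_on {a..b}. (cmod (glue N a b F m x))\<^sup>2)"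
proof -
  have "complex_of_real ((sobolev_norm m a b (glue N a b F 0))\<^sup>2) = sobolev_inner m a b (glue N a b F 0) (glue N a b F 0)"
    unfolding sobolev_norm_power2 sobolev_inner_self ..
  also have "\<dots> = of_real (LINT x|lebesgue_on {a..b}. (cmod (glue N a b F m x))\<^sup>2)"
    unfolding sobolev_inner_glue_glue[OF assms assms] integral_complex_of_real[symmetric]
    by (intro Bochner_Integration.integral_cong refl) (simp add: complex_mult_cnj cmod_power2)
  finally show ?thesis by (simp only: of_real_eq_iff)
qed

text \<open>The dummy summand makes scaling an instance of
  \<open>smooth_pieces_lincomb\<close>.\<close>

lemma sobolev_norm_glue_scale:
  assumes "smooth_pieces m N a b F"
  shows "sobolev_norm m a b (glue N a b (\<lambda>i k x. c * F i k x + 0 * F i k x) 0) = cmod c * sobolev_norm m a b (glue N a b F 0)"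
proof -
  have "(sobolev_norm m a b (glue N a b (\<lambda>i k x. c * F i k x + 0 * F i k x) 0))\<^sup>2
    = (cmod c * sobolev_norm m a b (glue N a b F 0))\<^sup>2"
    unfolding sobolev_norm_glue_power2[OF smooth_pieces_lincomb[OF assms assms]] glue_lincomb
      power_mult_distrib sobolev_norm_glue_power2[OF assms]
    by (simp add: norm_mult power_mult_distrib)
  then show ?thesis by (simp add: power2_eq_iff_nonneg sobolev_norm_nonneg)
qed

lemma sobolev_norm_glue_add:
  assumes F: "smooth_pieces m N a b F" and G: "smooth_pieces m N a b G"
  shows "(sobolev_norm m a b (glue N a b (\<lambda>i k x. 1 * F i k x + of_real t * G i k x) 0))\<^sup>2 =
    (sobolev_norm m a b (glue N a b F 0))\<^sup>2
    + 2 * t * Re (sobolev_inner m a b (glue N a b G 0) (glue N a b F 0))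
    + t\<^sup>2 * (sobolev_norm m a b (glue N a b G 0))\<^sup>2"
proof -
  interpret F: smooth_pieces m N a b F by fact
  interpret G: smooth_pieces m N a b G by fact
  let ?f = "glue N a b F m" and ?g = "glue N a b G m"
  have fg: "integrable (lebesgue_on {a..b}) (\<lambda>x. ?g x * cnj (?f x))"
    by (intro integrable_mult_cnj_square_integrable F.glue_measurable G.glue_measurable
        F.integrable_glue_square G.integrable_glue_square)
  define w where "w x = ?g x * cnj (?f x)" for x
  have w: "integrable (lebesgue_on {a..b}) w" using fg by (simp add: w_def[abs_def])
  have "(cmod (1 * ?f x + of_real t * ?g x))\<^sup>2 = (cmod (?f x))\<^sup>2 + (2 * t) * Re (w x) + t\<^sup>2 * (cmod (?g x))\<^sup>2" for x
    by (simp add: cmod_power2 w_def) (simp add: power2_eq_square algebra_simps)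
  then have "(LINT x|lebesgue_on {a..b}. (cmod (1 * ?f x + of_real t * ?g x))\<^sup>2)
    = (LINT x|lebesgue_on {a..b}. (cmod (?f x))\<^sup>2 + (2 * t) * Re (w x) + t\<^sup>2 * (cmod (?g x))\<^sup>2)"
    by (simp only:)
  also have "\<dots> = (LINT x|lebesgue_on {a..b}. (cmod (?f x))\<^sup>2)
      + 2 * t * (LINT x|lebesgue_on {a..b}. Re (w x)) + t\<^sup>2 * (LINT x|lebesgue_on {a..b}. (cmod (?g x))\<^sup>2)"
    using integrable_Re[OF w] F.integrable_glue_square[of m] G.integrable_glue_square[of m] by simp
  also have "(LINT x|lebesgue_on {a..b}. Re (w x)) = Re (LINT x|lebesgue_on {a..b}. w x)"
    by (rule integral_Re[OF w])
  finally show ?thesis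
    unfolding sobolev_norm_glue_power2[OF smooth_pieces_lincomb[OF F G]] glue_lincomb
      sobolev_norm_glue_power2[OF F] sobolev_norm_glue_power2[OF G] sobolev_inner_glue_glue[OF G F]
    by (simp only: w_def)
qed

text \<open>The representer \<open>\<psi>\<close> of the functional with coefficients \<open>C0\<close> vanishes at the nodes, so every
  functional takes the value \<open>\<parallel>\<psi>\<parallel>\<^sup>2\<close> at \<open>\<psi>\<close>; a functional of norm at most
  \<open>\<parallel>\<psi>\<parallel>\<close> is then compared with that of \<open>C0\<close> to first order at \<open>\<psi>\<close>.\<close>

lemma sard_optimal_iff_representer:
  assumes F: "smooth_pieces m N a b F" and mN: "m \<le> N + 1"
    and vanish: "\<And>i. i \<le> N \<Longrightarrow> glue N a b F 0 (node N a b i) = 0"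
    and rep: "\<And>\<phi>. \<phi> \<in> sobolev_space m a b \<Longrightarrow>
      error_functional N a b \<omega> C0 \<phi> = sobolev_inner m a b \<phi> (glue N a b F 0)"
  shows "sard_optimal m N a b \<omega> C \<longleftrightarrow> (\<forall>i\<le>N. C i = C0 i)"
proof -
  interpret F: smooth_pieces m N a b F by fact
  let ?g = "glue N a b" and ?norm = "sobolev_norm m a b" and ?H = "sobolev_space m a b"
    and ?E = "error_norm m N a b \<omega>" and ?P = "smooth_pieces m N a b"
  note mNab = F.m F.N F.ab
  define P where "P p = (\<lambda>(i::nat) k x. poly ((pderiv ^^ k) p) (complex_of_real x))" for p
  have P: "?P (P p)" for p
    unfolding P_def by (rule smooth_pieces_poly[OF mNab])
  define \<psi> where "\<psi> = ?g F 0"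
  define M where "M = ?norm \<psi>"
  define l where "l = error_functional N a b \<omega>"
  have M0: "0 \<le> M" by (simp add: M_def sobolev_norm_nonneg)
  have cont: "continuous_on {a..b} (?g G 0)" if "?P G" for G
    using sobolev_space_continuous[OF smooth_pieces.glue_in_sobolev_space[OF that], of 0]
    by (simp add: iter_deriv_def)
  have lin: "l C' (?g (\<lambda>i k x. c * G i k x + d * H i k x) 0)
      = c * l C' (?g G 0) + d * l C' (?g H 0)"
    if "?P G" "?P H" for C' c d G H
    unfolding l_def using error_functional_lincomb[OF cont[OF that(1)] cont[OF that(2)]]
    by (simp add: glue_lincomb[abs_def])
  \<comment> \<open>The integrals cancel, so two functionals differ by point evaluations at the
    nodes only.\<close>
  have diff: "l C' \<phi> - l C'' \<phi> = (\<Sum>i=0..N. (C'' i - C' i) * \<phi> (node N a b i))" for C' C'' \<phi>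
    by (simp add: l_def error_functional_def node_def left_diff_distrib sum_subtractf)
  have psi_sob: "\<psi> \<in> ?H"
    unfolding \<psi>_def by (rule F.glue_in_sobolev_space)
  have l0_psi: "l C0 \<psi> = of_real (M\<^sup>2)"
    using rep[OF psi_sob] unfolding l_def M_def sobolev_norm_power2 \<psi>_def[symmetric] sobolev_inner_self by simp
  have l_psi: "l C' \<psi> = of_real (M\<^sup>2)" for C'
    using diff[of C' \<psi> C0] vanish l0_psi by (simp add: \<psi>_def)
  have upper: "?E C0 \<le> ereal M"
    unfolding error_norm_def
  proof (rule SUP_least)
    fix \<phi> assume "\<phi> \<in> {\<phi> \<in> ?H. ?norm \<phi> \<le> 1}"
    then have \<phi>: "\<phi> \<in> ?H" "?norm \<phi> \<le> 1" by auto
    have "cmod (error_functional N a b \<omega> C0 \<phi>) \<le> ?norm \<phi> * M"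
      using rep[OF \<phi>(1)] sobolev_Cauchy_Schwarz[OF \<phi>(1) psi_sob] by (simp add: M_def \<psi>_def)
    also have "\<dots> \<le> 1 * M" using \<phi>(2) M0 by (rule mult_right_mono)
    finally show "ereal (cmod (error_functional N a b \<omega> C0 \<phi>)) \<le> ereal M" by simp
  qed
  have bound: "cmod (l C' (?g G 0)) \<le> M * ?norm (?g G 0)"
    if C': "?E C' \<le> ereal M" and G: "?P G" for C' G
  proof (rule field_le_epsilon)
    fix e :: real assume "e > 0"
    define \<nu> where "\<nu> = ?norm (?g G 0)"
    \<comment> \<open>The seminorm may vanish, for instance on polynomials of degree below m; the
      added \<epsilon> keeps the rescaling meaningful.\<close>
    define \<epsilon> where "\<epsilon> = e / (M + 1)"
    have \<epsilon>: "\<epsilon> > 0" using \<open>e > 0\<close> M0 by (simp add: \<epsilon>_def)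
    have \<nu>: "0 \<le> \<nu>" by (simp add: \<nu>_def sobolev_norm_nonneg)
    define c where "c = complex_of_real (1 / (\<nu> + \<epsilon>))"
    have cmodc: "cmod c = 1 / (\<nu> + \<epsilon>)" unfolding c_def norm_of_real using \<nu> \<epsilon> by simp
    let ?u = "?g (\<lambda>i k x. c * G i k x + 0 * G i k x) 0"
    have "?norm ?u = \<nu> / (\<nu> + \<epsilon>)"
      unfolding sobolev_norm_glue_scale[OF G] cmodc \<nu>_def by simp
    also have "\<dots> \<le> 1" using \<nu> \<epsilon> by simp
    finally have "ereal (cmod (l C' ?u)) \<le> ?E C'"
      unfolding error_norm_def l_def
      using smooth_pieces.glue_in_sobolev_space[OF smooth_pieces_lincomb[OF G G, of c 0]]
      by (intro SUP_upper) auto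
    also note C'
    finally have "cmod (l C' ?u) \<le> M" by simp
    moreover have "l C' ?u = c * l C' (?g G 0)" using lin[OF G G, of C' c 0] by simp
    ultimately have "cmod (l C' (?g G 0)) / (\<nu> + \<epsilon>) \<le> M" by (simp add: norm_mult cmodc)
    then have "cmod (l C' (?g G 0)) \<le> M * (\<nu> + \<epsilon>)" using \<nu> \<epsilon> by (simp add: divide_simps)
    also have "\<dots> = M * \<nu> + M * \<epsilon>" by (simp add: algebra_simps)
    also have "M * \<epsilon> \<le> e" using M0 \<open>e > 0\<close> by (simp add: \<epsilon>_def divide_simps)
    finally show "cmod (l C' (?g G 0)) \<le> M * ?norm (?g G 0) + e"
      by (simp add: \<nu>_def)
  qed
  have lower: "ereal M \<le> ?E C'" for C'
  proof -
    \<comment> \<open>For M = 0 the division gives c = 0, and the same formulas yield the trivial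
      bound.\<close>
    define c where "c = complex_of_real (1 / M)"
    let ?u = "?g (\<lambda>i k x. c * F i k x + 0 * F i k x) 0"
    have "?norm ?u \<le> 1"
      unfolding sobolev_norm_glue_scale[OF F] \<psi>_def[symmetric] M_def[symmetric] c_def norm_of_real
      using M0 by simp
    then have "ereal (cmod (l C' ?u)) \<le> ?E C'"
      unfolding error_norm_def l_def
      using smooth_pieces.glue_in_sobolev_space[OF smooth_pieces_lincomb[OF F F, of c 0]]
      by (intro SUP_upper) auto
    moreover have "l C' ?u = of_real M"
      using lin[OF F F, of C' c 0] l_psi[of C'] by (simp add: \<psi>_def c_def power2_eq_square)
    ultimately show ?thesis using M0 by simp
  qed
  have exact0: "exact_on_polynomials m N a b \<omega> C0"
    unfolding exact_on_polynomials_def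
  proof (intro allI impI)
    fix \<alpha> assume \<alpha>: "\<alpha> < m"
    have eq: "?g (P (monom 1 \<alpha>)) k x = poly ((pderiv ^^ k) (monom 1 \<alpha>)) (of_real x)" for k x
      unfolding P_def by (rule glue_poly)
    have "(\<lambda>x. complex_of_real x ^ \<alpha>) = ?g (P (monom 1 \<alpha>)) 0"
      by (rule ext) (simp add: eq poly_monom)
    moreover have "error_functional N a b \<omega> C0 (?g (P (monom 1 \<alpha>)) 0) = 0"
    proof -
      have "(pderiv ^^ m) (monom 1 \<alpha>) = (0 :: complex poly)"
        using \<alpha> by (intro pderiv_funpow_eq_0) (simp add: degree_monom_eq)
      then show ?thesis
        using rep[OF smooth_pieces.glue_in_sobolev_space[OF P]] sobolev_inner_glue_glue[OF P F]
        by (simp add: eq)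
    qed
    ultimately show "error_functional N a b \<omega> C0 (\<lambda>x. of_real x ^ \<alpha>) = 0" by simp
  qed
  have uniq: "C' i = C0 i" if C': "?E C' \<le> ereal M" and i: "i \<le> N" for C' i
  proof -
    have first_order: "Re (l C' (?g G 0)) \<le> Re (l C0 (?g G 0))"
      if G: "?P G" for G
    proof -
      define r where "r = Re (l C' (?g G 0))"
      define s where "s = Re (l C0 (?g G 0))"
      define X where "X = (?norm (?g G 0))\<^sup>2"
      have s: "s = Re (sobolev_inner m a b (?g G 0) \<psi>)"
        using rep[OF smooth_pieces.glue_in_sobolev_space[OF G]] by (simp add: s_def l_def \<psi>_def)
      have X0: "0 \<le> X" by (simp add: X_def)
      have le: "r - s \<le> t * X / 2" if t: "t > 0" for t
      proof -
        let ?u = "?g (\<lambda>i k x. 1 * F i k x + of_real t * G i k x) 0"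
        have n: "(?norm ?u)\<^sup>2 = M\<^sup>2 + 2 * t * s + t\<^sup>2 * X"
          unfolding sobolev_norm_glue_add[OF F G] s X_def M_def \<psi>_def ..
        have "M\<^sup>2 + t * r = Re (l C' ?u)"
          using lin[OF F G, of C' 1 "of_real t"] l_psi[of C'] by (simp add: \<psi>_def r_def)
        also have "\<dots> \<le> cmod (l C' ?u)" by (rule complex_Re_le_cmod)
        also have "\<dots> \<le> M * ?norm ?u"
          by (rule bound[OF C' smooth_pieces_lincomb[OF F G]])
        \<comment> \<open>The inequality of the means replaces the norm by its square, which is a
          polynomial in t.\<close>
        also have "\<dots> \<le> (M\<^sup>2 + (?norm ?u)\<^sup>2) / 2"
          using zero_le_power2[of "M - ?norm ?u"] by (simp add: power2_diff)
        also have "\<dots> = M\<^sup>2 + t * s + t * (t * X / 2)" unfolding n by (simp add: power2_eq_square)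
        finally have "t * (r - s) \<le> t * (t * X / 2)" by (simp add: algebra_simps)
        then show ?thesis using t by (simp add: mult_le_cancel_left_pos)
      qed
      have "r - s \<le> 0"
      proof (rule field_le_epsilon)
        fix e :: real assume "e > 0"
        then have "r - s \<le> (2 * e / (X + 1)) * X / 2" using X0 by (intro le) simp
        also have "\<dots> \<le> 0 + e" using X0 \<open>e > 0\<close> by (simp add: divide_simps)
        finally show "r - s \<le> 0 + e" .
      qed
      then show ?thesis by (simp add: r_def s_def)
    qed
    have eq: "l C' (?g G 0) = l C0 (?g G 0)" if G: "?P G" for G
    proof -
      define z where "z = l C' (?g G 0) - l C0 (?g G 0)"
      \<comment> \<open>Scaling the test family by \<open>cnj z\<close> turns the one-sided
        inequality of real parts into (cmod z)^2 \<le> 0.\<close>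
      have "Re (cnj z * l C' (?g G 0)) \<le> Re (cnj z * l C0 (?g G 0))"
        using first_order[OF smooth_pieces_lincomb[OF G G, of "cnj z" 0]]
        unfolding lin[OF G G] by simp
      then have "Re (cnj z * z) \<le> 0" by (simp add: z_def algebra_simps)
      moreover have "cnj z * z = of_real ((cmod z)\<^sup>2)" by (metis complex_norm_square mult.commute)
      ultimately have "z = 0" by simp
      then show ?thesis by (simp add: z_def)
    qed
    \<comment> \<open>It vanishes at every node except the one of index i, so it isolates one
      coefficient.\<close>
    define p where "p = (\<Prod>j\<in>{0..N} - {i}. [:- complex_of_real (node N a b j), 1:])"
    have p0: "poly p (of_real (node N a b j)) = 0" if "j \<in> {0..N} - {i}" for j
      unfolding p_def poly_prod using that by (intro prod_zero) auto
    have pi: "poly p (of_real (node N a b i)) \<noteq> 0"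
      unfolding p_def poly_prod using F.node_eq_iff by (auto simp: prod_zero_iff)
    have "0 = l C' (?g (P p) 0) - l C0 (?g (P p) 0)" using eq[OF P] by simp
    also have "\<dots> = (\<Sum>j=0..N. (C0 j - C' j) * poly p (of_real (node N a b j)))"
      unfolding diff P_def glue_poly by simp
    also have "\<dots> = (C0 i - C' i) * poly p (of_real (node N a b i))"
      using i p0 by (subst sum.remove[of _ i]) (auto intro!: sum.neutral)
    finally show ?thesis using pi by simp
  qed
  show ?thesis
  proof
    assume "sard_optimal m N a b \<omega> C"
    then have "?E C \<le> ?E C0"
      using exact0 by (simp add: sard_optimal_def)
    also note upper
    finally show "\<forall>i\<le>N. C i = C0 i" using uniq by blast
  next
    assume eq: "\<forall>i\<le>N. C i = C0 i"
    have "error_functional N a b \<omega> C = error_functional N a b \<omega> C0"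
      unfolding error_functional_def using eq by (intro ext arg_cong2[where f = "(-)"] sum.cong) auto
    then have "exact_on_polynomials m N a b \<omega> C" "?E C = ?E C0"
      using exact0 by (auto simp: exact_on_polynomials_def error_norm_def)
    then show "sard_optimal m N a b \<omega> C"
      unfolding sard_optimal_def using order_trans[OF upper lower] by auto
  qed
qed

section \<open>Splines as combinations of exponential splines\<close>

text \<open>Gaussian elimination: a pivot x0 in the row y expresses its unknown through the others,
  and substitution leaves one row and one unknown fewer.\<close>

lemma nontrivial_kernel:
  fixes M :: "'y \<Rightarrow> 'x \<Rightarrow> complex"
  assumes "finite Y" "finite X" "card Y < card X"
  shows "\<exists>c. (\<exists>x\<in>X. c x \<noteq> 0) \<and> (\<forall>y\<in>Y. (\<Sum>x\<in>X. M y x * c x) = 0)"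
  using assms
proof (induction Y arbitrary: X M rule: finite_induct)
  case empty
  then have "X \<noteq> {}" by auto
  then show ?case by (intro exI[of _ "\<lambda>_. 1"]) auto
next
  case (insert y Y)
  show ?case
  proof (cases "\<forall>x\<in>X. M y x = 0")
    case True
    have "card Y < card X" using insert by simp
    then obtain c where "\<exists>x\<in>X. c x \<noteq> 0" "\<forall>y\<in>Y. (\<Sum>x\<in>X. M y x * c x) = 0"
      using insert.IH[OF insert.prems(1)] by blast
    with True show ?thesis by (intro exI[of _ c]) (auto intro!: sum.neutral)
  next
    case False
    then obtain x0 where x0: "x0 \<in> X" "M y x0 \<noteq> 0" by blast
    define X' where "X' = X - {x0}"
    have X': "finite X'" "x0 \<notin> X'" "X = insert x0 X'" using insert.prems x0 by (auto simp: X'_def)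
    then have "card Y < card X'" using insert by simp
    then obtain c where c: "\<exists>x\<in>X'. c x \<noteq> 0"
      "\<And>y'. y' \<in> Y \<Longrightarrow> (\<Sum>x\<in>X'. (M y' x - M y' x0 * (M y x / M y x0)) * c x) = 0"
      using insert.IH[OF X'(1), of "\<lambda>y' x. M y' x - M y' x0 * (M y x / M y x0)"] by blast
    define s where "s = (\<Sum>x\<in>X'. M y x / M y x0 * c x)"
    have sum: "(\<Sum>x\<in>X. M y' x * (c(x0 := - s)) x) = (\<Sum>x\<in>X'. M y' x * c x) - M y' x0 * s" for y'
    proof -
      have "(\<Sum>x\<in>X'. M y' x * (c(x0 := - s)) x) = (\<Sum>x\<in>X'. M y' x * c x)"
        using X'(2) by (intro sum.cong) auto
      then show ?thesis unfolding X'(3) using X'(1,2) by simp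
    qed
    have "(\<Sum>x\<in>X. M y' x * (c(x0 := - s)) x) = 0" if "y' \<in> insert y Y" for y'
    proof (cases "y' = y")
      case True
      have "M y x0 * s = (\<Sum>x\<in>X'. M y x * c x)"
        unfolding s_def sum_distrib_left using x0 by simp
      then show ?thesis unfolding sum True by simp
    next
      case False
      then have "0 = (\<Sum>x\<in>X'. (M y' x - M y' x0 * (M y x / M y x0)) * c x)"
        using that c(2) by simp
      also have "\<dots> = (\<Sum>x\<in>X'. M y' x * c x) - M y' x0 * s"
        by (simp add: s_def sum_distrib_left left_diff_distrib sum_subtractf mult.assoc)
      finally show ?thesis unfolding sum by simp
    qed
    moreover have "\<exists>x\<in>X. (c(x0 := - s)) x \<noteq> 0" using c(1) X' by auto
    ultimately show ?thesis by blast
  qed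
qed

text \<open>The right-hand side becomes the column of an extra unknown \<open>None\<close>. A
  nontrivial kernel vector cannot vanish there, since the original kernel is trivial; dividing by
  that entry gives a solution.\<close>

lemma square_system_solvable:
  fixes M :: "'y \<Rightarrow> 'x \<Rightarrow> complex"
  assumes fin: "finite Y" "finite X" and card: "card Y = card X"
    and ker: "\<And>c. (\<And>y. y \<in> Y \<Longrightarrow> (\<Sum>x\<in>X. M y x * c x) = 0) \<Longrightarrow> \<forall>x\<in>X. c x = 0"
  shows "\<exists>c. \<forall>y\<in>Y. (\<Sum>x\<in>X. M y x * c x) = r y"
proof -
  define X' where "X' = insert None (Some ` X)"
  define M' where "M' y x = (case x of None \<Rightarrow> - r y | Some x \<Rightarrow> M y x)" for y x
  have "card Y < card X'" using fin card by (simp add: X'_def card_image)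
  then obtain c where c: "\<exists>x\<in>X'. c x \<noteq> 0" "\<And>y. y \<in> Y \<Longrightarrow> (\<Sum>x\<in>X'. M' y x * c x) = 0"
    using nontrivial_kernel[of Y X' M'] fin by (auto simp: X'_def)
  have eq: "(\<Sum>x\<in>X. M y x * c (Some x)) = r y * c None" if "y \<in> Y" for y
  proof -
    have "0 = (\<Sum>x\<in>X'. M' y x * c x)" using c(2)[OF that] by simp
    also have "\<dots> = - r y * c None + (\<Sum>x\<in>X. M y x * c (Some x))"
      unfolding X'_def using fin by (subst sum.insert) (auto simp: M'_def sum.reindex)
    finally show ?thesis by (simp add: algebra_simps)
  qed
  have "c None \<noteq> 0"
  proof
    assume 0: "c None = 0"
    then have "\<forall>x\<in>X. c (Some x) = 0" using eq by (intro ker) simp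
    with 0 c(1) show False by (auto simp: X'_def)
  qed
  then have "(\<Sum>x\<in>X. M y x * (c (Some x) / c None)) = r y" if "y \<in> Y" for y
    using eq[OF that] by (simp add: sum_divide_distrib[symmetric])
  then show ?thesis by (intro exI[of _ "\<lambda>x. c (Some x) / c None"]) blast
qed

section \<open>Chains of derivatives and their zeros\<close>

lemma derivative_chain_eq_0:
  fixes D :: "nat \<Rightarrow> real \<Rightarrow> complex"
  assumes D: "\<And>k x. (D k has_vector_derivative D (Suc k) x) (at x)"
    and top: "\<And>x. D n x = 0" and t: "\<And>k. k < n \<Longrightarrow> D k t = 0" and k: "k \<le> n"
  shows "D k x = 0"
  using k
proof (induction arbitrary: x rule: inc_induct)
  case (step k)
  have "\<And>x. (D k has_vector_derivative 0) (at x within UNIV)"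
    using D[of k] step.IH by simp
  then obtain c where "\<And>x. D k x = c"
    using has_vector_derivative_zero_constant[OF convex_UNIV] by (metis UNIV_I)
  then show ?case using t[of k] step by metis
qed (rule top)

lemma coeff_funpow_pderiv:
  fixes p :: "complex poly"
  shows "fact i * coeff ((pderiv ^^ k) p) i = fact (i + k) * coeff p (i + k)"
proof (induction k arbitrary: i)
  case (Suc k)
  have "fact i * coeff ((pderiv ^^ Suc k) p) i = fact (Suc i) * coeff ((pderiv ^^ k) p) (Suc i)"
    by (simp add: coeff_pderiv mult_ac)
  also have "\<dots> = fact (Suc i + k) * coeff p (Suc i + k)" by (rule Suc.IH)
  finally show ?case by (simp only: add_Suc_shift)
qed simp

text \<open>A chain that reaches 0 at order n starts with a polynomial of degree less than n, its
  Taylor polynomial at 0; n distinct real zeros, counted among the complex ones, are too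
  many.\<close>

lemma derivative_chain_zeros:
  fixes D :: "nat \<Rightarrow> real \<Rightarrow> complex"
  assumes D: "\<And>k x. (D k has_vector_derivative D (Suc k) x) (at x)"
    and top: "\<And>x. D n x = 0" and X: "finite X" "n \<le> card X" "\<And>x. x \<in> X \<Longrightarrow> D 0 x = 0"
  shows "D 0 x = 0"
proof -
  define p where "p = (\<Sum>k<n. monom (D k 0 / fact k) k)"
  have cp: "coeff p k = (if k < n then D k 0 / fact k else 0)" for k
    by (simp add: p_def coeff_sum)
  define E where "E k x = D k x - poly ((pderiv ^^ k) p) (of_real x)" for k x
  have "E 0 x = 0" for x
  proof (rule derivative_chain_eq_0[where n = n and t = 0])
    show "(E k has_vector_derivative E (Suc k) x) (at x)" for k x
      unfolding E_def using has_vector_derivative_real_field[OF poly_DERIV, of "(pderiv ^^ k) p" x UNIV]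
      by (intro has_vector_derivative_diff D) simp
    have "(pderiv ^^ n) p = 0"
      by (rule poly_eqI) (use coeff_funpow_pderiv[of _ n p] cp in \<open>simp\<close>)
    then show "E n x = 0" for x by (simp add: E_def top)
    show "E k 0 = 0" if "k < n" for k
      using coeff_funpow_pderiv[of 0 k p] that by (simp add: E_def poly_0_coeff_0 cp)
  qed simp
  then have eq: "D 0 x = poly p (of_real x)" for x by (simp add: E_def)
  have "p = 0"
  proof (rule ccontr)
    assume p: "p \<noteq> 0"
    have fin: "finite {z. poly p z = 0}" by (rule poly_roots_finite[OF p])
    have "n \<noteq> 0" using p by (cases n) (auto simp: p_def)
    have "degree p \<le> n - 1" using cp by (intro degree_le) auto
    then have "degree p < n" using \<open>n \<noteq> 0\<close> by simp
    also have "n \<le> card (complex_of_real ` X)" using X by (subst card_image) (auto simp: inj_on_def)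
    also have "\<dots> \<le> card {z. poly p z = 0}" using X eq by (intro card_mono fin) auto
    also have "\<dots> \<le> degree p" by (rule card_poly_roots_bound[OF p])
    finally show False by simp
  qed
  then show ?thesis by (simp add: eq)
qed

lemma sum_summation_by_parts:
  fixes y s :: "nat \<Rightarrow> complex"
  shows "(\<Sum>i<Suc n. s i * (y i - y (Suc i))) = y 0 * s 0 - y (Suc n) * s n + (\<Sum>i=1..n. y i * (s i - s (i - 1)))"
  by (induction n) (simp_all add: algebra_simps)

section \<open>Splines with a finite set of bases\<close>

locale spline_data =
  fixes m N :: nat and a b h :: real and Z :: "complex set" and c :: "complex \<Rightarrow> complex"
  assumes m: "m \<ge> 1" and N: "N \<ge> 1" and ab: "a < b" and h: "h = (b - a) / real N"
    and Z: "finite Z" "0 \<notin> Z" "1 \<notin> Z"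
begin

text \<open>The pieces of unit mesh width are rescaled to width h. The power of h makes the jump of
  order 2 * m - 1 at the node i equal to \<open>of_real h * (\<Sum>z\<in>Z. c z * z ^ i)\<close>,
  the shape of the interior coefficients.\<close>

definition spl :: "nat \<Rightarrow> nat \<Rightarrow> real \<Rightarrow> complex" where
  "spl i k x = (if k < 2 * m then of_real h ^ (2 * m - k) *
     (\<Sum>z\<in>Z. c z * z ^ i * spline_piece z (2 * m - 1 - k) (of_real ((x - node N a b i) / h))) else 0)"

lemma h_pos: "h > 0" using h N ab by simp

lemma node_eq: "node N a b i = h * real i + a" by (simp add: node_def h)

lemma spl_deriv: "(spl i k has_vector_derivative spl i (Suc k) x) (at x)"
proof (cases "Suc k < 2 * m")
  case True
  then have e: "2 * m - 1 - k = Suc (2 * m - 1 - Suc k)" "2 * m - k = Suc (2 * m - Suc k)" by auto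
  have inner: "((\<lambda>x. (x - of_real (node N a b i)) / of_real h) has_field_derivative (1 / of_real h)) (at y)" for y :: complex
    using h_pos by (auto intro!: derivative_eq_intros)
  have "((\<lambda>y. spline_piece z (2 * m - 1 - k) ((y - of_real (node N a b i)) / of_real h)) has_field_derivative
      (spline_piece z (2 * m - 1 - Suc k) ((y - of_real (node N a b i)) / of_real h) * (1 / of_real h))) (at y)" for z y
    unfolding e by (rule DERIV_chain2[OF has_field_derivative_spline_piece inner])
  then have "((\<lambda>y. of_real h ^ (2 * m - k) * (\<Sum>z\<in>Z. c z * z ^ i * spline_piece z (2 * m - 1 - k) ((y - of_real (node N a b i)) / of_real h)))
    has_field_derivative of_real h ^ (2 * m - k) * (\<Sum>z\<in>Z. c z * z ^ i *
      (spline_piece z (2 * m - 1 - Suc k) ((y - of_real (node N a b i)) / of_real h) * (1 / of_real h)))) (at y)" for y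
    by (intro DERIV_cmult DERIV_sum)
  from has_vector_derivative_real_field[OF this[of "of_real x"], of UNIV]
  have "(spl i k has_vector_derivative of_real h ^ (2 * m - k) * (\<Sum>z\<in>Z. c z * z ^ i *
      (spline_piece z (2 * m - 1 - Suc k) ((of_real x - of_real (node N a b i)) / of_real h) * (1 / of_real h)))) (at x)"
    using True by (simp add: spl_def[abs_def])
  moreover have "of_real h ^ (2 * m - k) * (\<Sum>z\<in>Z. c z * z ^ i *
      (spline_piece z (2 * m - 1 - Suc k) ((of_real x - of_real (node N a b i)) / of_real h) * (1 / of_real h)))
    = spl i (Suc k) x"
    using True h_pos unfolding e(2) by (simp add: spl_def sum_distrib_left mult_ac)
  ultimately show ?thesis by simp
next
  case False
  then have "spl i k = (\<lambda>x. spl i k a)" "spl i (Suc k) x = 0"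
    by (auto simp: spl_def spline_piece_const)
  then show ?thesis by (metis has_vector_derivative_const)
qed

lemma spline_sum_factor:
  "of_real h ^ (j + 1) * (\<Sum>z\<in>Z. c z * z ^ i * - ((-1) ^ j * abel_sum j z / fact j))
    = - ((-1) ^ j * of_real h ^ (j + 1) / fact j * (\<Sum>z\<in>Z. c z * z ^ i * abel_sum j z))"
proof -
  have "(\<Sum>z\<in>Z. c z * z ^ i * - ((-1) ^ j * abel_sum j z / fact j))
      = (\<Sum>z\<in>Z. - ((-1) ^ j / fact j) * (c z * z ^ i * abel_sum j z))"
    by (intro sum.cong) auto
  also have "\<dots> = - ((-1) ^ j / fact j) * (\<Sum>z\<in>Z. c z * z ^ i * abel_sum j z)"
    by (rule sum_distrib_left[symmetric])
  finally show ?thesis by simp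
qed

lemma spl_left:
  assumes "k < 2 * m" "j = 2 * m - 1 - k"
  shows "spl i k (node N a b i) = - ((-1) ^ j * of_real h ^ (j + 1) / fact j * (\<Sum>z\<in>Z. c z * z ^ i * abel_sum j z))"
proof -
  have "2 * m - k = j + 1" using assms by simp
  then show ?thesis
    using assms(1) spline_sum_factor[of j i]
    unfolding spl_def diff_self div_0 of_real_0 spline_piece_0 assms(2)[symmetric] by simp
qed

text \<open>The power \<open>z ^ Suc i\<close> in place of \<open>z ^ i\<close> is the fit with the
  next piece that \<open>spline_piece_1\<close> provides. It ends at order 2 * m - 2, which is j =
  1.\<close>

lemma spl_right:
  assumes "k \<le> 2 * m - 2" "j = 2 * m - 1 - k"
  shows "spl i k (node N a b (Suc i)) = - ((-1) ^ j * of_real h ^ (j + 1) / fact j * (\<Sum>z\<in>Z. c z * z ^ Suc i * abel_sum j z))"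
proof -
  have e: "2 * m - k = j + 1" "j \<ge> 1" "k < 2 * m" using assms m by auto
  have 1: "(node N a b (Suc i) - node N a b i) / h = 1" using h_pos by (simp add: node_eq algebra_simps)
  have "c z * z ^ i * spline_piece z j 1 = c z * z ^ Suc i * - ((-1) ^ j * abel_sum j z / fact j)" if "z \<in> Z" for z
  proof -
    have "z \<noteq> 0" "z \<noteq> 1" using that Z by auto
    then show ?thesis by (simp add: spline_piece_1[OF e(2)] spline_piece_0)
  qed
  then have "(\<Sum>z\<in>Z. c z * z ^ i * spline_piece z j 1)
      = (\<Sum>z\<in>Z. c z * z ^ Suc i * - ((-1) ^ j * abel_sum j z / fact j))"
    by (rule sum.cong[OF refl])
  then show ?thesis
    using e spline_sum_factor[of j "Suc i"] unfolding spl_def 1 assms(2)[symmetric] by simp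
qed

lemma spl_top: "spl i (2 * m - 1) x = of_real h * (\<Sum>z\<in>Z. c z * z ^ i * (z / (z - 1)))"
  using m by (simp add: spl_def spline_piece_const)

lemma spl_2m: "spl i (2 * m) x = 0" by (simp add: spl_def)

sublocale spl: smooth_pieces m N a b spl
proof
  show "spl i k (node N a b (Suc i)) = spl (Suc i) k (node N a b (Suc i))"
    if "Suc i < N" "k \<le> 2 * m - 2" for i k
    using that m by (subst spl_right) (auto simp: spl_left)
qed (use m N ab spl_deriv in auto)

text \<open>General end data r serve two purposes: r = 0 for natural null splines, and the end
  derivatives of the wave for the interpolating spline.\<close>

lemma spl_natural_a:
  assumes "\<And>j. 1 \<le> j \<Longrightarrow> j \<le> m - 1 \<Longrightarrow> (\<Sum>z\<in>Z. c z * abel_sum j z) = r j"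
    and "m \<le> k" "k \<le> 2 * m - 2"
  shows "spl 0 k a = - ((-1) ^ (2 * m - 1 - k) * of_real h ^ (2 * m - k) / fact (2 * m - 1 - k) * r (2 * m - 1 - k))"
proof -
  have "1 \<le> 2 * m - 1 - k" "2 * m - 1 - k \<le> m - 1" "2 * m - k = 2 * m - 1 - k + 1" "k < 2 * m"
    using assms(2,3) m by auto
  then show ?thesis using spl_left[of k _ 0, OF _ refl] assms(1)[of "2 * m - 1 - k"] by (simp add: spl.node_0)
qed

lemma spl_natural_b:
  assumes "\<And>j. 1 \<le> j \<Longrightarrow> j \<le> m - 1 \<Longrightarrow> (\<Sum>z\<in>Z. c z * z ^ N * abel_sum j z) = r j"
    and "m \<le> k" "k \<le> 2 * m - 2"
  shows "spl (N - 1) k b = - ((-1) ^ (2 * m - 1 - k) * of_real h ^ (2 * m - k) / fact (2 * m - 1 - k) * r (2 * m - 1 - k))"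
proof -
  have "1 \<le> 2 * m - 1 - k" "2 * m - 1 - k \<le> m - 1" "2 * m - k = 2 * m - 1 - k + 1" "Suc (N - 1) = N"
    using assms(2,3) m N by auto
  then show ?thesis using spl_right[of k _ "N - 1", OF assms(3) refl] assms(1)[of "2 * m - 1 - k"]
    by (simp add: spl.node_N)
qed

lemma spl_node:
  assumes "i \<le> N"
  shows "glue N a b spl 0 (node N a b i)
    = of_real h ^ (2 * m) / fact (2 * m - 1) * (\<Sum>z\<in>Z. c z * z ^ i * abel_sum (2 * m - 1) z)"
proof -
  have s: "- ((-1) ^ (2 * m - 1) * x) = (x :: complex)" for x
    using m by (cases m) auto
  have e: "2 * m - 1 + 1 = 2 * m" "2 * m - 1 = 2 * m - 1 - 0" using m by auto
  show ?thesis
  proof (cases "i < N")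
    case True
    then have "glue N a b spl 0 (node N a b i) = spl i 0 (node N a b i)"
      by (intro spl.glue_eq) (auto simp: spl.node_le_iff)
    also have "\<dots> = of_real h ^ (2 * m) / fact (2 * m - 1) * (\<Sum>z\<in>Z. c z * z ^ i * abel_sum (2 * m - 1) z)"
      using spl_left[OF _ e(2), of i] s m unfolding e(1) mult.assoc times_divide_eq_right[symmetric] by simp
    finally show ?thesis .
  next
    case False
    with assms N obtain i' where i': "i = Suc i'" "i' < N" by (cases i) auto
    then have "glue N a b spl 0 (node N a b i) = spl i' 0 (node N a b i)"
      by (intro spl.glue_eq) (auto simp: spl.node_le_iff)
    also have "\<dots> = of_real h ^ (2 * m) / fact (2 * m - 1) * (\<Sum>z\<in>Z. c z * z ^ i * abel_sum (2 * m - 1) z)"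
      using spl_right[OF _ e(2), of i'] s m i' unfolding e(1) mult.assoc times_divide_eq_right[symmetric] by simp
    finally show ?thesis .
  qed
qed

text \<open>A natural null spline has vanishing energy, hence is a polynomial of degree less than \<open>m\<close>
  with \<open>N + 1\<close> zeros.\<close>

lemma natural_null_spline_trivial:
  assumes mN: "m \<le> N + 1" and card: "card Z \<le> 2 * m - 2"
    and root: "\<And>z. z \<in> Z \<Longrightarrow> abel_sum (2 * m - 1) z = 0"
    and end_a: "\<And>j. 1 \<le> j \<Longrightarrow> j \<le> m - 1 \<Longrightarrow> (\<Sum>z\<in>Z. c z * abel_sum j z) = 0"
    and end_b: "\<And>j. 1 \<le> j \<Longrightarrow> j \<le> m - 1 \<Longrightarrow> (\<Sum>z\<in>Z. c z * z ^ N * abel_sum j z) = 0"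
    and w: "w \<in> Z"
  shows "c w = 0"
proof -
  let ?x = "node N a b"
  have nodes: "spl.g 0 (?x i) = 0" if "i \<le> N" for i
    using spl_node[OF that] root by simp
  \<comment> \<open>The derivative of order 2 * m is 0, and the boundary terms of order 2 * m - 1
    are paired with nodal values, which vanish.\<close>
  have "sobolev_inner m a b (spl.g 0) (spl.g 0) = 0"
  proof -
    have "spl.g (2 * m) x = 0" for x by (simp add: glue_def spl_2m)
    then show ?thesis
      using spl.sobolev_inner_glue_eq_jumps[OF spl.glue_in_sobolev_space]
        spl_natural_a[of "\<lambda>_. 0", OF end_a] spl_natural_b[of "\<lambda>_. 0", OF end_b] nodes by (simp add: spl.jump_sum_def)
  qed
  then have "(LINT x|lebesgue_on {a..b}. (cmod (spl.g m x))\<^sup>2) = 0"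
    unfolding sobolev_inner_self sobolev_norm_power2[symmetric]
      sobolev_norm_glue_power2[OF spl.smooth_pieces_axioms] by simp
  then have "AE x in lebesgue_on {a..b}. (cmod (spl.g m x))\<^sup>2 = 0"
    by (subst (asm) integral_nonneg_eq_0_iff_AE) (auto intro: spl.integrable_glue_square)
  then have "AE x in lebesgue. x \<in> {a..b} \<longrightarrow> spl.g m x = 0"
    by (subst (asm) AE_restrict_space_iff) auto
  then obtain E where E: "E \<in> null_sets lebesgue" "{x. \<not> (x \<in> {a..b} \<longrightarrow> spl.g m x = 0)} \<subseteq> E"
    by (auto simp: eventually_ae_filter)
  then have negE: "negligible E" by (simp add: negligible_iff_null_sets)
  have open0: "spl i (m + k) x = 0" if i: "i < N" and x: "x \<in> {?x i<..<?x (Suc i)}" for i k x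
    using x
  proof (induction k arbitrary: x)
    case 0
    \<comment> \<open>An open set contained in a null set, hence empty.\<close>
    define O' where "O' = {x \<in> {?x i<..<?x (Suc i)}. spl i m x \<noteq> 0}"
    have "open O'"
    proof -
      have "O' = {?x i<..<?x (Suc i)} \<inter> (spl i m -` (- {0}))" by (auto simp: O'_def)
      moreover have "open (spl i m -` (- {0}))"
        by (intro open_vimage spl.continuous_piece open_Compl) auto
      ultimately show ?thesis by (simp add: open_Int)
    qed
    have "O' \<subseteq> E"
    proof
      fix y assume y: "y \<in> O'"
      then have "y \<in> {?x i..?x (Suc i)}" by (auto simp: O'_def)
      then have "y \<in> {a..b}" using spl.pieces_cover i by blast
      moreover have "spl.g m y = spl i m y" using y by (intro spl.glue_left_open) (auto simp: O'_def)
      ultimately show "y \<in> E" using E(2) y by (auto simp: O'_def)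
    qed
    then have "negligible O'" using negE negligible_subset by blast
    then have "O' = {}" using \<open>open O'\<close> open_not_negligible by blast
    with 0 show ?case by (auto simp: O'_def)
  next
    case (Suc k)
    have "(spl i (m + k) has_vector_derivative 0) (at x)"
    proof (rule has_vector_derivative_transform_within_open)
      show "((\<lambda>_. 0) has_vector_derivative 0) (at x)" by simp
      show "open {?x i<..<?x (Suc i)}" by simp
    qed (use Suc in auto)
    then show ?case using spl_deriv[of i "m + k" x] vector_derivative_unique_at by force
  qed
  \<comment> \<open>From the open interval to the whole line: the order 2 * m vanishes everywhere,
    and the orders m, ..., 2 * m - 1 vanish at the midpoint.\<close>
  have m0: "spl i m x = 0" if i: "i < N" for i x
  proof -
    define t where "t = (?x i + ?x (Suc i)) / 2"
    have t: "t \<in> {?x i<..<?x (Suc i)}" using spl.node_less_iff[of i "Suc i"] by (auto simp: t_def)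
    have "spl i (m + 0) x = 0"
    proof (rule derivative_chain_eq_0[where D = "\<lambda>k. spl i (m + k)" and n = m and t = t])
      show "spl i (m + m) x = 0" for x using spl_2m by (simp add: mult_2)
      show "(spl i (m + k) has_vector_derivative spl i (m + Suc k) x) (at x)" for k x
        using spl_deriv[of i "m + k" x] by simp
    qed (use open0[OF i t] in auto)
    then show ?thesis by simp
  qed
  \<comment> \<open>The difference of neighbouring pieces is a chain that is 0 at order m, and its
    lower orders vanish at the common node.\<close>
  have same: "i < N \<Longrightarrow> spl i 0 x = spl 0 0 x" for i x
  proof (induction i)
    case (Suc i)
    have "spl (Suc i) 0 x - spl i 0 x = 0"
    proof (rule derivative_chain_eq_0[where D = "\<lambda>k x. spl (Suc i) k x - spl i k x" and n = m and t = "?x (Suc i)"])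
      show "((\<lambda>x. spl (Suc i) k x - spl i k x) has_vector_derivative spl (Suc i) (Suc k) x - spl i (Suc k) x) (at x)" for k x
        by (intro has_vector_derivative_diff spl_deriv)
      show "spl (Suc i) m x - spl i m x = 0" for x using m0 Suc by simp
      show "spl (Suc i) k (?x (Suc i)) - spl i k (?x (Suc i)) = 0" if "k < m" for k
        using spl.match[of i k] Suc that by simp
    qed simp
    then show ?case using Suc by simp
  qed simp
  have zero: "spl 0 0 x = 0" for x
  proof (rule derivative_chain_zeros[where D = "spl 0", OF spl_deriv])
    show "finite (?x ` {..N})" by simp
    show "m \<le> card (?x ` {..N})" using mN by (subst card_image) (auto simp: inj_on_def spl.node_eq_iff)
    show "spl 0 m x = 0" for x using m0 N by simp
    fix y assume "y \<in> ?x ` {..N}"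
    then obtain i where i: "i \<le> N" "y = ?x i" by auto
    then have "y \<in> {a..b}" using spl.node_bounds[OF i(1)] by simp
    then obtain i' where i': "i' < N" "y \<in> {?x i'..?x (Suc i')}"
      using spl.pieces_cover by blast
    have "0 = spl.g 0 y" using nodes i by simp
    also have "\<dots> = spl i' 0 y" using i' by (intro spl.glue_eq) auto
    also have "\<dots> = spl 0 0 y" by (rule same[OF i'(1)])
    finally show "spl 0 0 y = 0" by simp
  qed
  have zero_k: "spl 0 k x = 0" for k x
  proof (induction k arbitrary: x)
    case (Suc k)
    have "spl 0 k = (\<lambda>_. 0)" using Suc by auto
    then show ?case using spl_deriv[of 0 k x] vector_derivative_unique_at by (metis has_vector_derivative_const)
  qed (rule zero)
  \<comment> \<open>At the first node the vanishing derivatives are, up to nonzero factors, the Abel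
    combinations of orders 1, ..., 2 * m - 2, which suffices for at most 2 * m - 2 bases.\<close>
  show ?thesis
  proof (rule abel_sums_independent[OF Z card _ w])
    fix j assume j: "1 \<le> j" "j \<le> 2 * m - 2"
    then have "spl 0 (2 * m - 1 - j) (?x 0) = - ((-1) ^ j * of_real h ^ (j + 1) / fact j * (\<Sum>z\<in>Z. c z * z ^ 0 * abel_sum j z))"
      by (intro spl_left) auto
    then show "(\<Sum>z\<in>Z. c z * abel_sum j z) = 0"
      using zero_k h_pos by simp
  qed
qed

end

section \<open>Optimal coefficients from an interpolating spline\<close>

lemma wave_has_vector_derivative:
  "(wave \<omega> has_vector_derivative (2 * of_real pi * \<i> * of_real \<omega>) * wave \<omega> x) (at x)"
proof -
  have "((\<lambda>z. exp (2 * of_real pi * \<i> * of_real \<omega> * z)) has_field_derivative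
     (2 * of_real pi * \<i> * of_real \<omega>) * exp (2 * of_real pi * \<i> * of_real \<omega> * of_real x)) (at (of_real x))"
    by (auto intro!: derivative_eq_intros)
  from has_vector_derivative_real_field[OF this, of UNIV] show ?thesis
    by (simp add: wave_def[abs_def])
qed

lemma wave_add: "wave \<omega> (x + y) = wave \<omega> x * wave \<omega> y"
  by (simp add: wave_def exp_add[symmetric] algebra_simps)

lemma wave_node: "wave \<omega> (h * real i + a) = wave \<omega> a * wave \<omega> h ^ i"
proof -
  have "wave \<omega> (h * real i) = wave \<omega> h ^ i"
    by (simp add: wave_def exp_of_nat_mult[symmetric] mult_ac)
  then show ?thesis by (simp add: wave_add)
qed

context spline_data
begin

lemma sard_optimal_iff_interpolating_spline:
  fixes \<omega> :: real
  defines "\<kappa> \<equiv> 2 * of_real pi * \<i> * of_real \<omega> * of_real h"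
  assumes mN: "m \<le> N + 1" and om: "\<omega> \<noteq> 0"
    and interp: "\<And>i. i \<le> N \<Longrightarrow> (\<Sum>z\<in>Z. c z * z ^ i * abel_sum (2 * m - 1) z)
      = fact (2 * m - 1) * wave \<omega> (node N a b i) / \<kappa> ^ (2 * m)"
    and end_a: "\<And>j. 1 \<le> j \<Longrightarrow> j \<le> m - 1 \<Longrightarrow>
      (\<Sum>z\<in>Z. c z * abel_sum j z) = (-1) ^ (j + 1) * fact j * wave \<omega> a / \<kappa> ^ (j + 1)"
    and end_b: "\<And>j. 1 \<le> j \<Longrightarrow> j \<le> m - 1 \<Longrightarrow>
      (\<Sum>z\<in>Z. c z * z ^ N * abel_sum j z) = (-1) ^ (j + 1) * fact j * wave \<omega> b / \<kappa> ^ (j + 1)"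
  shows "sard_optimal m N a b \<omega> C \<longleftrightarrow>
    C 0 = of_real h * ((\<Sum>z\<in>Z. c z * (z / (z - 1))) - wave \<omega> a / \<kappa>) \<and>
    (\<forall>i\<in>{1..N - 1}. C i = of_real h * (\<Sum>z\<in>Z. c z * z ^ i)) \<and>
    C N = of_real h * (wave \<omega> b / \<kappa> - (\<Sum>z\<in>Z. c z * (z ^ N / (z - 1))))"
proof -
  define \<zeta> where "\<zeta> = 2 * of_real pi * \<i> * complex_of_real \<omega>"
  have \<zeta>: "\<zeta> \<noteq> 0" using om by (simp add: \<zeta>_def)
  have \<kappa>: "\<kappa> = \<zeta> * of_real h" by (simp add: \<kappa>_def \<zeta>_def)
  have h0: "of_real h \<noteq> (0 :: complex)" using h_pos by simp
  let ?x = "node N a b"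
  \<comment> \<open>The outer conjugate undoes that in the second argument of the inner product, and
    the sign cancels the (-1) ^ m from integrating by parts m times.\<close>
  define F where "F i k x = cnj ((-1) ^ m * (\<zeta> ^ k / \<zeta> ^ (2 * m) * wave \<omega> x - spl i k x))" for i k x
  interpret F: smooth_pieces m N a b F
  proof
    show "(F i k has_vector_derivative F i (Suc k) x) (at x)" for i k x
    proof -
      have "((\<lambda>x. \<zeta> ^ k / \<zeta> ^ (2 * m) * wave \<omega> x) has_vector_derivative \<zeta> ^ k / \<zeta> ^ (2 * m) * (\<zeta> * wave \<omega> x)) (at x)"
        using wave_has_vector_derivative[of \<omega> x] unfolding \<zeta>_def[symmetric]
        by (rule has_vector_derivative_mult_right)
      then have "((\<lambda>x. \<zeta> ^ k / \<zeta> ^ (2 * m) * wave \<omega> x) has_vector_derivative \<zeta> ^ Suc k / \<zeta> ^ (2 * m) * wave \<omega> x) (at x)"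
        by (simp add: mult_ac)
      then show ?thesis
        unfolding F_def by (intro has_vector_derivative_cnj has_vector_derivative_mult_right has_vector_derivative_diff spl_deriv)
    qed
    show "F i k (?x (Suc i)) = F (Suc i) k (?x (Suc i))" if "Suc i < N" "k \<le> 2 * m - 2" for i k
      using spl.match[OF that] by (simp add: F_def)
  qed (use m N ab in auto)
  have glueF: "F.g k x = cnj ((-1) ^ m * (\<zeta> ^ k / \<zeta> ^ (2 * m) * wave \<omega> x - spl.g k x))" for k x
    by (simp add: glue_def F_def)
  have nodes: "F.g 0 (?x i) = 0" if "i \<le> N" for i
  proof -
    have "spl.g 0 (?x i) = wave \<omega> (?x i) / \<zeta> ^ (2 * m)"
      unfolding spl_node[OF that] interp[OF that] \<kappa> power_mult_distrib
      using h0 \<zeta> by simp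
    then show ?thesis by (simp add: glueF)
  qed
  \<comment> \<open>With j = 2 * m - 1 - k, the end data given by Abel sums are exactly the
    derivatives of W at the end points; this makes F natural.\<close>
  have end_value: "\<zeta> ^ k / \<zeta> ^ (2 * m) * w =
      - ((-1) ^ (2 * m - 1 - k) * of_real h ^ (2 * m - k) / fact (2 * m - 1 - k) *
        ((-1) ^ (2 * m - 1 - k + 1) * fact (2 * m - 1 - k) * w / \<kappa> ^ (2 * m - 1 - k + 1)))"
    if "k \<le> 2 * m - 2" for k w
  proof -
    define j where "j = 2 * m - 1 - k"
    have j: "2 * m - k = j + 1" "2 * m = k + (j + 1)" using that m by (auto simp: j_def)
    have "\<zeta> ^ k / \<zeta> ^ (2 * m) * w = w / \<zeta> ^ (j + 1)"
      unfolding j(2) power_add[of \<zeta> k] using \<zeta> by simp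
    moreover have "(-1) ^ j * (-1) ^ (j + 1) = (-1 :: complex)"
      by (simp add: power_add[symmetric] mult_2[symmetric])
    ultimately show ?thesis
      unfolding j_def[symmetric] j(1) \<kappa> power_mult_distrib using h0 \<zeta>
      by (simp add: field_simps)
  qed
  have nat_a: "F 0 k a = 0" if k: "m \<le> k" "k \<le> 2 * m - 2" for k
    using spl_natural_a[OF end_a k] end_value[OF k(2), of "wave \<omega> a"] by (simp only: F_def) simp
  have nat_b: "F (N - 1) k b = 0" if k: "m \<le> k" "k \<le> 2 * m - 2" for k
    using spl_natural_b[OF end_b k] end_value[OF k(2), of "wave \<omega> b"] by (simp only: F_def) simp
  define \<sigma> where "\<sigma> i = of_real h * (\<Sum>z\<in>Z. c z * z ^ i * (z / (z - 1)))" for i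
  define w where "w i = wave \<omega> (?x i) / \<zeta>" for i
  \<comment> \<open>W is smooth, so its part cancels at interior nodes; an end point has only one
    side, and there \<open>w\<close> remains.\<close>
  define C0 where "C0 i = (if i = 0 then \<sigma> 0 - w 0 else if i = N then w N - \<sigma> (N - 1) else \<sigma> i - \<sigma> (i - 1))" for i
  obtain n where n: "N = Suc n" using N by (cases N) auto
  have "sard_optimal m N a b \<omega> C \<longleftrightarrow> (\<forall>i\<le>N. C i = C0 i)"
  proof (rule sard_optimal_iff_representer[OF F.smooth_pieces_axioms mN nodes])
    fix \<phi> assume \<phi>: "\<phi> \<in> sobolev_space m a b"
    define y where "y i = \<phi> (?x i)" for i
    have s: "(-1) ^ m * ((-1) ^ m * x) = (x :: complex)" "(-1) ^ (m - 1) * ((-1) ^ m * x) = - x" for x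
      using m by (cases m; simp add: mult.assoc[symmetric] power_add[symmetric] mult_2[symmetric])+
    have "cnj (F.g (2 * m) x) = (-1) ^ m * wave \<omega> x" for x
      using \<zeta> by (simp add: glue_def F_def spl_2m)
    then have "(LINT x|lebesgue_on {a..b}. \<phi> x * cnj (F.g (2 * m) x))
      = (LINT x|lebesgue_on {a..b}. (-1) ^ m * (wave \<omega> x * \<phi> x))"
      by (intro Bochner_Integration.integral_cong refl) (simp only: mult_ac)
    then have I: "(-1) ^ m * (LINT x|lebesgue_on {a..b}. \<phi> x * cnj (F.g (2 * m) x))
      = (LINT x|lebesgue_on {a..b}. wave \<omega> x * \<phi> x)"
      by (simp only: integral_mult_right_zero s(1))
    have "\<zeta> ^ (2 * m - 1) / \<zeta> ^ (2 * m) = 1 / \<zeta>"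
      using \<zeta> m by (cases m) auto
    then have top: "cnj (F i (2 * m - 1) (?x j)) = (-1) ^ m * (w j - \<sigma> i)" for i j
      unfolding F_def w_def \<sigma>_def spl_top by simp
    have "(-1) ^ (m - 1) * F.jump_sum \<phi>
      = (\<Sum>i<N. (-1) ^ (m - 1) * ((-1) ^ m * (y (Suc i) * (w (Suc i) - \<sigma> i) - y i * (w i - \<sigma> i))))"
      unfolding F.jump_sum_def top y_def[symmetric] sum_distrib_left by (intro sum.cong refl) (simp add: algebra_simps)
    also have "\<dots> = - ((\<Sum>i<N. y (Suc i) * w (Suc i) - y i * w i) + (\<Sum>i<N. \<sigma> i * (y i - y (Suc i))))"
      unfolding s sum.distrib[symmetric] sum_negf[symmetric] by (intro sum.cong refl) (simp add: algebra_simps)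
    also have "(\<Sum>i<N. y (Suc i) * w (Suc i) - y i * w i) = y N * w N - y 0 * w 0"
      by (rule sum_lessThan_telescope)
    also have "(\<Sum>i<N. \<sigma> i * (y i - y (Suc i))) =
       y 0 * \<sigma> 0 - y N * \<sigma> (N - 1) + (\<Sum>i=1..n. y i * (\<sigma> i - \<sigma> (i - 1)))"
      unfolding n sum_summation_by_parts by simp
    also have "- (y N * w N - y 0 * w 0 + (y 0 * \<sigma> 0 - y N * \<sigma> (N - 1) + (\<Sum>i=1..n. y i * (\<sigma> i - \<sigma> (i - 1)))))
      = - (C0 0 * y 0 + (\<Sum>i=1..n. C0 i * y i) + C0 N * y N)"
    proof -
      have "(\<Sum>i=1..n. y i * (\<sigma> i - \<sigma> (i - 1))) = (\<Sum>i=1..n. C0 i * y i)"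
        by (intro sum.cong refl) (auto simp: C0_def n)
      moreover have "C0 0 = \<sigma> 0 - w 0" "C0 N = w N - \<sigma> (N - 1)" using N by (auto simp: C0_def)
      ultimately show ?thesis by (simp only:) (simp add: algebra_simps)
    qed
    also have "C0 0 * y 0 + (\<Sum>i=1..n. C0 i * y i) + C0 N * y N = (\<Sum>i=0..N. C0 i * y i)"
      unfolding n by (simp add: sum.atLeast_Suc_atMost)
    finally have jumps: "(-1) ^ (m - 1) * F.jump_sum \<phi> = - (\<Sum>i=0..N. C0 i * y i)" .
    have "sobolev_inner m a b \<phi> (F.g 0) = (-1) ^ m * (LINT x|lebesgue_on {a..b}. \<phi> x * cnj (F.g (2 * m) x))
      + (-1) ^ (m - 1) * F.jump_sum \<phi>"
      by (rule F.sobolev_inner_glue_eq_jumps[OF \<phi>]) (use nat_a nat_b in auto)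
    then show "error_functional N a b \<omega> C0 \<phi> = sobolev_inner m a b \<phi> (F.g 0)"
      unfolding I jumps unfolding error_functional_def y_def node_def by simp
  qed
  also have "\<dots> \<longleftrightarrow> C 0 = C0 0 \<and> (\<forall>i\<in>{1..N - 1}. C i = C0 i) \<and> C N = C0 N"
  proof -
    have "{..N} = insert 0 ({1..N - 1} \<union> {N})" using N by auto
    then have "(\<forall>i\<in>{..N}. C i = C0 i) \<longleftrightarrow> (\<forall>i\<in>insert 0 ({1..N - 1} \<union> {N}). C i = C0 i)" by (simp only:)
    then show ?thesis by auto
  qed
  also have "C0 0 = of_real h * ((\<Sum>z\<in>Z. c z * (z / (z - 1))) - wave \<omega> a / \<kappa>)"
    using h0 \<zeta> by (simp add: C0_def \<sigma>_def w_def spl.node_0 \<kappa> right_diff_distrib)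
  also have "C0 N = of_real h * (wave \<omega> b / \<kappa> - (\<Sum>z\<in>Z. c z * (z ^ N / (z - 1))))"
  proof -
    have eq: "(\<Sum>z\<in>Z. c z * z ^ (N - 1) * (z / (z - 1))) = (\<Sum>z\<in>Z. c z * (z ^ N / (z - 1)))"
      unfolding n by (intro sum.cong) auto
    have "C0 N = w N - \<sigma> (N - 1)" using N by (simp add: C0_def)
    then show ?thesis
      unfolding \<sigma>_def eq w_def spl.node_N \<kappa> using h0 \<zeta> by (simp add: right_diff_distrib)
  qed
  also have "(\<forall>i\<in>{1..N - 1}. C i = C0 i) \<longleftrightarrow> (\<forall>i\<in>{1..N - 1}. C i = of_real h * (\<Sum>z\<in>Z. c z * z ^ i))"
  proof (intro ball_cong refl)
    fix i assume i: "i \<in> {1..N - 1}"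
    then obtain i' where i': "i = Suc i'" by (cases i) auto
    \<comment> \<open>The factor z / (z - 1) is the discrete primitive: (z^i - z^(i - 1)) * z / (z -
      1) = z^i.\<close>
    have "c z * z ^ i * (z / (z - 1)) - c z * z ^ (i - 1) * (z / (z - 1)) = c z * z ^ i" if "z \<in> Z" for z
    proof -
      have "z - 1 \<noteq> 0" using that Z by auto
      then show ?thesis
        unfolding i' by (simp add: divide_simps) (simp add: algebra_simps)
    qed
    then have "\<sigma> i - \<sigma> (i - 1) = of_real h * (\<Sum>z\<in>Z. c z * z ^ i)"
      unfolding \<sigma>_def right_diff_distrib[symmetric] sum_subtractf[symmetric] by simp
    then show "(C i = C0 i) = (C i = of_real h * (\<Sum>z\<in>Z. c z * z ^ i))"
      using i N by (auto simp: C0_def)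
  qed
  finally show ?thesis .
qed

end

section \<open>The linear system for the coefficients\<close>

text \<open>The shapes in which Abel sums occur in the system. Powers of q - 1 belong to the base 1
  / q, because q / (q - 1)^(t + 1) = (1 / q)^t / (1 - 1 / q)^(t + 1).\<close>

lemma abel_sum_system_forms:
  assumes q: "q \<noteq> 0" "q \<noteq> 1" and j: "j \<ge> 1"
  shows "(\<Sum>t=1..j. q ^ t * diff_zero t j / (1 - q) ^ (t + 1)) = abel_sum j q"
    and "(\<Sum>t=1..j. q ^ (N + t) * diff_zero t j / (1 - q) ^ (t + 1)) = q ^ N * abel_sum j q"
    and "(\<Sum>t=1..j. q * diff_zero t j / (q - 1) ^ (t + 1)) = abel_sum j (1 / q)"
    and "(\<Sum>t=1..j. q ^ (N + 1) * diff_zero t j / (q - 1) ^ (t + 1)) = q ^ N * abel_sum j (1 / q)"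
    and "x / (1 - q) * (\<Sum>t=1..j. (q / (1 - q)) ^ t * diff_zero t j) = x * abel_sum j q"
proof -
  have nz: "1 - q \<noteq> 0" "q - 1 \<noteq> 0" using q by auto
  have L: "abel_sum j z = (\<Sum>t=1..j. diff_zero t j * (z ^ t / (1 - z) ^ (t + 1)))" for z
    using j by (simp add: abel_sum_def)
  show "(\<Sum>t=1..j. q ^ t * diff_zero t j / (1 - q) ^ (t + 1)) = abel_sum j q"
    unfolding L by (simp add: mult_ac)
  show "(\<Sum>t=1..j. q ^ (N + t) * diff_zero t j / (1 - q) ^ (t + 1)) = q ^ N * abel_sum j q"
    unfolding L sum_distrib_left by (simp add: power_add mult_ac)
  have inv: "q / (q - 1) ^ (t + 1) = (1 / q) ^ t / (1 - 1 / q) ^ (t + 1)" for t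
  proof -
    have "1 - 1 / q = (q - 1) / q" using q by (simp add: field_simps)
    then show ?thesis using q nz by (simp add: power_divide)
  qed
  have "q * diff_zero t j / (q - 1) ^ (t + 1) = diff_zero t j * ((1 / q) ^ t / (1 - 1 / q) ^ (t + 1))" for t
    unfolding inv[symmetric] by simp
  then show 3: "(\<Sum>t=1..j. q * diff_zero t j / (q - 1) ^ (t + 1)) = abel_sum j (1 / q)"
    unfolding L by (simp only:)
  show "(\<Sum>t=1..j. q ^ (N + 1) * diff_zero t j / (q - 1) ^ (t + 1)) = q ^ N * abel_sum j (1 / q)"
    unfolding 3[symmetric] sum_distrib_left by (simp add: mult_ac)
  show "x / (1 - q) * (\<Sum>t=1..j. (q / (1 - q)) ^ t * diff_zero t j) = x * abel_sum j q"
    unfolding L sum_distrib_left by (intro sum.cong refl) (simp add: power_divide mult_ac)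
qed

section \<open>The bases of the optimal spline\<close>

locale optimal_system =
  fixes m N :: nat and a b h \<omega> :: real and q :: "nat \<Rightarrow> complex"
  assumes m: "m \<ge> 1" and N: "N \<ge> 1" and mN: "N + 1 \<ge> m" and ab: "a < b"
    and h: "h = (b - a) / real N" and om: "\<omega> * h \<notin> \<int>"
    and q: "bij_betw q {1..m - 1} {z. poly (euler_frobenius (2 * m - 2)) z = 0 \<and> cmod z < 1}"
begin

abbreviation \<mu> :: complex where "\<mu> \<equiv> wave \<omega> h"
abbreviation \<kappa> :: complex where "\<kappa> \<equiv> 2 * of_real pi * \<i> * of_real \<omega> * of_real h"
abbreviation K :: complex where "K \<equiv> of_real (K_const m h \<omega>)"

definition Z0 :: "complex set" where "Z0 = {z. poly (euler_frobenius (2 * m - 2)) z = 0}"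

lemma Z0_eq: "Z0 = q ` {1..m - 1} \<union> (\<lambda>z. 1 / z) ` q ` {1..m - 1}"
  and Z0_disj: "q ` {1..m - 1} \<inter> (\<lambda>z. 1 / z) ` q ` {1..m - 1} = {}"
  and card_Z0: "card Z0 = 2 * m - 2"
  and Z0_nz: "z \<in> Z0 \<Longrightarrow> z \<noteq> 0 \<and> cmod z \<noteq> 1"
  unfolding Z0_def using euler_frobenius_roots[OF m q] by simp_all

lemma finite_Z0: "finite Z0"
  by (simp add: Z0_eq)

lemma inj_q: "inj_on q {1..m - 1}"
  using q by (rule bij_betw_imp_inj_on)

lemma q_in: "k \<in> {1..m - 1} \<Longrightarrow> q k \<in> Z0" and q_inv_in: "k \<in> {1..m - 1} \<Longrightarrow> 1 / q k \<in> Z0"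
  by (auto simp: Z0_eq)

lemma q_nz: "k \<in> {1..m - 1} \<Longrightarrow> q k \<noteq> 0 \<and> q k \<noteq> 1"
proof -
  assume "k \<in> {1..m - 1}"
  then have "q k \<noteq> 0" "cmod (q k) \<noteq> 1" using Z0_nz[OF q_in] by blast+
  then show ?thesis by auto
qed

lemma sum_Z0: "(\<Sum>z\<in>Z0. f z) = (\<Sum>k=1..m - 1. f (q k) + f (1 / q k))"
proof -
  have "(\<Sum>z\<in>Z0. f z) = (\<Sum>z\<in>q ` {1..m - 1}. f z) + (\<Sum>z\<in>(\<lambda>z. 1 / z) ` q ` {1..m - 1}. f z)"
    unfolding Z0_eq by (rule sum.union_disjoint) (use Z0_disj in auto)
  also have "(\<Sum>z\<in>(\<lambda>z. 1 / z) ` q ` {1..m - 1}. f z) = (\<Sum>z\<in>q ` {1..m - 1}. f (1 / z))"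
    by (subst sum.reindex) (auto simp: inj_on_def)
  finally show ?thesis
    using inj_q by (simp add: sum.reindex sum.distrib)
qed

lemma root: "z \<in> Z0 \<Longrightarrow> abel_sum (2 * m - 1) z = 0"
proof -
  assume z: "z \<in> Z0"
  have "2 * m - 2 + 1 = 2 * m - 1" using m by simp
  moreover have "z \<noteq> 0" "z \<noteq> 1" using Z0_nz[OF z] by auto
  ultimately show ?thesis
    using abel_sum_euler_frobenius[of z "2 * m - 2"] z by (simp add: Z0_def)
qed

text \<open>The base \<mu> lies on the unit circle and no root does. Hence the denominator of K is
  nonzero, and the weight at \<mu> stays separate from the unknown weights at the roots.\<close>

lemma wave_h: "\<mu> \<noteq> 0" "\<mu> \<noteq> 1" "\<mu> \<notin> Z0"
proof -
  show "\<mu> \<noteq> 0" by (simp add: wave_def)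
  show "\<mu> \<noteq> 1" using om by (simp add: wave_eq_1_iff)
  have "cmod \<mu> = 1" by (simp add: wave_def)
  then show "\<mu> \<notin> Z0" using Z0_nz by blast
qed

lemma om_nz: "\<omega> \<noteq> 0"
  using om by auto

lemma wave_b: "wave \<omega> b = wave \<omega> a * \<mu> ^ N"
proof -
  have "b = h * real N + a" using N h by simp
  then show ?thesis using wave_node[of \<omega> h N a] by simp
qed

lemma K_identity: "K * abel_sum (2 * m - 1) \<mu> = fact (2 * m - 1) / \<kappa> ^ (2 * m)"
  using wave_h(3) by (intro K_const_abel_sum m om) (simp add: Z0_def)

text \<open>Two sets of bases are used: \<open>Z0\<close> for null splines and
  \<open>insert \<mu> Z0\<close> for the interpolating spline.\<close>

lemma spline_data: "Z \<subseteq> insert \<mu> Z0 \<Longrightarrow> spline_data m N a b h Z"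
  using m N ab h wave_h Z0_nz[of 0] Z0_nz[of 1] finite_subset[of Z "insert \<mu> Z0"] finite_Z0
  by unfold_locales auto

lemma kernel_trivial:
  assumes "\<And>j. 1 \<le> j \<Longrightarrow> j \<le> m - 1 \<Longrightarrow> (\<Sum>z\<in>Z0. c z * abel_sum j z) = 0"
    and "\<And>j. 1 \<le> j \<Longrightarrow> j \<le> m - 1 \<Longrightarrow> (\<Sum>z\<in>Z0. c z * z ^ N * abel_sum j z) = 0"
    and "z \<in> Z0"
  shows "c z = 0"
  using spline_data.natural_null_spline_trivial[OF spline_data[OF subset_insertI], of c z]
    mN card_Z0 root assms by simp

section \<open>The linear system as end conditions\<close>

text \<open>The defect in the end condition on the spline derivative of order \<open>2 * m - 1 - j\<close>, up to a
  nonzero factor.\<close>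

definition end_a :: "(nat \<Rightarrow> complex) \<Rightarrow> (nat \<Rightarrow> complex) \<Rightarrow> nat \<Rightarrow> complex" where
  "end_a A B j = (\<Sum>k=1..m - 1. A k * abel_sum j (q k) + B k * q k ^ N * abel_sum j (1 / q k))
     + K * wave \<omega> a * abel_sum j \<mu> - (-1) ^ (j + 1) * fact j * wave \<omega> a / \<kappa> ^ (j + 1)"

definition end_b :: "(nat \<Rightarrow> complex) \<Rightarrow> (nat \<Rightarrow> complex) \<Rightarrow> nat \<Rightarrow> complex" where
  "end_b A B j = (\<Sum>k=1..m - 1. A k * q k ^ N * abel_sum j (q k) + B k * abel_sum j (1 / q k))
     + K * wave \<omega> b * abel_sum j \<mu> - (-1) ^ (j + 1) * fact j * wave \<omega> b / \<kappa> ^ (j + 1)"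

text \<open>The system has base 1 / q k where \<open>end_a\<close> has q k, and conversely, and
  likewise 1 / \<mu> for \<mu>. By \<open>abel_sum_inverse\<close> this only multiplies the equation
  of order j by (-1) ^ (j + 1).\<close>

lemma system_left_iff:
  "system_left m N a h \<omega> q A B \<longleftrightarrow> (\<forall>j\<in>{1..m - 1}. end_a A B j = 0)"
  unfolding system_left_def
proof (intro ball_cong refl)
  fix j assume "j \<in> {1..m - 1}"
  then have j: "j \<ge> 1" by simp
  let ?S = "(\<Sum>k=1..m - 1. A k * (\<Sum>t=1..j. q k * diff_zero t j / (q k - 1) ^ (t + 1)))
     + (\<Sum>k=1..m - 1. B k * (\<Sum>t=1..j. q k ^ (N + t) * diff_zero t j / (1 - q k) ^ (t + 1)))"
  let ?Y = "\<Sum>t=1..j. wave \<omega> (a + h) * K * diff_zero t j / (\<mu> - 1) ^ (t + 1)"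
  define s where "s = ((-1) ^ (j + 1) :: complex)"
  have s: "s * (s * x) = x" for x
    by (simp add: s_def mult.assoc[symmetric] power_add[symmetric] mult_2[symmetric])
  have flip: "x * (s * u) + y * (v * u) = s * (x * u + y * v * (s * u))" for x y u v
  proof -
    have "s * (x * u + y * v * (s * u)) = x * (s * u) + y * v * (s * (s * u))"
      by (simp add: algebra_simps)
    then show ?thesis by (simp only: s mult.assoc)
  qed
  have inv: "abel_sum j (1 / z) = s * abel_sum j z" if "z \<noteq> 0" "z \<noteq> 1" for z
    using abel_sum_inverse[OF j that] by (simp add: s_def)
  have 1: "?S
    = (\<Sum>k=1..m - 1. s * (A k * abel_sum j (q k) + B k * q k ^ N * abel_sum j (1 / q k)))"
    unfolding sum.distrib[symmetric]
  proof (intro sum.cong refl)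
    fix k assume "k \<in> {1..m - 1}"
    then have k: "q k \<noteq> 0" "q k \<noteq> 1" using q_nz by auto
    show "A k * (\<Sum>t=1..j. q k * diff_zero t j / (q k - 1) ^ (t + 1))
       + B k * (\<Sum>t=1..j. q k ^ (N + t) * diff_zero t j / (1 - q k) ^ (t + 1))
      = s * (A k * abel_sum j (q k) + B k * q k ^ N * abel_sum j (1 / q k))"
      unfolding abel_sum_system_forms[OF k j] inv[OF k] by (rule flip)
  qed
  define T where "T = (\<Sum>k=1..m - 1. A k * abel_sum j (q k) + B k * q k ^ N * abel_sum j (1 / q k))"
  define Y where "Y = K * wave \<omega> a * (s * abel_sum j \<mu>)"
  define W where "W = fact j * wave \<omega> a / \<kappa> ^ (j + 1)"
  have 2: "?Y = Y"
    unfolding Y_def inv[OF wave_h(1,2), symmetric] abel_sum_system_forms(3)[OF wave_h(1,2) j, symmetric] sum_distrib_left wave_add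
    by (intro sum.cong refl) (simp add: mult_ac)
  have "end_a A B j = T + s * Y - s * W"
    unfolding end_a_def s_def[symmetric] T_def[symmetric] Y_def W_def
    using s[of "K * wave \<omega> a * abel_sum j \<mu>"] by (simp add: mult_ac)
  then have "s * end_a A B j = s * T + s * (s * Y) - s * (s * W)"
    by (simp only: distrib_left right_diff_distrib)
  then have 3: "s * end_a A B j = s * T + Y - W"
    by (simp only: s)
  have "s \<noteq> 0" by (simp add: s_def)
  then have "(end_a A B j = 0) = (s * end_a A B j = 0)" by simp
  also have "\<dots> = (s * T = W - Y)" unfolding 3 by (simp add: eq_diff_eq)
  finally show "(?S = fact j * wave \<omega> a / \<kappa> ^ (j + 1) - ?Y) = (end_a A B j = 0)"
    unfolding 1 2 W_def[symmetric] sum_distrib_left[symmetric] T_def[symmetric] by simp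
qed

text \<open>A right equation mixes the two ends. In the system the weights P i are powers of h / (b
  - a) = 1 / N, namely N ^ (j - i), as in a binomial expansion; their values do not enter the
  regrouping.\<close>

lemma system_right_eq_iff:
  fixes P :: "nat \<Rightarrow> complex"
  assumes j: "j \<ge> 1"
  shows "(\<Sum>k=1..m - 1. A k *
        ((\<Sum>t=1..j. q k ^ t * diff_zero t j / (1 - q k) ^ (t + 1))
         - (\<Sum>i=1..j. P i * of_nat (j choose i) *
              (\<Sum>t=1..i. q k ^ (N + t) * diff_zero t i / (1 - q k) ^ (t + 1)))))
     + (\<Sum>k=1..m - 1. B k *
        ((\<Sum>t=1..j. q k ^ (N + 1) * diff_zero t j / (q k - 1) ^ (t + 1))
         - (\<Sum>i=1..j. P i * of_nat (j choose i) *
              (\<Sum>t=1..i. q k * diff_zero t i / (q k - 1) ^ (t + 1)))))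
     = (-1) ^ (j + 1) * fact j * wave \<omega> a / \<kappa> ^ (j + 1)
       + (\<Sum>i=1..j. P i *
            ((-1) ^ i * fact j * wave \<omega> b
              / (fact (j - i) * \<kappa> ^ (i + 1))))
       - K * wave \<omega> a / (1 - \<mu>) *
            (\<Sum>t=1..j. (\<mu> / (1 - \<mu>)) ^ t * diff_zero t j)
       + K * wave \<omega> b / (1 - \<mu>) *
            (\<Sum>i=1..j. P i * of_nat (j choose i) *
              (\<Sum>t=1..i. (\<mu> / (1 - \<mu>)) ^ t * diff_zero t i))
    \<longleftrightarrow> end_a A B j = (\<Sum>i=1..j. P i * of_nat (j choose i) * end_b A B i)"
    (is "?A + ?B = _ + ?U - ?a + ?b \<longleftrightarrow> _")
proof -
  define R where "R i = P i * of_nat (j choose i)" for i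
  define X where "X k i = q k ^ N * abel_sum i (q k)" for k i
  define Y where "Y k i = abel_sum i (1 / q k)" for k i
  define V where "V i = (-1) ^ (i + 1) * fact i * wave \<omega> b / \<kappa> ^ (i + 1)" for i
  have 1: "?A
     = (\<Sum>k=1..m - 1. A k * (abel_sum j (q k) - (\<Sum>i=1..j. R i * X k i)))"
  proof (intro sum.cong refl arg_cong2[where f = "(*)"] arg_cong2[where f = "(-)"])
    fix k assume "k \<in> {1..m - 1}"
    then have k: "q k \<noteq> 0" "q k \<noteq> 1" using q_nz by auto
    show "(\<Sum>t=1..j. q k ^ t * diff_zero t j / (1 - q k) ^ (t + 1)) = abel_sum j (q k)"
      by (rule abel_sum_system_forms[OF k j])
    fix i assume "i \<in> {1..j}"
    then have "i \<ge> 1" by simp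
    then show "(\<Sum>t=1..i. q k ^ (N + t) * diff_zero t i / (1 - q k) ^ (t + 1)) = X k i"
      unfolding X_def by (rule abel_sum_system_forms(2)[OF k])
  qed (simp add: R_def)
  have 2: "?B
     = (\<Sum>k=1..m - 1. B k * (q k ^ N * abel_sum j (1 / q k) - (\<Sum>i=1..j. R i * Y k i)))"
  proof (intro sum.cong refl arg_cong2[where f = "(*)"] arg_cong2[where f = "(-)"])
    fix k assume "k \<in> {1..m - 1}"
    then have k: "q k \<noteq> 0" "q k \<noteq> 1" using q_nz by auto
    show "(\<Sum>t=1..j. q k ^ (N + 1) * diff_zero t j / (q k - 1) ^ (t + 1)) = q k ^ N * abel_sum j (1 / q k)"
      by (rule abel_sum_system_forms[OF k j])
    fix i assume "i \<in> {1..j}"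
    then have "i \<ge> 1" by simp
    then show "(\<Sum>t=1..i. q k * diff_zero t i / (q k - 1) ^ (t + 1)) = Y k i"
      unfolding Y_def by (rule abel_sum_system_forms(3)[OF k])
  qed (simp add: R_def)
  have 3: "?a = K * wave \<omega> a * abel_sum j \<mu>"
    by (rule abel_sum_system_forms(5)[OF wave_h(1,2) j])
  have 4: "?b
     = (\<Sum>i=1..j. R i * (K * wave \<omega> b * abel_sum i \<mu>))"
    unfolding sum_distrib_left[of "K * wave \<omega> b / (1 - \<mu>)"]
  proof (intro sum.cong refl)
    fix i assume "i \<in> {1..j}"
    then have "i \<ge> 1" by simp
    from abel_sum_system_forms(5)[OF wave_h(1,2) this, of "K * wave \<omega> b"]
    show "K * wave \<omega> b / (1 - \<mu>) * (P i * of_nat (j choose i) * (\<Sum>t=1..i. (\<mu> / (1 - \<mu>)) ^ t * diff_zero t i))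
      = R i * (K * wave \<omega> b * abel_sum i \<mu>)"
      unfolding R_def mult.left_commute[of "K * wave \<omega> b / (1 - \<mu>)"] by (simp only:)
  qed
  have 5: "?U = - (\<Sum>i=1..j. R i * V i)"
    unfolding sum_negf[symmetric]
  proof (intro sum.cong refl)
    fix i assume "i \<in> {1..j}"
    then have "of_nat (j choose i) * fact i = (fact j / fact (j - i) :: complex)"
      by (simp add: binomial_fact)
    then have fact: "fact j / fact (j - i) = of_nat (j choose i) * (fact i :: complex)" ..
    define d where "d = \<kappa> ^ (i + 1)"
    have "P i * ((-1) ^ i * fact j * wave \<omega> b / (fact (j - i) * d))
      = P i * ((-1) ^ i * (fact j / fact (j - i)) * wave \<omega> b / d)"
      by simp
    then show "P i * ((-1) ^ i * fact j * wave \<omega> b / (fact (j - i) * \<kappa> ^ (i + 1))) = - (R i * V i)"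
      unfolding R_def V_def d_def[symmetric] fact by simp
  qed
  have 6: "(\<Sum>k=1..m - 1. A k * (abel_sum j (q k) - (\<Sum>i=1..j. R i * X k i)))
      + (\<Sum>k=1..m - 1. B k * (q k ^ N * abel_sum j (1 / q k) - (\<Sum>i=1..j. R i * Y k i)))
    = (\<Sum>k=1..m - 1. A k * abel_sum j (q k) + B k * q k ^ N * abel_sum j (1 / q k))
      - (\<Sum>i=1..j. R i * (\<Sum>k=1..m - 1. A k * X k i + B k * Y k i))"
  proof -
    have "(\<Sum>i=1..j. R i * (\<Sum>k=1..m - 1. A k * X k i + B k * Y k i))
      = (\<Sum>k=1..m - 1. \<Sum>i=1..j. R i * (A k * X k i + B k * Y k i))"
      unfolding sum_distrib_left by (rule sum.swap)
    also have "\<dots> = (\<Sum>k=1..m - 1. A k * (\<Sum>i=1..j. R i * X k i) + B k * (\<Sum>i=1..j. R i * Y k i))"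
      unfolding sum_distrib_left sum.distrib[symmetric] by (intro sum.cong refl) (simp add: algebra_simps)
    finally show ?thesis
      unfolding sum.distrib[symmetric] sum_subtractf[symmetric] right_diff_distrib
      by (simp add: algebra_simps sum.distrib sum_subtractf)
  qed
  have 7: "(\<Sum>i=1..j. R i * end_b A B i) = (\<Sum>i=1..j. R i * (\<Sum>k=1..m - 1. A k * X k i + B k * Y k i))
      + (\<Sum>i=1..j. R i * (K * wave \<omega> b * abel_sum i \<mu>)) - (\<Sum>i=1..j. R i * V i)"
    unfolding sum.distrib[symmetric] sum_subtractf[symmetric]
    by (intro sum.cong refl) (simp add: end_b_def X_def Y_def V_def algebra_simps)
  have 8: "x = y \<longleftrightarrow> x' = y'" if "x - y = x' - y'" for x y x' y' :: complex
    using that by (metis eq_iff_diff_eq_0)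
  show ?thesis
    unfolding 1 2 3 4 5 6 unfolding R_def[symmetric] 7
    by (rule 8) (simp add: end_a_def)
qed

abbreviation solves :: "(nat \<Rightarrow> complex) \<Rightarrow> (nat \<Rightarrow> complex) \<Rightarrow> bool" where
  "solves A B \<equiv> system_left m N a h \<omega> q A B \<and> system_right m N a b h \<omega> q A B"

text \<open>Once \<open>end_a\<close> vanishes, the right equations are triangular in
  \<open>end_b\<close> with diagonal weight (h / (b - a)) powi 0 = 1, so the orders are cleared one
  after the other.\<close>

lemma system_iff:
  "solves A B \<longleftrightarrow>
    (\<forall>j\<in>{1..m - 1}. end_a A B j = 0 \<and> end_b A B j = 0)"
proof -
  define P where "P j i = (of_real (h / (b - a)) powi (int i - int j) :: complex)" for j i :: nat
  have right: "system_right m N a b h \<omega> q A B \<longleftrightarrow>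
    (\<forall>j\<in>{1..m - 1}. end_a A B j = (\<Sum>i=1..j. P j i * of_nat (j choose i) * end_b A B i))"
    unfolding system_right_def P_def[symmetric]
    by (intro ball_cong refl system_right_eq_iff) simp
  show ?thesis
  proof
    assume *: "solves A B"
    then have end_a: "\<And>j. j \<in> {1..m - 1} \<Longrightarrow> end_a A B j = 0" by (simp add: system_left_iff)
    have "1 \<le> j \<Longrightarrow> j \<le> m - 1 \<Longrightarrow> end_b A B j = 0" for j
    proof (induction j rule: less_induct)
      case (less j)
      have "0 = (\<Sum>i=1..j. P j i * of_nat (j choose i) * end_b A B i)"
        using * end_a[of j] less.prems unfolding right by auto
      also have "\<dots> = P j j * of_nat (j choose j) * end_b A B j
          + (\<Sum>i\<in>{1..j} - {j}. P j i * of_nat (j choose i) * end_b A B i)"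
        using less.prems by (intro sum.remove) auto
      also have "(\<Sum>i\<in>{1..j} - {j}. P j i * of_nat (j choose i) * end_b A B i) = 0"
        using less by (intro sum.neutral) auto
      finally show ?case by (simp add: P_def)
    qed
    with end_a show "\<forall>j\<in>{1..m - 1}. end_a A B j = 0 \<and> end_b A B j = 0" by simp
  next
    assume *: "\<forall>j\<in>{1..m - 1}. end_a A B j = 0 \<and> end_b A B j = 0"
    then have "(\<Sum>i=1..j. P j i * of_nat (j choose i) * end_b A B i) = 0" if "j \<in> {1..m - 1}" for j
      using that by (intro sum.neutral) auto
    with * show "solves A B"
      unfolding right system_left_iff by simp
  qed
qed

section \<open>Existence, uniqueness and the coefficient formulas\<close>

text \<open>The power (1 / z) ^ N normalizes at the right end: for z = 1 / q k the term at the node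
  i is B k * q k ^ (N - i), which decays away from b as A k * q k ^ i decays away from a.\<close>

definition coef :: "(nat \<Rightarrow> complex) \<Rightarrow> (nat \<Rightarrow> complex) \<Rightarrow> complex \<Rightarrow> complex" where
  "coef A B z = (if z = \<mu> then K * wave \<omega> a
     else if z \<in> q ` {1..m - 1} then A (the_inv_into {1..m - 1} q z)
     else B (the_inv_into {1..m - 1} q (1 / z)) * (1 / z) ^ N)"

lemma coef_q:
  assumes k: "k \<in> {1..m - 1}"
  shows "coef A B (q k) = A k" "coef A B (1 / q k) = B k * q k ^ N"
proof -
  have "q k \<noteq> \<mu>" "1 / q k \<noteq> \<mu>" using q_in[OF k] q_inv_in[OF k] wave_h(3) by auto
  moreover have "1 / q k \<notin> q ` {1..m - 1}" using Z0_disj k by blast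
  ultimately show "coef A B (q k) = A k" "coef A B (1 / q k) = B k * q k ^ N"
    using k the_inv_into_f_f[OF inj_q k] by (auto simp: coef_def)
qed

lemma sum_coef_Z0:
  "(\<Sum>z\<in>Z0. coef A B z * f z) = (\<Sum>k=1..m - 1. A k * f (q k) + B k * q k ^ N * f (1 / q k))"
  unfolding sum_Z0 by (intro sum.cong refl) (simp only: coef_q)

lemma sum_coef:
  "(\<Sum>z\<in>insert \<mu> Z0. coef A B z * f z)
    = K * wave \<omega> a * f \<mu> + (\<Sum>k=1..m - 1. A k * f (q k) + B k * q k ^ N * f (1 / q k))"
proof -
  have "coef A B \<mu> = K * wave \<omega> a" by (simp add: coef_def)
  then show ?thesis using wave_h(3) finite_Z0 by (simp add: sum_coef_Z0)
qed

lemma q_power_cancel: "k \<in> {1..m - 1} \<Longrightarrow> i \<le> N \<Longrightarrow> q k ^ N * (1 / q k) ^ i = q k ^ (N - i)"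
  using q_nz[of k] by (simp add: power_diff power_divide)

lemma system_solution_exists:
  "\<exists>A B. solves A B"
proof -
  \<comment> \<open>A row is an order together with a Boolean, True for the end b. There are 2 * m -
    2 rows, as many as roots.\<close>
  define M where "M y z = (if snd y then z ^ N else 1) * abel_sum (fst y) z" for y :: "nat \<times> bool" and z
  define r where "r y = (if snd y then - (K * wave \<omega> b * abel_sum (fst y) \<mu>) + (-1) ^ (fst y + 1) * fact (fst y) * wave \<omega> b / \<kappa> ^ (fst y + 1)
     else - (K * wave \<omega> a * abel_sum (fst y) \<mu>) + (-1) ^ (fst y + 1) * fact (fst y) * wave \<omega> a / \<kappa> ^ (fst y + 1))"
    for y :: "nat \<times> bool"
  have "\<exists>c. \<forall>y\<in>{1..m - 1} \<times> UNIV. (\<Sum>z\<in>Z0. M y z * c z) = r y"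
  proof (rule square_system_solvable)
    show "card ({1..m - 1} \<times> (UNIV :: bool set)) = card Z0"
      by (simp add: card_Z0 card_cartesian_product)
    show "\<forall>z\<in>Z0. c z = 0" if ker: "\<And>y. y \<in> {1..m - 1} \<times> UNIV \<Longrightarrow> (\<Sum>z\<in>Z0. M y z * c z) = 0" for c
    proof
      fix z assume z: "z \<in> Z0"
      show "c z = 0"
      proof (rule kernel_trivial[OF _ _ z])
        show "(\<Sum>z\<in>Z0. c z * abel_sum j z) = 0" if "1 \<le> j" "j \<le> m - 1" for j
          using ker[of "(j, False)"] that
          by (simp add: M_def mult_ac)
        show "(\<Sum>z\<in>Z0. c z * z ^ N * abel_sum j z) = 0" if "1 \<le> j" "j \<le> m - 1" for j
          using ker[of "(j, True)"] that
          by (simp add: M_def mult_ac)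
      qed
    qed
  qed (auto simp: finite_Z0)
  then obtain c where c: "\<And>y. y \<in> {1..m - 1} \<times> UNIV \<Longrightarrow> (\<Sum>z\<in>Z0. M y z * c z) = r y" by blast
  define A where "A k = c (q k)" for k
  \<comment> \<open>Undoes the normalization of \<open>coef\<close> at 1 / q k.\<close>
  define B where "B k = c (1 / q k) / q k ^ N" for k
  have "end_a A B j = 0 \<and> end_b A B j = 0" if j: "j \<in> {1..m - 1}" for j
  proof
    have "(\<Sum>k=1..m - 1. A k * abel_sum j (q k) + B k * q k ^ N * abel_sum j (1 / q k)) = (\<Sum>z\<in>Z0. M (j, False) z * c z)"
      unfolding sum_Z0 using q_nz by (intro sum.cong refl) (simp add: A_def B_def M_def)
    then show "end_a A B j = 0"
      using c[of "(j, False)"] j by (simp add: end_a_def r_def)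
    have "(\<Sum>k=1..m - 1. A k * q k ^ N * abel_sum j (q k) + B k * abel_sum j (1 / q k)) = (\<Sum>z\<in>Z0. M (j, True) z * c z)"
      unfolding sum_Z0 using q_nz by (intro sum.cong refl) (simp add: A_def B_def M_def power_divide)
    then show "end_b A B j = 0"
      using c[of "(j, True)"] j by (simp add: end_b_def r_def)
  qed
  then show ?thesis using system_iff[of A B] by blast
qed

text \<open>The terms with K and the waves cancel in the difference of two solutions, which
  therefore holds the weights of a natural null spline.\<close>

lemma system_solution_unique:
  assumes 1: "solves A B"
    and 2: "solves A' B'"
    and k: "k \<in> {1..m - 1}"
  shows "A k = A' k \<and> B k = B' k"
proof -
  define c where "c = coef (\<lambda>k. A k - A' k) (\<lambda>k. B k - B' k)"
  have zero: "c z = 0" if z: "z \<in> Z0" for z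
  proof (rule kernel_trivial[OF _ _ z])
    fix j assume j: "1 \<le> j" "j \<le> m - 1"
    then have e: "end_a A B j = 0" "end_b A B j = 0" "end_a A' B' j = 0" "end_b A' B' j = 0"
      using 1 2 unfolding system_iff by auto
    have "(\<Sum>z\<in>Z0. c z * abel_sum j z) = end_a A B j - end_a A' B' j"
      unfolding c_def sum_coef_Z0 end_a_def
      by (simp add: sum_subtractf[symmetric] algebra_simps)
    then show "(\<Sum>z\<in>Z0. c z * abel_sum j z) = 0" using e by simp
    have "(\<Sum>z\<in>Z0. c z * z ^ N * abel_sum j z) = (\<Sum>z\<in>Z0. c z * (z ^ N * abel_sum j z))"
      by (simp add: mult.assoc)
    also have "\<dots> = (\<Sum>k=1..m - 1. (A k - A' k) * q k ^ N * abel_sum j (q k) + (B k - B' k) * abel_sum j (1 / q k))"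
      unfolding c_def sum_coef_Z0 using q_nz by (intro sum.cong refl) (simp add: power_divide)
    also have "\<dots> = end_b A B j - end_b A' B' j"
      unfolding end_b_def by (simp add: sum_subtractf[symmetric] algebra_simps)
    finally show "(\<Sum>z\<in>Z0. c z * z ^ N * abel_sum j z) = 0" using e by simp
  qed
  show ?thesis
    using zero[OF q_in[OF k]] zero[OF q_inv_in[OF k]] q_nz[OF k] unfolding c_def coef_q[OF k] by simp
qed

lemma sard_optimal_iff:
  assumes sys: "solves A B"
  shows "sard_optimal m N a b \<omega> C \<longleftrightarrow>
        C 0 = of_real h *
          (wave \<omega> (a + h) * K / (\<mu> - 1) - wave \<omega> a / \<kappa>
           + (\<Sum>k=1..m - 1. A k * (q k / (q k - 1)) + B k * (q k ^ N / (1 - q k)))) \<and>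
        (\<forall>\<beta>\<in>{1..N - 1}. C \<beta> = of_real h *
          (wave \<omega> (h * real \<beta> + a) * K
           + (\<Sum>k=1..m - 1. A k * q k ^ \<beta> + B k * q k ^ (N - \<beta>)))) \<and>
        C N = of_real h *
          (wave \<omega> b * K / (1 - \<mu>) + wave \<omega> b / \<kappa>
           + (\<Sum>k=1..m - 1. A k * (q k ^ N / (1 - q k)) + B k * (q k / (q k - 1))))"
proof -
  interpret spline_data m N a b h "insert \<mu> Z0" "coef A B"
    by (rule spline_data) simp
  let ?Z = "insert \<mu> Z0" and ?c = "coef A B"
  have "sard_optimal m N a b \<omega> C \<longleftrightarrow>
    C 0 = of_real h * ((\<Sum>z\<in>?Z. ?c z * (z / (z - 1))) - wave \<omega> a / \<kappa>) \<and>
    (\<forall>i\<in>{1..N - 1}. C i = of_real h * (\<Sum>z\<in>?Z. ?c z * z ^ i)) \<and>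
    C N = of_real h * (wave \<omega> b / \<kappa> - (\<Sum>z\<in>?Z. ?c z * (z ^ N / (z - 1))))"
  proof (rule sard_optimal_iff_interpolating_spline)
    show "m \<le> N + 1" "\<omega> \<noteq> 0" using mN om_nz by auto
    fix i
    \<comment> \<open>The roots annihilate the Abel sum of order 2 * m - 1, so the nodal values come
      from \<mu> alone and \<open>K_identity\<close> evaluates them.\<close>
    have "(\<Sum>z\<in>?Z. ?c z * z ^ i * abel_sum (2 * m - 1) z)
      = (\<Sum>z\<in>{\<mu>}. ?c z * z ^ i * abel_sum (2 * m - 1) z)"
      using root finite_Z0 by (intro sum.mono_neutral_right) auto
    also have "\<dots> = wave \<omega> a * \<mu> ^ i * (K * abel_sum (2 * m - 1) \<mu>)"
      by (simp add: coef_def)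
    also have "\<dots> = fact (2 * m - 1) * wave \<omega> (node N a b i) / \<kappa> ^ (2 * m)"
      unfolding K_identity node_eq wave_node by simp
    finally show "(\<Sum>z\<in>?Z. ?c z * z ^ i * abel_sum (2 * m - 1) z)
      = fact (2 * m - 1) * wave \<omega> (node N a b i) / \<kappa> ^ (2 * m)" .
  next
    fix j assume j: "1 \<le> j" "j \<le> m - 1"
    then have e: "end_a A B j = 0" "end_b A B j = 0" using sys unfolding system_iff by auto
    show "(\<Sum>z\<in>?Z. ?c z * abel_sum j z) = (-1) ^ (j + 1) * fact j * wave \<omega> a / \<kappa> ^ (j + 1)"
      using e(1) unfolding sum_coef end_a_def by (simp only: right_minus_eq add.commute)
    have "(\<Sum>z\<in>?Z. ?c z * z ^ N * abel_sum j z)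
      = (\<Sum>z\<in>?Z. ?c z * (z ^ N * abel_sum j z))"
      by (simp only: mult.assoc)
    also have "\<dots> = K * wave \<omega> a * (\<mu> ^ N * abel_sum j \<mu>)
        + (\<Sum>k=1..m - 1. A k * q k ^ N * abel_sum j (q k) + B k * abel_sum j (1 / q k))"
      unfolding sum_coef
    proof (intro arg_cong2[where f = "(+)"] sum.cong refl)
      fix k assume "k \<in> {1..m - 1}"
      then have "q k \<noteq> 0" using q_nz by blast
      then show "B k * q k ^ N * ((1 / q k) ^ N * abel_sum j (1 / q k)) = B k * abel_sum j (1 / q k)"
        by (simp add: power_divide)
    qed (simp only: mult.assoc)
    finally show "(\<Sum>z\<in>?Z. ?c z * z ^ N * abel_sum j z) = (-1) ^ (j + 1) * fact j * wave \<omega> b / \<kappa> ^ (j + 1)"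
      using e(2) unfolding end_b_def wave_b by (simp only: right_minus_eq add.commute mult.assoc)
  qed
  also have "(\<Sum>z\<in>?Z. ?c z * (z / (z - 1))) - wave \<omega> a / \<kappa>
    = wave \<omega> (a + h) * K / (\<mu> - 1) - wave \<omega> a / \<kappa>
      + (\<Sum>k=1..m - 1. A k * (q k / (q k - 1)) + B k * (q k ^ N / (1 - q k)))"
  proof -
    \<comment> \<open>The base 1 / q k is expressed in q k, which turns the denominator 1 / q k - 1
      into 1 - q k.\<close>
    have "q k ^ N * (1 / q k / (1 / q k - 1)) = q k ^ N / (1 - q k)" if "k \<in> {1..m - 1}" for k
      using q_nz[OF that] by (simp add: divide_simps)
    then have "(\<Sum>k=1..m - 1. A k * (q k / (q k - 1)) + B k * q k ^ N * (1 / q k / (1 / q k - 1)))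
      = (\<Sum>k=1..m - 1. A k * (q k / (q k - 1)) + B k * (q k ^ N / (1 - q k)))"
      by (intro sum.cong refl) (simp only: mult.assoc)
    then show ?thesis unfolding sum_coef wave_add by (simp add: algebra_simps)
  qed
  also have "(\<forall>i\<in>{1..N - 1}. C i = of_real h * (\<Sum>z\<in>?Z. ?c z * z ^ i)) \<longleftrightarrow>
    (\<forall>\<beta>\<in>{1..N - 1}. C \<beta> = of_real h * (wave \<omega> (h * real \<beta> + a) * K
           + (\<Sum>k=1..m - 1. A k * q k ^ \<beta> + B k * q k ^ (N - \<beta>))))"
  proof (intro ball_cong refl)
    fix i assume i: "i \<in> {1..N - 1}"
    then have "(\<Sum>k=1..m - 1. A k * q k ^ i + B k * q k ^ N * (1 / q k) ^ i)
      = (\<Sum>k=1..m - 1. A k * q k ^ i + B k * q k ^ (N - i))"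
      by (intro sum.cong refl) (simp only: mult.assoc q_power_cancel, auto simp: q_power_cancel)
    then show "(C i = of_real h * (\<Sum>z\<in>?Z. ?c z * z ^ i)) =
      (C i = of_real h * (wave \<omega> (h * real i + a) * K
           + (\<Sum>k=1..m - 1. A k * q k ^ i + B k * q k ^ (N - i))))"
      unfolding sum_coef wave_node by (simp add: mult_ac)
  qed
  also have "wave \<omega> b / \<kappa> - (\<Sum>z\<in>?Z. ?c z * (z ^ N / (z - 1)))
    = wave \<omega> b * K / (1 - \<mu>) + wave \<omega> b / \<kappa>
      + (\<Sum>k=1..m - 1. A k * (q k ^ N / (1 - q k)) + B k * (q k / (q k - 1)))"
  proof -
    have "A k * (q k ^ N / (1 - q k)) + B k * (q k / (q k - 1))
      = - (A k * (q k ^ N / (q k - 1)) + B k * q k ^ N * ((1 / q k) ^ N / (1 / q k - 1)))" if k: "k \<in> {1..m - 1}" for k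
    proof -
      have nz: "q k \<noteq> 0" "q k - 1 \<noteq> 0" "1 - q k \<noteq> 0" using q_nz[OF k] by auto
      have "q k ^ N * ((1 / q k) ^ N / (1 / q k - 1)) = 1 / (1 / q k - 1)"
        using nz by (simp add: power_divide)
      also have "\<dots> = - (q k / (q k - 1))" using nz by (simp add: divide_simps) (simp add: algebra_simps)
      finally have 1: "q k ^ N * ((1 / q k) ^ N / (1 / q k - 1)) = - (q k / (q k - 1))" .
      have 2: "q k ^ N / (1 - q k) = - (q k ^ N / (q k - 1))" using nz by (simp add: divide_simps) (simp add: algebra_simps)
      show ?thesis unfolding mult.assoc 1 2 by simp
    qed
    then have "(\<Sum>k=1..m - 1. A k * (q k ^ N / (1 - q k)) + B k * (q k / (q k - 1)))
      = - (\<Sum>k=1..m - 1. A k * (q k ^ N / (q k - 1)) + B k * q k ^ N * ((1 / q k) ^ N / (1 / q k - 1)))"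
      unfolding sum_negf[symmetric] by (intro sum.cong refl)
    moreover have "wave \<omega> b * K / (1 - \<mu>) = - (K * wave \<omega> a * (\<mu> ^ N / (\<mu> - 1)))"
    proof -
      have "1 - \<mu> = - (\<mu> - 1)" by simp
      then show ?thesis unfolding wave_b by (simp only: divide_minus_right) simp
    qed
    ultimately show ?thesis unfolding sum_coef by simp
  qed
  finally show ?thesis .
qed

end

theorem theorem9:
  fixes m N :: nat and a b h \<omega> :: real and q :: "nat \<Rightarrow> complex"
  assumes "m \<ge> 1" and "N \<ge> 1" and "N + 1 \<ge> m"
    and "a < b"
    and "h = (b - a) / real N"
    and "\<omega> * h \<notin> \<int>"
    and "bij_betw q {1..m - 1} {z. poly (euler_frobenius (2 * m - 2)) z = 0 \<and> cmod z < 1}"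
  shows "euler_frobenius (2 * m - 2) = (\<Sum>s=0..2 * m - 2. monom (of_real (ef_coeff m s)) s) \<and>
    (\<exists>A B. system_left m N a h \<omega> q A B \<and> system_right m N a b h \<omega> q A B) \<and>
    (\<forall>A B A' B'.
      system_left m N a h \<omega> q A B \<and> system_right m N a b h \<omega> q A B \<and>
      system_left m N a h \<omega> q A' B' \<and> system_right m N a b h \<omega> q A' B' \<longrightarrow>
      (\<forall>k\<in>{1..m - 1}. A k = A' k \<and> B k = B' k)) \<and>
    (\<forall>A B C.
      system_left m N a h \<omega> q A B \<and> system_right m N a b h \<omega> q A B \<longrightarrow>
      (sard_optimal m N a b \<omega> C \<longleftrightarrow>
        C 0 = of_real h *
          (wave \<omega> (a + h) * of_real (K_const m h \<omega>) / (wave \<omega> h - 1)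
           - wave \<omega> a / (2 * of_real pi * \<i> * of_real \<omega> * of_real h)
           + (\<Sum>k=1..m - 1. A k * (q k / (q k - 1)) + B k * (q k ^ N / (1 - q k)))) \<and>
        (\<forall>\<beta>\<in>{1..N - 1}. C \<beta> = of_real h *
          (wave \<omega> (h * real \<beta> + a) * of_real (K_const m h \<omega>)
           + (\<Sum>k=1..m - 1. A k * q k ^ \<beta> + B k * q k ^ (N - \<beta>)))) \<and>
        C N = of_real h *
          (wave \<omega> b * of_real (K_const m h \<omega>) / (1 - wave \<omega> h)
           + wave \<omega> b / (2 * of_real pi * \<i> * of_real \<omega> * of_real h)
           + (\<Sum>k=1..m - 1. A k * (q k ^ N / (1 - q k)) + B k * (q k / (q k - 1))))))"
proof -
  interpret optimal_system m N a b h \<omega> q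
    by unfold_locales (fact assms)+
  show ?thesis
  proof (intro conjI allI impI ballI)
    fix A B A' B' k
    assume "system_left m N a h \<omega> q A B \<and> system_right m N a b h \<omega> q A B \<and>
      system_left m N a h \<omega> q A' B' \<and>
      system_right m N a b h \<omega> q A' B'" "k \<in> {1..m - 1}"
    then show "A k = A' k" "B k = B' k"
      using system_solution_unique[of A B A' B' k] by auto
  qed (rule euler_frobenius_expansion[OF m] system_solution_exists sard_optimal_iff, assumption?)+
qed

end
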